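(* Let $c\in W^{1,\infty}_{\rm loc}(\mathbf R)$ be a non-negative function and let $H$ be the operator on $L_2(\mathbf R)$ with domain $D(H)=C_c^\infty(\mathbf R)$ and action $H\varphi=-(c\,\varphi')'$. Then $H$ has a unique submarkovian extension.
   Context: A lower semibounded self-adjoint operator $K$ on $L_2(\mathbf R)$ generates the semigroup $S_t=e^{-tK}$; it is submarkovian if $0\le\varphi\le 1$ implies $0\le S_t\varphi\le 1$ for all $t>0$. A submarkovian extension of $H$ is a self-adjoint extension of $H$ which generates a submarkovian semigroup. The function $c$ is allowed to vanish on an arbitrary closed set. *)

theory Defs
  imports "HOL-Analysis.Analysis" "HOL-Library.Complex_Order"
begin

section \<open>The complex Hilbert space of square-integrable functions on the line\<close>

text \<open>Borel measurability loses nothing here: every Lebesgue measurable function agrees almost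
  everywhere with a Borel measurable one.\<close>

definition square_integrable :: "(real \<Rightarrow> complex) \<Rightarrow> bool" where
  "square_integrable f \<longleftrightarrow>
     f \<in> borel_measurable lborel \<and> integrable lborel (\<lambda>x. (norm (f x))\<^sup>2)"

definition L2_eq :: "(real \<Rightarrow> complex) \<Rightarrow> (real \<Rightarrow> complex) \<Rightarrow> bool" where
  "L2_eq f g \<longleftrightarrow> square_integrable f \<and> square_integrable g \<and> (AE x in lborel. f x = g x)"

lemma square_integrable_zero: "square_integrable (\<lambda>x. 0)"
  by (simp add: square_integrable_def)

lemma square_integrable_add:
  assumes "square_integrable f" "square_integrable g"
  shows "square_integrable (\<lambda>x. f x + g x)"
proof -
  have [measurable]: "f \<in> borel_measurable lborel" "g \<in> borel_measurable lborel"
    and i: "integrable lborel (\<lambda>x. (norm (f x))\<^sup>2)" "integrable lborel (\<lambda>x. (norm (g x))\<^sup>2)"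
    using assms by (simp_all only: square_integrable_def)
  have bound: "(norm (f x + g x))\<^sup>2 \<le> 2 * (norm (f x))\<^sup>2 + 2 * (norm (g x))\<^sup>2" for x
  proof -
    have "(norm (f x + g x))\<^sup>2 \<le> (norm (f x) + norm (g x))\<^sup>2"
      by (intro power_mono norm_triangle_ineq norm_ge_zero)
    also have "\<dots> = (norm (f x))\<^sup>2 + (norm (g x))\<^sup>2 + 2 * norm (f x) * norm (g x)"
      by (rule power2_sum)
    also have "\<dots> \<le> 2 * (norm (f x))\<^sup>2 + 2 * (norm (g x))\<^sup>2"
      using sum_squares_bound[of "norm (f x)" "norm (g x)"] by linarith
    finally show ?thesis .
  qed
  have "integrable lborel (\<lambda>x. (norm (f x + g x))\<^sup>2)"
  proof (rule Bochner_Integration.integrable_bound)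
    show "integrable lborel (\<lambda>x. 2 * (norm (f x))\<^sup>2 + 2 * (norm (g x))\<^sup>2)"
      by (intro Bochner_Integration.integrable_add integrable_mult_right i)
    show "(\<lambda>x. (norm (f x + g x))\<^sup>2) \<in> borel_measurable lborel"
      by measurable
    show "AE x in lborel. norm ((norm (f x + g x))\<^sup>2)
        \<le> norm (2 * (norm (f x))\<^sup>2 + 2 * (norm (g x))\<^sup>2)"
    proof (rule AE_I2)
      fix x
      show "norm ((norm (f x + g x))\<^sup>2) \<le> norm (2 * (norm (f x))\<^sup>2 + 2 * (norm (g x))\<^sup>2)"
        using bound[of x] unfolding real_norm_def by (smt (verit) zero_le_power2)
    qed
  qed
  moreover have "(\<lambda>x. f x + g x) \<in> borel_measurable lborel"
    by measurable
  ultimately show ?thesis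
    unfolding square_integrable_def by blast
qed

lemma square_integrable_scale:
  assumes "square_integrable f"
  shows "square_integrable (\<lambda>x. a * f x)"
proof -
  have [measurable]: "f \<in> borel_measurable lborel"
    and i: "integrable lborel (\<lambda>x. (norm (f x))\<^sup>2)"
    using assms by (simp_all only: square_integrable_def)
  have "integrable lborel (\<lambda>x. (norm a)\<^sup>2 * (norm (f x))\<^sup>2)"
    by (intro integrable_mult_right i)
  moreover have "(\<lambda>x. a * f x) \<in> borel_measurable lborel"
    by measurable
  ultimately show ?thesis
    unfolding square_integrable_def norm_mult power_mult_distrib by blast
qed

lemma square_integrable_uminus:
  "square_integrable f \<Longrightarrow> square_integrable (\<lambda>x. - f x)"
  using square_integrable_scale[of f "-1"] by simp

lemma square_integrable_scaleR:
  "square_integrable f \<Longrightarrow> square_integrable (\<lambda>x. r *\<^sub>R f x)"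
  using square_integrable_scale[of f "complex_of_real r"] by (simp add: scaleR_conv_of_real)

lemma square_integrable_prod:
  assumes "square_integrable f" "square_integrable g"
  shows "integrable lborel (\<lambda>x. f x * cnj (g x))"
proof -
  have [measurable]: "f \<in> borel_measurable lborel" "g \<in> borel_measurable lborel"
    and i: "integrable lborel (\<lambda>x. (norm (f x))\<^sup>2)" "integrable lborel (\<lambda>x. (norm (g x))\<^sup>2)"
    using assms by (simp_all only: square_integrable_def)
  have [measurable]: "(\<lambda>x. cnj (g x)) \<in> borel_measurable lborel"
    by (rule borel_measurable_continuous_on[where f = cnj]) (intro continuous_intros, measurable)
  show ?thesis
  proof (rule Bochner_Integration.integrable_bound)
    show "integrable lborel (\<lambda>x. (norm (f x))\<^sup>2 + (norm (g x))\<^sup>2)"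
      by (intro Bochner_Integration.integrable_add i)
    show "(\<lambda>x. f x * cnj (g x)) \<in> borel_measurable lborel"
      by measurable
    show "AE x in lborel. norm (f x * cnj (g x)) \<le> norm ((norm (f x))\<^sup>2 + (norm (g x))\<^sup>2)"
    proof (rule AE_I2)
      fix x
      have "norm (f x) * norm (g x) \<ge> 0" by simp
      then show "norm (f x * cnj (g x)) \<le> norm ((norm (f x))\<^sup>2 + (norm (g x))\<^sup>2)"
        using sum_squares_bound[of "norm (f x)" "norm (g x)"]
        unfolding norm_mult complex_mod_cnj real_norm_def by linarith
    qed
  qed
qed

lemma square_integrable_inner:
  assumes "square_integrable f" "square_integrable g"
  shows "integrable lborel (\<lambda>x. inner (f x) (g x))"
  using integrable_Re[OF square_integrable_prod[OF assms]] by (simp add: inner_complex_def)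

quotient_type L2 = "real \<Rightarrow> complex" / partial: L2_eq
proof (rule part_equivpI)
  show "\<exists>f. L2_eq f f"
    using square_integrable_zero by (auto simp: L2_eq_def)
  show "symp L2_eq"
    by (auto simp: L2_eq_def symp_def)
  show "transp L2_eq"
    unfolding transp_def L2_eq_def by (auto elim: AE_mp)
qed

instantiation L2 :: real_inner
begin

lift_definition zero_L2 :: L2 is "\<lambda>x. 0"
  by (simp add: L2_eq_def square_integrable_zero)

lift_definition plus_L2 :: "L2 \<Rightarrow> L2 \<Rightarrow> L2" is "\<lambda>f g x. f x + g x"
  by (auto simp: L2_eq_def square_integrable_add)

lift_definition uminus_L2 :: "L2 \<Rightarrow> L2" is "\<lambda>f x. - f x"
  by (auto simp: L2_eq_def square_integrable_uminus)

definition minus_L2 :: "L2 \<Rightarrow> L2 \<Rightarrow> L2" where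
  "minus_L2 u v = u + (- v)"

lift_definition scaleR_L2 :: "real \<Rightarrow> L2 \<Rightarrow> L2" is "\<lambda>r f x. r *\<^sub>R f x"
  by (auto simp: L2_eq_def square_integrable_scaleR)

text \<open>This is the real part of the complex inner product \<open>cinner_L2\<close> below, as the type class
  requires; it induces the usual norm and topology.\<close>

lift_definition inner_L2 :: "L2 \<Rightarrow> L2 \<Rightarrow> real" is
  "\<lambda>f g. \<integral>x. inner (f x) (g x) \<partial>lborel"
proof -
  fix f f' g g' assume a: "L2_eq f f'" "L2_eq g g'"
  then have "AE x in lborel. inner (f x) (g x) = inner (f' x) (g' x)"
    by (auto simp: L2_eq_def)
  then show "(\<integral>x. inner (f x) (g x) \<partial>lborel) = (\<integral>x. inner (f' x) (g' x) \<partial>lborel)"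
    using a unfolding L2_eq_def
    by (intro integral_cong_AE borel_measurable_integrable square_integrable_inner) blast+
qed

definition norm_L2 :: "L2 \<Rightarrow> real" where
  "norm_L2 u = sqrt (inner u u)"

definition dist_L2 :: "L2 \<Rightarrow> L2 \<Rightarrow> real" where
  "dist_L2 u v = norm (u - v)"

definition sgn_L2 :: "L2 \<Rightarrow> L2" where
  "sgn_L2 u = scaleR (inverse (norm u)) u"

definition uniformity_L2 :: "(L2 \<times> L2) filter" where
  "uniformity_L2 = (INF e\<in>{0<..}. principal {(u, v). dist u v < e})"

definition open_L2 :: "L2 set \<Rightarrow> bool" where
  "open_L2 U \<longleftrightarrow> (\<forall>u\<in>U. \<forall>\<^sub>F (u', v) in uniformity. u' = u \<longrightarrow> v \<in> U)"

instance
proof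
  fix a b c :: L2 and r s :: real and U :: "L2 set"
  show "a + b + c = a + (b + c)"
    by transfer (auto simp: L2_eq_def add.assoc intro!: square_integrable_add)
  show "a + b = b + a"
    by transfer (auto simp: L2_eq_def add.commute intro!: square_integrable_add)
  show "0 + a = a"
    by transfer (auto simp: L2_eq_def)
  show "- a + a = 0"
    by transfer (auto simp: L2_eq_def square_integrable_zero)
  show "a - b = a + - b"
    by (simp add: minus_L2_def)
  show "r *\<^sub>R (a + b) = r *\<^sub>R a + r *\<^sub>R b"
    by transfer
      (auto simp: L2_eq_def scaleR_add_right
        intro!: square_integrable_add square_integrable_scaleR)
  show "(r + s) *\<^sub>R a = r *\<^sub>R a + s *\<^sub>R a"
    by transfer
      (auto simp: L2_eq_def scaleR_add_left
        intro!: square_integrable_add square_integrable_scaleR)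
  show "r *\<^sub>R s *\<^sub>R a = (r * s) *\<^sub>R a"
    by transfer (auto simp: L2_eq_def intro!: square_integrable_scaleR)
  show "1 *\<^sub>R a = a"
    by transfer (auto simp: L2_eq_def)
  show "inner a b = inner b a"
    by transfer (simp add: inner_commute)
  show "inner (a + b) c = inner a c + inner b c"
    by transfer (auto simp: L2_eq_def inner_add_left square_integrable_inner)
  show "inner (r *\<^sub>R a) b = r * inner a b"
    by transfer (auto simp: L2_eq_def)
  show "0 \<le> inner a a"
    by transfer auto
  show "inner a a = 0 \<longleftrightarrow> a = 0"
  proof transfer
    fix f assume "L2_eq f f"
    then have f: "square_integrable f" by (simp add: L2_eq_def)
    have "(\<integral>x. inner (f x) (f x) \<partial>lborel) = 0 \<longleftrightarrow> (AE x in lborel. inner (f x) (f x) = 0)"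
      by (intro integral_nonneg_eq_0_iff_AE square_integrable_inner f) auto
    then show "((\<integral>x. inner (f x) (f x) \<partial>lborel) = 0) = L2_eq f (\<lambda>x. 0)"
      using f by (simp add: L2_eq_def square_integrable_zero)
  qed
qed (simp_all add: norm_L2_def dist_L2_def sgn_L2_def uniformity_L2_def open_L2_def)

end

lift_definition scaleC_L2 :: "complex \<Rightarrow> L2 \<Rightarrow> L2" is "\<lambda>a f x. a * f x"
  by (auto simp: L2_eq_def square_integrable_scale)

lift_definition cinner_L2 :: "L2 \<Rightarrow> L2 \<Rightarrow> complex" is
  "\<lambda>f g. \<integral>x. f x * cnj (g x) \<partial>lborel"
proof -
  fix f f' g g' assume a: "L2_eq f f'" "L2_eq g g'"
  then have "AE x in lborel. f x * cnj (g x) = f' x * cnj (g' x)"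
    by (auto simp: L2_eq_def)
  then show "(\<integral>x. f x * cnj (g x) \<partial>lborel) = (\<integral>x. f' x * cnj (g' x) \<partial>lborel)"
    using a unfolding L2_eq_def
    by (intro integral_cong_AE borel_measurable_integrable square_integrable_prod) blast+
qed

text \<open>The order is that of \<open>Complex_Order\<close>, so the bounds include that the function is
  real-valued almost everywhere.\<close>

lift_definition between_0_1 :: "L2 \<Rightarrow> bool" is "\<lambda>f. AE x in lborel. 0 \<le> f x \<and> f x \<le> 1"
proof -
  fix f g assume "L2_eq f g"
  then have eq: "AE x in lborel. f x = g x" by (simp add: L2_eq_def)
  have "eventually (\<lambda>x. (0 \<le> f x \<and> f x \<le> 1) = (0 \<le> g x \<and> g x \<le> 1)) (ae_filter lborel)"
    using eq by (auto elim: eventually_mono)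
  then show "(AE x in lborel. 0 \<le> f x \<and> f x \<le> 1) = (AE x in lborel. 0 \<le> g x \<and> g x \<le> 1)"
    by (rule eventually_subst)
qed


section \<open>Unbounded operators, identified with their graphs\<close>

type_synonym L2_op = "(L2 \<times> L2) set"

definition linear_op :: "L2_op \<Rightarrow> bool" where
  "linear_op K \<longleftrightarrow>
     single_valued K \<and> (0, 0) \<in> K \<and>
     (\<forall>(u, v)\<in>K. \<forall>(u', v')\<in>K. (u + u', v + v') \<in> K) \<and>
     (\<forall>a. \<forall>(u, v)\<in>K. (scaleC_L2 a u, scaleC_L2 a v) \<in> K)"

definition adjoint_op :: "L2_op \<Rightarrow> L2_op" where
  "adjoint_op K = {(f, g). \<forall>(u, v)\<in>K. cinner_L2 v f = cinner_L2 u g}"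

definition self_adjoint_op :: "L2_op \<Rightarrow> bool" where
  "self_adjoint_op K \<longleftrightarrow> linear_op K \<and> closure (Domain K) = UNIV \<and> adjoint_op K = K"

definition lower_semibounded :: "L2_op \<Rightarrow> bool" where
  "lower_semibounded K \<longleftrightarrow> (\<exists>m. \<forall>(u, v)\<in>K. m * (norm u)\<^sup>2 \<le> Re (cinner_L2 v u))"


section \<open>Submarkovian semigroups\<close>

text \<open>Only the values of \<open>S\<close> at non-negative times are relevant.\<close>

definition C0_semigroup :: "(real \<Rightarrow> L2 \<Rightarrow> L2) \<Rightarrow> bool" where
  "C0_semigroup S \<longleftrightarrow>
     (\<forall>t\<ge>0. bounded_linear (S t) \<and> (\<forall>a u. S t (scaleC_L2 a u) = scaleC_L2 a (S t u))) \<and>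
     (\<forall>u. S 0 u = u) \<and>
     (\<forall>s\<ge>0. \<forall>t\<ge>0. \<forall>u. S (s + t) u = S s (S t u)) \<and>
     (\<forall>u. ((\<lambda>t. S t u) \<longlongrightarrow> u) (at_right 0))"

text \<open>\<open>generates K S\<close> says that \<open>S t = exp (- t K)\<close>: the infinitesimal generator of \<open>S\<close>,
  with its full domain, is \<open>- K\<close>.\<close>

definition generates :: "L2_op \<Rightarrow> (real \<Rightarrow> L2 \<Rightarrow> L2) \<Rightarrow> bool" where
  "generates K S \<longleftrightarrow> C0_semigroup S \<and>
     K = {(u, v). ((\<lambda>t. (S t u - u) /\<^sub>R t) \<longlongrightarrow> - v) (at_right 0)}"

definition submarkovian :: "(real \<Rightarrow> L2 \<Rightarrow> L2) \<Rightarrow> bool" where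
  "submarkovian S \<longleftrightarrow> (\<forall>t>0. \<forall>u. between_0_1 u \<longrightarrow> between_0_1 (S t u))"

definition submarkovian_extension :: "L2_op \<Rightarrow> L2_op \<Rightarrow> bool" where
  "submarkovian_extension H K \<longleftrightarrow>
     H \<subseteq> K \<and> self_adjoint_op K \<and> lower_semibounded K \<and>
     (\<exists>S. generates K S \<and> submarkovian S)"


section \<open>Test functions, weak derivatives and the operator\<close>

definition test_function :: "(real \<Rightarrow> 'a::real_normed_vector) \<Rightarrow> bool" where
  "test_function f \<longleftrightarrow>
     (\<exists>D :: nat \<Rightarrow> real \<Rightarrow> 'a. D 0 = f \<and>
        (\<forall>n x. (D n has_vector_derivative D (Suc n) x) (at x))) \<and>
     compact (closure {x. f x \<noteq> 0})"

definition locally_integrable ::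
    "(real \<Rightarrow> 'a::{banach, second_countable_topology}) \<Rightarrow> bool" where
  "locally_integrable f \<longleftrightarrow> (\<forall>A. compact A \<longrightarrow> set_integrable lborel A f)"

definition has_weak_derivative ::
    "(real \<Rightarrow> 'a::{banach, second_countable_topology}) \<Rightarrow> (real \<Rightarrow> 'a) \<Rightarrow> bool" where
  "has_weak_derivative f g \<longleftrightarrow>
     locally_integrable f \<and> locally_integrable g \<and>
     (\<forall>\<psi> :: real \<Rightarrow> real. test_function \<psi> \<longrightarrow>
        (\<integral>x. deriv \<psi> x *\<^sub>R f x \<partial>lborel) = - (\<integral>x. \<psi> x *\<^sub>R g x \<partial>lborel))"

definition Linf_loc :: "(real \<Rightarrow> real) \<Rightarrow> bool" where
  "Linf_loc f \<longleftrightarrow> f \<in> borel_measurable lborel \<and>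
     (\<forall>A. compact A \<longrightarrow> (\<exists>B. AE x in lborel. x \<in> A \<longrightarrow> \<bar>f x\<bar> \<le> B))"

definition W1inf_loc :: "(real \<Rightarrow> real) \<Rightarrow> bool" where
  "W1inf_loc f \<longleftrightarrow> Linf_loc f \<and> (\<exists>g. Linf_loc g \<and> has_weak_derivative f g)"

text \<open>The operator with action \<open>- (c \<phi>')'\<close>, the outer derivative being a weak one. If \<open>c\<close> satisfies
  \<open>W1inf_loc\<close> then \<open>(c \<phi>')' = c' \<phi>' + c \<phi>''\<close> is bounded with compact support, hence square-integrable,
  for every test function \<open>\<phi>\<close>; so the domain consists of (the classes of) all complex-valued test
  functions. The weak derivative determines \<open>v\<close> as an element of \<open>L2\<close>.\<close>

definition divergence_form_op :: "(real \<Rightarrow> real) \<Rightarrow> L2_op" where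
  "divergence_form_op c =
     {(abs_L2 \<phi>, v) | \<phi> v. test_function \<phi> \<and>
        has_weak_derivative (\<lambda>x. c x *\<^sub>R vector_derivative \<phi> (at x)) (\<lambda>x. - rep_L2 v x)}"

end

theory Submission
  imports Defs "HOL-Computational_Algebra.Polynomial"
begin

text \<open>
  \<^bold>\<open>Existence.\<close> Let \<open>G\<close> be the closure in \<open>L\<^sup>2 \<times> L\<^sup>2\<close> of the graph of \<open>\<phi> \<mapsto> \<surd>c \<phi>'\<close> on test functions.
  Writing \<open>T\<close> for the closed operator with graph \<open>G\<close>, the operator \<open>T\<^sup>* T\<close>
  (\<open>form_op\<close>) is non-negative and self-adjoint, and it extends \<open>H\<close> because
  \<open>\<langle>\<surd>c \<psi>', \<surd>c \<phi>'\<rangle> = \<langle>\<psi>, H \<phi>\<rangle>\<close> is the definition of the weak derivative of \<open>c \<phi>'\<close>. Its resolvent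
  \<open>J\<^sub>h f = (1 + h T\<^sup>* T)\<^sup>-\<^sup>1 f\<close> is the first component of the minimiser of
  \<open>\<parallel>a - f\<parallel>\<^sup>2 + h \<parallel>b\<parallel>\<^sup>2\<close> over \<open>(a, b) \<in> G\<close>, hence exists by orthogonal projection. If \<open>f\<close> takes values
  in the unit interval, then cutting \<open>a\<close> off at \<open>0\<close> and \<open>1\<close> does not increase this functional, so
  \<open>J\<^sub>h f\<close> takes values in the unit interval too (\<open>J_between_0_1\<close>). The semigroup is the limit of
  the \<open>2\<^sup>k\<close>-fold iterates of the implicit Euler step \<open>J\<close> of length \<open>t / 2\<^sup>k\<close> and inherits the property.

  \<^bold>\<open>Uniqueness.\<close> Let \<open>K\<^sub>1\<close> and \<open>K\<^sub>2\<close> be submarkovian extensions and \<open>f\<close> a function with values in the unit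
  interval. For large \<open>\<mu>\<close> the resolvents \<open>u\<^sub>i = (\<mu> + K\<^sub>i)\<^sup>-\<^sup>1 f\<close> are Laplace transforms of the semigroups
  and therefore bounded (\<open>resolvent_between_0_1\<close>). Since both operators are restrictions of the
  adjoint of \<open>H\<close>, the difference \<open>w = u\<^sub>1 - u\<^sub>2\<close> is a bounded square-integrable weak solution of
  \<open>(c w')' = \<mu> w\<close>. Such a \<open>w\<close> vanishes (\<open>bounded_solution_zero\<close>), so the two resolvents agree on a set
  with dense span, and \<open>K\<^sub>1 = K\<^sub>2\<close>.

  That \<open>w\<close> vanishes is where the dimension one and the Lipschitz continuity of \<open>c\<close> enter. The flux
  \<open>p = c w'\<close> satisfies \<open>p' = \<mu> w\<close>, so where \<open>c > 0\<close> the product \<open>p w\<close> has the derivative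
  \<open>\<mu> w\<^sup>2 + p\<^sup>2 / c \<ge> 0\<close>. Suppose \<open>p w \<ge> \<delta> > 0\<close> from some point on, moving to the right; then
  \<open>(w\<^sup>2)' = 2 p w / c\<close> is positive. If \<open>c\<close> never vanishes on the right, \<open>w\<^sup>2\<close> is increasing up to
  infinity, which contradicts square integrability. If \<open>c\<close> first vanishes at \<open>b\<close>, then
  \<open>c x \<le> L (b - x)\<close>, so \<open>w\<^sup>2\<close> grows at least like \<open>(2 \<delta> / L) \<bar>log (b - x)\<bar>\<close>, which contradicts
  boundedness. The reflected argument excludes \<open>p w < 0\<close>; hence \<open>p w\<close> is \<open>0\<close>, and so is \<open>w\<close>, on
  \<open>{c > 0}\<close>. On \<open>{c = 0}\<close> the functions \<open>c\<close> and \<open>c w\<close> vanish, hence almost everywhere also their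
  derivatives \<open>c'\<close> and \<open>c' w + p\<close>; so \<open>p = 0\<close> almost everywhere there, and in turn its derivative
  \<open>\<mu> w\<close>. Boundedness is what excludes logarithmic growth at the zeros of
  \<open>c\<close>: for \<open>c x = \<bar>x\<bar>\<close> near \<open>0\<close> the function \<open>sgn x log \<bar>x\<bar>\<close> is locally square-integrable and has
  the constant flux \<open>1\<close> across the zero.
\<close>

section \<open>Orthogonal projection and uniform boundedness\<close>

lemma subspace_closure_normed:
  fixes M :: "'a::real_normed_vector set"
  assumes "subspace M"
  shows "subspace (closure M)"
proof (rule subspaceI)
  show "0 \<in> closure M"
    using assms closure_subset subspace_0 by blast
next
  fix x y assume "x \<in> closure M" "y \<in> closure M"
  then obtain a b where a: "\<And>n::nat. a n \<in> M" "a \<longlonglongrightarrow> x" and b: "\<And>n::nat. b n \<in> M" "b \<longlonglongrightarrow> y"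
    unfolding closure_sequential by blast
  have "(\<lambda>n. a n + b n) \<longlonglongrightarrow> x + y"
    by (intro tendsto_add a b)
  moreover have "a n + b n \<in> M" for n
    using assms a(1) b(1) subspace_add by blast
  ultimately show "x + y \<in> closure M"
    unfolding closure_sequential by (intro exI[of _ "\<lambda>n. a n + b n"]) blast
next
  fix r x assume "x \<in> closure M"
  then obtain a where a: "\<And>n::nat. a n \<in> M" "a \<longlonglongrightarrow> x"
    unfolding closure_sequential by blast
  have "(\<lambda>n. r *\<^sub>R a n) \<longlonglongrightarrow> r *\<^sub>R x"
    by (intro tendsto_scaleR tendsto_const a)
  moreover have "r *\<^sub>R a n \<in> M" for n
    using assms a(1) subspace_scale by blast
  ultimately show "r *\<^sub>R x \<in> closure M"
    unfolding closure_sequential by (intro exI[of _ "\<lambda>n. r *\<^sub>R a n"]) blast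
qed

text \<open>By the parallelogram identity every minimising sequence for the distance from \<open>f\<close> to \<open>M\<close> is a
  Cauchy sequence; at its limit the first variation of the distance vanishes.\<close>

lemma orthogonal_projection_exists:
  fixes M :: "'a::{real_inner,banach} set"
  assumes "closed M" and M: "subspace M"
  obtains p where "p \<in> M" "\<And>q. q \<in> M \<Longrightarrow> inner q (f - p) = 0"
proof -
  define D where "D = Inf ((\<lambda>q. (norm (f - q))\<^sup>2) ` M)"
  have bdd: "bdd_below ((\<lambda>q. (norm (f - q))\<^sup>2) ` M)"
    by (rule bdd_belowI2[of _ 0]) simp
  have ne: "(\<lambda>q. (norm (f - q))\<^sup>2) ` M \<noteq> {}"
    using subspace_0[OF M] by blast
  have lower: "D \<le> (norm (f - q))\<^sup>2" if "q \<in> M" for q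
    unfolding D_def by (rule cInf_lower[OF _ bdd]) (use that in blast)
  have "\<exists>q\<in>M. (norm (f - q))\<^sup>2 < D + inverse (Suc n)" for n
  proof -
    have "D < D + inverse (Suc n)" by simp
    then show ?thesis
      unfolding D_def using cInf_lessD[OF ne] by fastforce
  qed
  then obtain q where q: "\<And>n. q n \<in> M" "\<And>n. (norm (f - q n))\<^sup>2 < D + inverse (Suc n)"
    by metis
  have close: "(norm (q n - q m))\<^sup>2 \<le> 2 * inverse (Suc n) + 2 * inverse (Suc m)" for n m
  proof -
    have mid: "(1/2) *\<^sub>R (q n + q m) \<in> M"
      using M q(1) by (intro subspace_scale subspace_add)
    have "(norm (q n - q m))\<^sup>2 =
        2 * (norm (f - q n))\<^sup>2 + 2 * (norm (f - q m))\<^sup>2 - 4 * (norm (f - (1/2) *\<^sub>R (q n + q m)))\<^sup>2"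
      unfolding power2_norm_eq_inner by (simp add: inner_diff inner_add inner_commute algebra_simps)
    then show ?thesis
      using lower[OF mid] q(2)[of n] q(2)[of m] by linarith
  qed
  have "Cauchy q"
    unfolding Cauchy_altdef2
  proof (intro allI impI)
    fix e :: real assume "0 < e"
    then have "0 < e\<^sup>2 / 4" by simp
    then obtain N where N: "inverse (Suc N) < e\<^sup>2 / 4"
      using reals_Archimedean by blast
    have "dist (q n) (q N) < e" if "n \<ge> N" for n
    proof -
      have "inverse (real (Suc n)) \<le> inverse (Suc N)"
        using that by (simp add: field_simps)
      then have "(norm (q n - q N))\<^sup>2 < e\<^sup>2"
        using close[of n N] N by linarith
      then show ?thesis
        using \<open>0 < e\<close> by (simp add: dist_norm power_less_imp_less_base)
    qed
    then show "\<exists>N. \<forall>n\<ge>N. dist (q n) (q N) < e" by blast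
  qed
  then obtain p where p: "q \<longlonglongrightarrow> p"
    using Cauchy_convergent convergent_def by blast
  have pM: "p \<in> M"
    using closed_sequentially[OF \<open>closed M\<close>] q(1) p by blast
  have le: "(norm (f - p))\<^sup>2 \<le> D"
  proof (rule LIMSEQ_le)
    show "(\<lambda>n. (norm (f - q n))\<^sup>2) \<longlonglongrightarrow> (norm (f - p))\<^sup>2"
      by (intro tendsto_intros p)
    show "(\<lambda>n. D + inverse (Suc n)) \<longlonglongrightarrow> D"
      using tendsto_add[OF tendsto_const LIMSEQ_inverse_real_of_nat] by simp
    show "\<exists>N. \<forall>n\<ge>N. (norm (f - q n))\<^sup>2 \<le> D + inverse (Suc n)"
      using q(2) less_imp_le by blast
  qed
  show thesis
  proof (rule that[OF pM])
    fix x assume x: "x \<in> M"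
    show "inner x (f - p) = 0"
    proof (cases "x = 0")
      case False
      then have nx: "inner x x > 0" by simp
      \<comment> \<open>the value of \<open>r\<close> that minimises \<open>norm (f - p - r x)\<close>\<close>
      define t where "t = inner x (f - p) / inner x x"
      have "p + t *\<^sub>R x \<in> M"
        using M pM x by (intro subspace_add subspace_scale)
      from lower[OF this] le have "(norm (f - p))\<^sup>2 \<le> (norm (f - (p + t *\<^sub>R x)))\<^sup>2"
        by linarith
      also have "\<dots> = (norm (f - p))\<^sup>2 - 2 * t * inner x (f - p) + t * t * inner x x"
        unfolding power2_norm_eq_inner by (simp add: inner_diff inner_add inner_commute algebra_simps)
      also have "\<dots> = (norm (f - p))\<^sup>2 - inner x (f - p) * inner x (f - p) / inner x x"
        using nx by (simp add: t_def field_simps)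
      finally have "inner x (f - p) * inner x (f - p) / inner x x \<le> 0" by simp
      then have "inner x (f - p) * inner x (f - p) \<le> 0"
        using nx by (simp add: divide_le_0_iff)
      then show ?thesis
        by (metis mult_eq_0_iff linorder_not_le not_real_square_gt_zero)
    qed simp
  qed
qed

lemma dense_subspace_if_no_orthogonal:
  fixes M :: "'a::{real_inner,banach} set"
  assumes "subspace M" and orth: "\<And>x. (\<And>m. m \<in> M \<Longrightarrow> inner m x = 0) \<Longrightarrow> x = 0"
  shows "closure M = UNIV"
proof -
  have "f \<in> closure M" for f
  proof -
    obtain p where p: "p \<in> closure M" "\<And>q. q \<in> closure M \<Longrightarrow> inner q (f - p) = 0"
      using orthogonal_projection_exists[OF closed_closure subspace_closure_normed[OF assms(1)]] by blast
    then have "f - p = 0"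
      using orth closure_subset by blast
    then show ?thesis using p by simp
  qed
  then show ?thesis by blast
qed

text \<open>A form of the uniform boundedness principle. The vectors whose orbit up to time \<open>1 / (n + 1)\<close> is
  bounded by \<open>n\<close> form closed sets covering the space, so by Baire's theorem one of them contains a
  ball, and linearity turns the bound on a ball into a bound on the operators.\<close>

lemma locally_bounded_if_strongly_continuous_at_0:
  fixes S :: "real \<Rightarrow> 'a::banach \<Rightarrow> 'a"
  assumes lin: "\<And>t. t > 0 \<Longrightarrow> bounded_linear (S t)"
    and cont: "\<And>u. ((\<lambda>t. S t u) \<longlongrightarrow> u) (at_right 0)"
  obtains \<delta> B where "\<delta> > 0" "B \<ge> 1" "\<And>t u. 0 < t \<Longrightarrow> t \<le> \<delta> \<Longrightarrow> norm (S t u) \<le> B * norm u"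
proof -
  define A where "A n = {u. \<forall>t. 0 < t \<and> t \<le> inverse (Suc n) \<longrightarrow> norm (S t u) \<le> real n}" for n
  have closed: "closed (A n)" for n
  proof -
    have eq: "A n = (\<Inter>t\<in>{0<..inverse (Suc n)}. {u. norm (S t u) \<le> real n})"
      by (auto simp: A_def)
    show ?thesis
      unfolding eq
    proof (intro closed_INT ballI closed_Collect_le continuous_intros)
      fix t assume "t \<in> {0<..inverse (real (Suc n))}"
      then have "bounded_linear (S t)" using lin by simp
      then show "continuous_on UNIV (S t)"
        using linear_continuous_on by blast
    qed
  qed
  have cover: "\<exists>n. u \<in> A n" for u
  proof -
    have "\<forall>\<^sub>F t in at_right 0. dist (S t u) u < 1"
      using cont tendstoD zero_less_one by blast
    then obtain b where b: "b > 0" "\<And>t. 0 < t \<Longrightarrow> t < b \<Longrightarrow> dist (S t u) u < 1"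
      by (auto simp: eventually_at_right_field)
    obtain m where m: "inverse (Suc m) < b"
      using reals_Archimedean b(1) by blast
    obtain k where k: "norm u + 1 \<le> real k"
      using real_arch_simple by blast
    have "u \<in> A (max m k)"
      unfolding A_def
    proof (intro CollectI allI impI)
      fix t assume t: "0 < t \<and> t \<le> inverse (real (Suc (max m k)))"
      have "inverse (real (Suc (max m k))) \<le> inverse (Suc m)"
        by (simp add: field_simps)
      then have "dist (S t u) u < 1"
        using t m by (intro b(2)) linarith+
      moreover have "norm (S t u) \<le> norm u + dist (S t u) u"
        unfolding dist_norm by (metis add.commute diff_add_cancel norm_triangle_ineq)
      ultimately have "norm (S t u) \<le> real k" using k by linarith
      then show "norm (S t u) \<le> real (max m k)" by simp
    qed
    then show ?thesis by blast
  qed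
  have "\<exists>n. interior (A n) \<noteq> {}"
  proof (rule ccontr)
    assume "\<not> ?thesis"
    then have emp: "interior (A n) = {}" for n by blast
    have "euclidean interior_of \<Union>(range A) = {}"
      using Met_TC.metric_Baire_category_alt[where \<G> = "range A"] closed emp
      by (auto simp: complete_UNIV)
    moreover have "\<Union>(range A) = UNIV"
      using cover by blast
    ultimately show False by simp
  qed
  then obtain n x where "x \<in> interior (A n)" by blast
  then obtain r where r: "r > 0" "ball x r \<subseteq> A n"
    using mem_interior by blast
  define B where "B = max 1 (4 * real n / r)"
  have "norm (S t u) \<le> B * norm u" if t: "0 < t" "t \<le> inverse (Suc n)" for t u
  proof (cases "u = 0")
    case True
    then show ?thesis
      using lin[OF t(1)] by (simp add: linear_0 bounded_linear.linear)
  next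
    case False
    interpret S: bounded_linear "S t" by (rule lin[OF t(1)])
    \<comment> \<open>scales \<open>u\<close> into the ball of radius \<open>r\<close>\<close>
    define s where "s = r / (2 * norm u)"
    have s: "s > 0" using r False by (simp add: s_def)
    have "norm (s *\<^sub>R u) < r"
      using r(1) False by (simp add: s_def)
    then have "x + s *\<^sub>R u \<in> A n" "x \<in> A n"
      using r by (auto simp: dist_norm)
    then have "norm (S t (x + s *\<^sub>R u)) \<le> n" "norm (S t x) \<le> n"
      using t by (auto simp: A_def)
    moreover have "s *\<^sub>R S t u = S t (x + s *\<^sub>R u) - S t x"
      by (simp add: S.add S.scaleR)
    ultimately have "norm (s *\<^sub>R S t u) \<le> 2 * n"
      using norm_triangle_ineq4[of "S t (x + s *\<^sub>R u)" "S t x"] by simp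
    then have "norm (S t u) \<le> 2 * n / s"
      using s by (simp add: field_simps)
    also have "\<dots> = 4 * n / r * norm u"
      using r False by (simp add: s_def field_simps)
    also have "\<dots> \<le> B * norm u"
      by (intro mult_right_mono) (auto simp: B_def)
    finally show ?thesis .
  qed
  then show thesis
    using that[of "inverse (Suc n)" B] by (simp add: B_def)
qed

section \<open>Contraction semigroups by implicit Euler steps\<close>

lemma power_contraction:
  fixes A :: "'a::real_normed_vector \<Rightarrow> 'a"
  assumes "\<And>x. norm (A x) \<le> norm x"
  shows "norm ((A ^^ n) x) \<le> norm x"
  by (induction n) (auto intro: order_trans[OF assms])

lemma linear_funpow:
  fixes A :: "'a::real_vector \<Rightarrow> 'a"
  shows "linear A \<Longrightarrow> linear (A ^^ n)"
proof (induction n)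
  case 0
  show ?case by (auto intro: linearI)
next
  case (Suc n)
  then show ?case using linear_compose[of "A ^^ n" A] by (simp add: comp_def)
qed

text \<open>The differences telescope: \<open>A\<^sup>n - B\<^sup>n\<close> is the sum of the \<open>n\<close> terms \<open>A\<^sup>i (A - B) B\<^sup>j\<close> with \<open>i + j = n - 1\<close>.\<close>

lemma power_difference_bound:
  fixes A B :: "'a::real_normed_vector \<Rightarrow> 'a"
  assumes "linear A" "linear B" "\<And>x. A (B x) = B (A x)"
    and "\<And>x. norm (A x) \<le> norm x" "\<And>x. norm (B x) \<le> norm x"
  shows "norm ((A ^^ n) u - (B ^^ n) u) \<le> real n * norm (A u - B u)"
proof (induction n)
  case (Suc n)
  have comm: "(A ^^ n) (B x) = B ((A ^^ n) x)" for x
    by (induction n) (simp_all add: assms(3))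
  have "(A ^^ Suc n) u - (B ^^ Suc n) u = (A ^^ n) (A u - B u) + B ((A ^^ n) u - (B ^^ n) u)"
    using linear_diff[OF linear_funpow[OF assms(1)], of n] linear_diff[OF assms(2)]
    by (simp add: comm funpow_swap1)
  also have "norm \<dots> \<le> norm ((A ^^ n) (A u - B u)) + norm (B ((A ^^ n) u - (B ^^ n) u))"
    by (rule norm_triangle_ineq)
  also have "\<dots> \<le> norm (A u - B u) + real n * norm (A u - B u)"
    by (intro add_mono power_contraction[of A, OF assms(4)] order_trans[OF assms(5) Suc])
  finally show ?case by (simp add: algebra_simps)
qed simp

text \<open>Graphs of non-negative operators for which \<open>1 + h K\<close> is onto for every step size \<open>h > 0\<close>. The
  inverse \<open>J h\<close> of \<open>1 + h K\<close> is one step of the implicit Euler scheme for \<open>u' = - K u\<close>, and the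
  semigroup \<open>exp (- t K)\<close> is obtained from it by iteration.\<close>

locale accretive_op =
  fixes K :: "('a::{real_inner,banach} \<times> 'a) set"
  assumes K_add: "(u, v) \<in> K \<Longrightarrow> (u', v') \<in> K \<Longrightarrow> (u + u', v + v') \<in> K"
    and K_scale: "(u, v) \<in> K \<Longrightarrow> (r *\<^sub>R u, r *\<^sub>R v) \<in> K"
    and K_accretive: "(u, v) \<in> K \<Longrightarrow> 0 \<le> inner u v"
    and K_range: "h > 0 \<Longrightarrow> \<exists>u. (u, (f - u) /\<^sub>R h) \<in> K"
    and K_dense: "closure (Domain K) = UNIV"
begin

text \<open>For positive \<open>h\<close> the choice is unique: \<open>J h\<close> is the inverse of \<open>1 + h K\<close>.\<close>

definition J :: "real \<Rightarrow> 'a \<Rightarrow> 'a" where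
  "J h f = (SOME u. (u, (f - u) /\<^sub>R h) \<in> K)"

lemma J_in_K: "h > 0 \<Longrightarrow> (J h f, (f - J h f) /\<^sub>R h) \<in> K"
  unfolding J_def by (rule someI_ex) (rule K_range)

lemma K_diff: "(u, v) \<in> K \<Longrightarrow> (u', v') \<in> K \<Longrightarrow> (u - u', v - v') \<in> K"
  using K_add[of u v "- u'" "- v'"] K_scale[of u' v' "-1"] by simp

lemma J_unique:
  assumes "h > 0" "(u, v) \<in> K"
  shows "J h (u + h *\<^sub>R v) = u"
proof -
  define d where "d = J h (u + h *\<^sub>R v) - u"
  have "(d, (u + h *\<^sub>R v - J h (u + h *\<^sub>R v)) /\<^sub>R h - v) \<in> K"
    unfolding d_def using assms J_in_K K_diff by blast
  moreover have "(u + h *\<^sub>R v - J h (u + h *\<^sub>R v)) /\<^sub>R h - v = - (d /\<^sub>R h)"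
    using assms(1) by (simp add: d_def algebra_simps)
  ultimately have "0 \<le> inner d (- (d /\<^sub>R h))"
    using K_accretive by force
  then have "inner d d \<le> 0"
    using assms(1) by (simp add: field_simps mult_le_0_iff)
  then have "d = 0" by (metis inner_eq_zero_iff inner_ge_zero antisym)
  then show ?thesis by (simp add: d_def)
qed

lemma J_linear:
  assumes h: "h > 0"
  shows "linear (J h)"
proof (rule linearI)
  fix x y and r :: real
  have "(J h x + J h y, (x - J h x) /\<^sub>R h + (y - J h y) /\<^sub>R h) \<in> K"
    by (intro K_add J_in_K h)
  from J_unique[OF h this] show "J h (x + y) = J h x + J h y"
    using h by (simp add: algebra_simps)
  have "(r *\<^sub>R J h x, r *\<^sub>R ((x - J h x) /\<^sub>R h)) \<in> K"
    by (intro K_scale J_in_K h)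
  moreover have "r *\<^sub>R J h x + h *\<^sub>R (r *\<^sub>R ((x - J h x) /\<^sub>R h)) = r *\<^sub>R x"
  proof -
    have eq: "h *\<^sub>R (r *\<^sub>R (y /\<^sub>R h)) = r *\<^sub>R y" for y :: 'a
    proof -
      have "h *\<^sub>R (r *\<^sub>R (y /\<^sub>R h)) = (h * (r * inverse h)) *\<^sub>R y" by simp
      also have "h * (r * inverse h) = r" using h by (simp add: field_simps)
      finally show ?thesis .
    qed
    show ?thesis unfolding eq by (simp add: algebra_simps)
  qed
  ultimately show "J h (r *\<^sub>R x) = r *\<^sub>R J h x"
    using J_unique[OF h] by metis
qed

lemma J_contraction:
  assumes h: "h > 0"
  shows "norm (J h f) \<le> norm f"
proof -
  have "0 \<le> inner (J h f) ((f - J h f) /\<^sub>R h)"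
    by (intro K_accretive J_in_K h)
  then have "inner (J h f) (J h f) \<le> inner (J h f) f"
    using h by (simp add: inner_diff_right zero_le_mult_iff)
  also have "\<dots> \<le> norm (J h f) * norm f"
    by (rule norm_cauchy_schwarz)
  finally have "norm (J h f) * norm (J h f) \<le> norm (J h f) * norm f"
    by (metis power2_norm_eq_inner power2_eq_square)
  then show ?thesis
    by (cases "J h f = 0") auto
qed

lemma J_resolvent:
  assumes h: "h > 0" and "(u, v) \<in> K"
  shows "J h u = u - h *\<^sub>R J h v" and "(J h u, J h v) \<in> K"
proof -
  have "(u - h *\<^sub>R J h v, v - h *\<^sub>R ((v - J h v) /\<^sub>R h)) \<in> K"
    by (intro K_diff K_scale J_in_K h assms)
  then have k: "(u - h *\<^sub>R J h v, J h v) \<in> K"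
    using h by simp
  from J_unique[OF h this] show eq: "J h u = u - h *\<^sub>R J h v" by simp
  show "(J h u, J h v) \<in> K" using k unfolding eq .
qed

lemma J_commute:
  assumes a: "a > 0" and b: "b > 0"
  shows "J a (J b f) = J b (J a f)"
proof -
  have "(J a (J b f), J a ((f - J b f) /\<^sub>R b)) \<in> K"
    by (intro J_resolvent a J_in_K b)
  from J_unique[OF b this] show ?thesis
    using linear_cmul[OF J_linear[OF a]] linear_diff[OF J_linear[OF a]] b by (simp add: )
qed

lemma J_near_id:
  assumes "h > 0" "(u, v) \<in> K"
  shows "norm (J h u - u) \<le> h * norm v"
  using J_resolvent(1)[OF assms] J_contraction[OF assms(1), of v] assms(1) by simp

text \<open>Splitting one implicit step into two shorter ones costs only the product of the two lengths,
  because \<open>(1 + a K) (1 + b K) - (1 + (a + b) K) = a b K\<^sup>2\<close>.\<close>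

lemma J_split_error:
  assumes a: "a > 0" and b: "b > 0" and uv: "(u, v) \<in> K" and vw: "(v, w) \<in> K"
  shows "norm (J (a + b) u - J a (J b u)) \<le> a * b * norm w"
proof -
  have ab: "a + b > 0" using a b by simp
  note lin = linear_add[OF J_linear[OF a]] linear_add[OF J_linear[OF b]]
    linear_cmul[OF J_linear[OF a]] linear_cmul[OF J_linear[OF b]]
  define L where "L x = J a (J b x)" for x
  have "J b (u + b *\<^sub>R v) = u" "J b (v + b *\<^sub>R w) = v" "J a (u + a *\<^sub>R v) = u"
    using J_unique a b uv vw by auto
  then have "L ((u + b *\<^sub>R v) + a *\<^sub>R (v + b *\<^sub>R w)) = u"
    unfolding L_def using lin by simp
  then have u: "u = L u + (a + b) *\<^sub>R L v + (a * b) *\<^sub>R L w"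
    unfolding L_def by (simp add: lin algebra_simps)
  have "(L u, L v) \<in> K"
    unfolding L_def by (intro J_resolvent a b uv)
  then have "J (a + b) (L u + (a + b) *\<^sub>R L v) = L u"
    by (rule J_unique[OF ab])
  then have "J (a + b) u = L u + (a * b) *\<^sub>R J (a + b) (L w)"
    by (subst u) (simp add: linear_add[OF J_linear[OF ab]] linear_cmul[OF J_linear[OF ab]])
  then have "J (a + b) u - L u = (a * b) *\<^sub>R J (a + b) (L w)"
    by (metis add_diff_cancel_left')
  then have "norm (J (a + b) u - L u) = a * b * norm (J (a + b) (L w))"
    unfolding \<open>J (a + b) u - L u = _\<close> norm_scaleR using a b by (simp add: abs_mult)
  also have "norm (J (a + b) (L w)) \<le> norm w"
    unfolding L_def
    by (rule order_trans[OF J_contraction[OF ab] order_trans[OF J_contraction[OF a] J_contraction[OF b]]])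
  then have "a * b * norm (J (a + b) (L w)) \<le> a * b * norm w"
    using a b by (intro mult_left_mono) auto
  finally show ?thesis unfolding L_def .
qed

text \<open>Errors of the scheme are controlled by \<open>K\<^sup>2 u\<close>. The domain of \<open>K\<^sup>2\<close> is a core for \<open>K\<close>, since
  \<open>J h u\<close> lies in it and tends to \<open>u\<close> in the graph norm as \<open>h\<close> tends to \<open>0\<close>.\<close>

lemma K2_dense:
  assumes "(u, v) \<in> K" "e > 0"
  obtains u' v' w' where "(u', v') \<in> K" "(v', w') \<in> K" "norm (u - u') < e" "norm (v - v') < e"
proof -
  obtain v0 where v0: "v0 \<in> Domain K" "norm (v - v0) < e / 3"
    using K_dense assms(2) closure_approachable[of v "Domain K"]
    by (metis UNIV_I dist_commute dist_norm divide_pos_pos zero_less_numeral)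
  then obtain w0 where w0: "(v0, w0) \<in> K" by blast
  \<comment> \<open>makes \<open>h * norm v\<close> and \<open>h * norm w0\<close> at most \<open>e / 3\<close>\<close>
  define h where "h = e / 3 / (norm v + norm w0 + 1)"
  have N: "norm v + norm w0 + 1 > 0" by (smt (verit) norm_ge_zero)
  have h: "h > 0" using assms(2) N by (simp add: h_def)
  have hb: "h * (norm v + norm w0 + 1) = e / 3"
    using N unfolding h_def by (rule nonzero_eq_divide_eq[THEN iffD1, OF less_imp_neq[symmetric], OF _ refl])
  have hv: "h * norm v \<le> e / 3" "h * norm w0 \<le> e / 3"
    unfolding hb[symmetric] using h by (auto intro!: mult_left_mono)
  have "norm (v - J h v) \<le> norm (v - v0) + norm (J h (v0 - v)) + norm (J h v0 - v0)"
    unfolding linear_diff[OF J_linear[OF h]]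
    by (smt (verit, ccfv_threshold) diff_add_cancel diff_diff_eq2 norm_minus_commute norm_triangle_ineq)
  also have "\<dots> < e"
    using J_near_id[OF h w0] hv(2) J_contraction[OF h, of "v0 - v"] v0(2)
    by (simp add: norm_minus_commute)
  finally have 1: "norm (v - J h v) < e" .
  have 2: "norm (u - J h u) < e"
    using J_near_id[OF h assms(1)] hv(1) assms(2) by (simp add: norm_minus_commute)
  show thesis
    using that[OF J_resolvent(2)[OF h assms(1)] J_in_K[OF h, of v]] 1 2 by blast
qed

definition E :: "nat \<Rightarrow> real \<Rightarrow> 'a \<Rightarrow> 'a" where
  "E k t = (J (t / 2 ^ k)) ^^ (2 ^ k)"

lemma E_linear: "t > 0 \<Longrightarrow> linear (E k t)"
  unfolding E_def by (intro linear_funpow J_linear) simp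

lemma E_contraction: "t > 0 \<Longrightarrow> norm (E k t x) \<le> norm x"
  unfolding E_def by (intro power_contraction J_contraction) simp

text \<open>Halving the step size changes each of the \<open>2\<^sup>k\<close> steps by an error quadratic in its length, which leaves
  a geometric series for the total.\<close>

lemma E_step:
  assumes t: "t > 0" and "(u, v) \<in> K" "(v, w) \<in> K"
  shows "norm (E (Suc k) t u - E k t u) \<le> t\<^sup>2 * norm w * (1/2) ^ k"
proof -
  define h where "h = t / 2 ^ Suc k"
  have h: "h > 0" using t by (simp add: h_def)
  have hh: "t / 2 ^ k = h + h" by (simp add: h_def)
  have "E (Suc k) t = (J h ^^ 2) ^^ (2 ^ k)"
    unfolding E_def h_def by (simp add: funpow_mult mult.commute)
  also have "J h ^^ 2 = (\<lambda>x. J h (J h x))"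
    by (simp add: numeral_2_eq_2 fun_eq_iff)
  finally have "norm (E (Suc k) t u - E k t u)
      = norm ((J (h + h) ^^ (2 ^ k)) u - ((\<lambda>x. J h (J h x)) ^^ (2 ^ k)) u)"
    unfolding E_def hh by (simp add: norm_minus_commute)
  also have "\<dots> \<le> real (2 ^ k) * norm (J (h + h) u - J h (J h u))"
  proof (rule power_difference_bound)
    show "linear (J (h + h))" using J_linear h by simp
    show "linear (\<lambda>x. J h (J h x))"
      using linear_compose[OF J_linear[OF h] J_linear[OF h]] by (simp add: comp_def)
    show "J (h + h) (J h (J h x)) = J h (J h (J (h + h) x))" for x
      using h by (simp add: J_commute)
    show "norm (J (h + h) x) \<le> norm x" for x using J_contraction h by simp
    show "norm (J h (J h x)) \<le> norm x" for x by (rule order_trans[OF J_contraction[OF h] J_contraction[OF h]])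
  qed
  also have "\<dots> \<le> real (2 ^ k) * (h * h * norm w)"
    by (intro mult_left_mono J_split_error[OF _ _ assms(2,3)] h) simp
  also have "\<dots> = t\<^sup>2 * norm w * (1/2) ^ k / 4"
    by (simp add: h_def power2_eq_square field_simps)
  also have "\<dots> \<le> t\<^sup>2 * norm w * (1/2) ^ k"
    by simp
  finally show ?thesis .
qed

lemma E_Cauchy:
  assumes t: "t > 0"
  shows "Cauchy (\<lambda>k. E k t x)"
proof (rule metric_CauchyI)
  fix e :: real assume e: "e > 0"
  obtain u0 v0 where 0: "(u0, v0) \<in> K" "norm (x - u0) < e / 6"
    using K_dense e closure_approachable[of x "Domain K"]
    by (metis DomainE UNIV_I dist_commute dist_norm divide_pos_pos zero_less_numeral)
  obtain u v w where uvw: "(u, v) \<in> K" "(v, w) \<in> K" "norm (u0 - u) < e / 6"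
    using K2_dense[OF 0(1), of "e / 6" thesis] e by auto
  have xu: "norm (x - u) < e / 3"
    using 0(2) uvw(3) norm_triangle_ineq[of "x - u0" "u0 - u"] by simp
  have "summable (\<lambda>k. E (Suc k) t u - E k t u)"
  proof (rule summable_comparison_test)
    show "\<exists>N. \<forall>n\<ge>N. norm (E (Suc n) t u - E n t u) \<le> t\<^sup>2 * norm w * (1/2) ^ n"
      using E_step[OF t uvw(1,2)] by blast
    show "summable (\<lambda>n. t\<^sup>2 * norm w * (1/2) ^ n)"
      by (intro summable_mult summable_geometric) simp
  qed
  then have "(\<lambda>n. (\<Sum>k<n. E (Suc k) t u - E k t u) + E 0 t u) \<longlonglongrightarrow> (\<Sum>k. E (Suc k) t u - E k t u) + E 0 t u"
    by (intro tendsto_add tendsto_const summable_LIMSEQ)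
  then have "Cauchy (\<lambda>n. E n t u)"
    unfolding sum_lessThan_telescope[of "\<lambda>n. E n t u"] using LIMSEQ_imp_Cauchy by fastforce
  moreover have "0 < e / 3" using e by simp
  ultimately obtain M where M: "\<And>m n. m \<ge> M \<Longrightarrow> n \<ge> M \<Longrightarrow> norm (E m t u - E n t u) < e / 3"
    unfolding Cauchy_iff by blast
  have "dist (E m t x) (E n t x) < e" if "m \<ge> M" "n \<ge> M" for m n
  proof -
    have "norm (E m t x - E n t x) = norm (E m t (x - u) - E n t (x - u) + (E m t u - E n t u))"
      by (simp add: linear_diff[OF E_linear[OF t]])
    also have "\<dots> \<le> norm (E m t (x - u)) + norm (E n t (x - u)) + norm (E m t u - E n t u)"
      by (meson add_right_mono norm_triangle_ineq norm_triangle_ineq4 order_trans)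
    also have "\<dots> < e"
      using E_contraction[OF t, of m "x - u"] E_contraction[OF t, of n "x - u"] xu M[OF that] by linarith
    finally show ?thesis by (simp add: dist_norm)
  qed
  then show "\<exists>M. \<forall>m\<ge>M. \<forall>n\<ge>M. dist (E m t x) (E n t x) < e" by blast
qed

text \<open>The identity is prescribed at time \<open>0\<close>, since Euler steps have positive length.\<close>

definition S :: "real \<Rightarrow> 'a \<Rightarrow> 'a" where
  "S t x = (if t \<le> 0 then x else lim (\<lambda>k. E k t x))"

lemma E_tendsto_S:
  assumes t: "t > 0"
  shows "(\<lambda>k. E k t x) \<longlonglongrightarrow> S t x"
  using Cauchy_convergent[OF E_Cauchy[OF t]] t by (simp add: S_def convergent_LIMSEQ_iff)

lemma S_contraction: "norm (S t x) \<le> norm x"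
proof (cases "t \<le> 0")
  case False
  then have t: "t > 0" by simp
  show ?thesis
    by (rule LIMSEQ_le_const2[OF tendsto_norm[OF E_tendsto_S[OF t]]]) (use E_contraction[OF t] in blast)
qed (simp add: S_def)

lemma S_linear: "linear (S t)"
proof (cases "t \<le> 0")
  case True
  then show ?thesis by (auto simp: S_def intro!: linearI)
next
  case False
  then have t: "t > 0" by simp
  show ?thesis
  proof (rule linearI)
    fix x y and r :: real
    have "(\<lambda>k. E k t (x + y)) \<longlonglongrightarrow> S t x + S t y"
      unfolding linear_add[OF E_linear[OF t]] by (intro tendsto_add E_tendsto_S t)
    then show "S t (x + y) = S t x + S t y"
      using E_tendsto_S[OF t] LIMSEQ_unique by blast
    have "(\<lambda>k. E k t (r *\<^sub>R x)) \<longlonglongrightarrow> r *\<^sub>R S t x"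
      unfolding linear_cmul[OF E_linear[OF t]] by (intro tendsto_scaleR tendsto_const E_tendsto_S t)
    then show "S t (r *\<^sub>R x) = r *\<^sub>R S t x"
      using E_tendsto_S[OF t] LIMSEQ_unique by blast
  qed
qed

lemma S_bounded_linear: "bounded_linear (S t)"
  using S_linear S_contraction
  by (intro bounded_linear.intro bounded_linear_axioms.intro exI[of _ 1]) auto

lemma K2_approx:
  assumes "e > 0"
  obtains u v w where "(u, v) \<in> K" "(v, w) \<in> K" "norm (x - u) < e"
proof -
  obtain u0 v0 where 0: "(u0, v0) \<in> K" "norm (x - u0) < e / 2"
    using K_dense assms closure_approachable[of x "Domain K"]
    by (metis DomainE UNIV_I dist_commute dist_norm divide_pos_pos zero_less_numeral)
  obtain u v w where uvw: "(u, v) \<in> K" "(v, w) \<in> K" "norm (u0 - u) < e / 2"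
    using K2_dense[OF 0(1), of "e / 2" thesis] assms by auto
  show thesis
    using that[OF uvw(1,2)] 0(2) uvw(3) norm_triangle_ineq[of "x - u0" "u0 - u"] by simp
qed

text \<open>Applying the splitting estimate to the \<open>2\<^sup>k\<close> steps of length \<open>(s + t) / 2\<^sup>k\<close> compares the \<open>k\<close>-th
  approximation at \<open>s + t\<close> with the product of those at \<open>s\<close> and \<open>t\<close>.\<close>

lemma S_semigroup:
  assumes s: "s > 0" and t: "t > 0"
  shows "S (s + t) x = S s (S t x)"
proof -
  have D2: "S (s + t) u = S s (S t u)" if uv: "(u, v) \<in> K" and vw: "(v, w) \<in> K" for u v w
  proof -
    have diff: "norm (E k (s + t) u - E k s (E k t u)) \<le> s * t * norm w * (1/2) ^ k" for k
    proof -
      define a where "a = s / 2 ^ k"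
      define b where "b = t / 2 ^ k"
      have a: "a > 0" and b: "b > 0" using s t by (simp_all add: a_def b_def)
      have st: "(s + t) / 2 ^ k = a + b" by (simp add: a_def b_def add_divide_distrib)
      have "(J a ^^ n) ((J b ^^ n) x) = ((\<lambda>x. J a (J b x)) ^^ n) x" for n x
      proof (induction n arbitrary: x)
        case (Suc n)
        have "(J b ^^ n) (J a y) = J a ((J b ^^ n) y)" for y
          by (induction n) (simp_all add: J_commute[OF a b])
        then have "J a ((J b ^^ Suc n) x) = (J b ^^ n) (J a (J b x))"
          by (simp add: funpow_swap1)
        then show ?case
          using Suc[of "J a (J b x)"] by (simp add: funpow_swap1[of "J a"] funpow_swap1[of "\<lambda>x. J a (J b x)"])
      qed simp
      then have "norm (E k (s + t) u - E k s (E k t u))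
          = norm ((J (a + b) ^^ (2 ^ k)) u - ((\<lambda>x. J a (J b x)) ^^ (2 ^ k)) u)"
        unfolding E_def st a_def[symmetric] b_def[symmetric] by simp
      also have "\<dots> \<le> real (2 ^ k) * norm (J (a + b) u - J a (J b u))"
      proof (rule power_difference_bound)
        show "linear (J (a + b))" using J_linear a b by simp
        show "linear (\<lambda>x. J a (J b x))"
          using linear_compose[OF J_linear[OF b] J_linear[OF a]] by (simp add: comp_def)
        show "J (a + b) (J a (J b x)) = J a (J b (J (a + b) x))" for x
          using a b by (simp add: J_commute[of "a + b"])
        show "norm (J (a + b) x) \<le> norm x" for x using J_contraction a b by simp
        show "norm (J a (J b x)) \<le> norm x" for x
          by (rule order_trans[OF J_contraction[OF a] J_contraction[OF b]])
      qed
      also have "\<dots> \<le> real (2 ^ k) * (a * b * norm w)"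
        by (intro mult_left_mono J_split_error[OF _ _ uv vw] a b) simp
      also have "\<dots> = s * t * norm w * (1/2) ^ k"
        by (simp add: a_def b_def power2_eq_square field_simps)
      finally show ?thesis .
    qed
    have "(\<lambda>k. (1/2 :: real) ^ k) \<longlonglongrightarrow> 0"
      by (rule LIMSEQ_power_zero) simp
    from tendsto_mult[OF tendsto_const this, of "s * t * norm w"]
    have geometric: "(\<lambda>k. s * t * norm w * (1/2) ^ k) \<longlonglongrightarrow> 0"
      by simp
    have l1: "(\<lambda>k. E k (s + t) u - E k s (E k t u)) \<longlonglongrightarrow> 0"
      by (rule Lim_null_comparison[OF _ geometric]) (use diff in simp)
    have l2: "(\<lambda>k. E k s (E k t u - S t u)) \<longlonglongrightarrow> 0"
    proof (rule Lim_null_comparison)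
      show "\<forall>\<^sub>F k in sequentially. norm (E k s (E k t u - S t u)) \<le> norm (E k t u - S t u)"
        using E_contraction[OF s] by simp
      show "(\<lambda>k. norm (E k t u - S t u)) \<longlonglongrightarrow> 0"
        using E_tendsto_S[OF t, of u] tendsto_norm_zero LIM_zero by blast
    qed
    have "(\<lambda>k. (E k (s + t) u - E k s (E k t u)) + E k s (E k t u - S t u) + E k s (S t u)) \<longlonglongrightarrow> 0 + 0 + S s (S t u)"
      by (intro tendsto_add l1 l2 E_tendsto_S s)
    then have "(\<lambda>k. E k (s + t) u) \<longlonglongrightarrow> S s (S t u)"
      by (simp add: linear_diff[OF E_linear[OF s]])
    then show ?thesis
      using E_tendsto_S[of "s + t" u] s t LIMSEQ_unique by (metis add_pos_pos)
  qed
  have "norm (S (s + t) x - S s (S t x)) \<le> 0 + e" if e: "e > 0" for e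
  proof -
    obtain u v w where uvw: "(u, v) \<in> K" "(v, w) \<in> K" "norm (x - u) < e / 2"
      using K2_approx[of "e / 2" x] e by auto
    have "S (s + t) x - S s (S t x) = S (s + t) (x - u) - S s (S t (x - u))"
      using D2[OF uvw(1,2)] by (simp add: linear_diff[OF S_linear])
    also have "norm \<dots> \<le> norm (x - u) + norm (x - u)"
      using norm_triangle_ineq4 S_contraction by (smt (verit, best))
    finally show ?thesis using uvw(3) by simp
  qed
  then have "norm (S (s + t) x - S s (S t x)) \<le> 0"
    by (rule field_le_epsilon)
  then show ?thesis by simp
qed

lemma E_first_order:
  assumes t: "t > 0" and uv: "(u, v) \<in> K"
  shows "norm (E k t u - u) \<le> t * norm v"
proof -
  have h: "t / 2 ^ k > 0" using t by simp
  have "norm (E k t u - ((\<lambda>x. x) ^^ (2 ^ k)) u) \<le> real (2 ^ k) * norm (J (t / 2 ^ k) u - u)"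
    unfolding E_def by (rule power_difference_bound) (auto simp: J_linear h J_contraction linear_id[unfolded id_def])
  moreover have "((\<lambda>x. x) ^^ n) u = u" for n :: nat
    by (induction n) auto
  ultimately have "norm (E k t u - u) \<le> real (2 ^ k) * norm (J (t / 2 ^ k) u - u)"
    by simp
  also have "\<dots> \<le> real (2 ^ k) * (t / 2 ^ k * norm v)"
    by (intro mult_left_mono J_near_id h uv) simp
  finally show ?thesis by simp
qed

text \<open>A discrete Taylor expansion, uniform in the number of steps for fixed total time \<open>n h\<close>.\<close>

lemma J_power_second_order:
  assumes h: "h > 0" and uv: "(u, v) \<in> K" and vw: "(v, w) \<in> K"
  shows "norm ((J h ^^ n) u - u + (real n * h) *\<^sub>R v) \<le> (real n * h)\<^sup>2 * norm w"
proof (induction n)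
  case (Suc n)
  have id: "norm ((J h ^^ m) v - v) \<le> real m * (h * norm w)" for m
  proof -
    have "norm ((J h ^^ m) v - ((\<lambda>x. x) ^^ m) v) \<le> real m * norm (J h v - v)"
      by (rule power_difference_bound) (auto simp: J_linear h J_contraction linear_id[unfolded id_def])
    moreover have "((\<lambda>x. x) ^^ m) v = v"
      by (induction m) auto
    ultimately show ?thesis
      using mult_left_mono[OF J_near_id[OF h vw], of "real m"] by simp
  qed
  have lin: "linear (J h ^^ n)" by (intro linear_funpow J_linear h)
  have "(J h ^^ Suc n) u = (J h ^^ n) (u - h *\<^sub>R J h v)"
    by (simp add: funpow_swap1 J_resolvent(1)[OF h uv, symmetric])
  also have "\<dots> = (J h ^^ n) u - h *\<^sub>R (J h ^^ Suc n) v"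
    by (simp add: linear_diff[OF lin] linear_cmul[OF lin] funpow_swap1)
  finally have "(J h ^^ Suc n) u - u + (real (Suc n) * h) *\<^sub>R v
      = ((J h ^^ n) u - u + (real n * h) *\<^sub>R v) - h *\<^sub>R ((J h ^^ Suc n) v - v)"
    by (simp add: algebra_simps)
  also have "norm \<dots> \<le> (real n * h)\<^sup>2 * norm w + h * (real (Suc n) * (h * norm w))"
  proof (rule order_trans[OF norm_triangle_ineq4 add_mono[OF Suc]])
    show "norm (h *\<^sub>R ((J h ^^ Suc n) v - v)) \<le> h * (real (Suc n) * (h * norm w))"
      unfolding norm_scaleR abs_of_pos[OF h] using h by (intro mult_left_mono[OF id]) simp
  qed
  also have "\<dots> = ((real n)\<^sup>2 + real n + 1) * (h\<^sup>2 * norm w)"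
    by (simp add: power2_eq_square algebra_simps)
  also have "\<dots> \<le> (real (Suc n))\<^sup>2 * (h\<^sup>2 * norm w)"
    using h by (intro mult_right_mono) (simp_all add: power2_eq_square algebra_simps)
  finally show ?case by (simp only: power_mult_distrib mult.assoc)
qed simp

lemma S_first_order:
  assumes "t > 0" "(u, v) \<in> K"
  shows "norm (S t u - u) \<le> t * norm v"
  by (rule LIMSEQ_le_const2[OF tendsto_norm[OF tendsto_diff[OF E_tendsto_S tendsto_const]]])
     (use assms E_first_order in blast)+

lemma S_second_order:
  assumes t: "t > 0" and "(u, v) \<in> K" "(v, w) \<in> K"
  shows "norm (S t u - u + t *\<^sub>R v) \<le> t\<^sup>2 * norm w"
proof (rule LIMSEQ_le_const2)
  show "(\<lambda>k. norm (E k t u - u + t *\<^sub>R v)) \<longlonglongrightarrow> norm (S t u - u + t *\<^sub>R v)"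
    by (intro tendsto_intros E_tendsto_S t)
  have "norm (E k t u - u + t *\<^sub>R v) \<le> t\<^sup>2 * norm w" for k
    using J_power_second_order[of "t / 2 ^ k" u v w "2 ^ k"] assms by (simp add: E_def)
  then show "\<exists>N. \<forall>n\<ge>N. norm (E n t u - u + t *\<^sub>R v) \<le> t\<^sup>2 * norm w" by blast
qed

lemma S_continuous: "((\<lambda>t. S t x) \<longlongrightarrow> x) (at_right 0)"
proof (rule tendstoI)
  fix e :: real assume e: "e > 0"
  obtain u v w where uvw: "(u, v) \<in> K" "(v, w) \<in> K" "norm (x - u) < e / 3"
    using K2_approx[of "e / 3" x] e by auto
  define d where "d = e / (3 * (norm v + 1))"
  have d: "d > 0" using e by (simp add: d_def add_nonneg_pos)
  have dv: "d * norm v < e / 3"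
  proof -
    have "d * norm v < d * (norm v + 1)" using d by simp
    also have "\<dots> = e / 3" by (simp add: d_def add_nonneg_eq_0_iff field_simps)
    finally show ?thesis .
  qed
  have "dist (S t x) x < e" if t: "0 < t" "t < d" for t
  proof -
    have "S t x - x = S t (x - u) - (x - u) + (S t u - u)"
      by (simp add: linear_diff[OF S_linear])
    also have "norm \<dots> \<le> norm (x - u) + norm (x - u) + t * norm v"
      using S_contraction[of t "x - u"] S_first_order[OF t(1) uvw(1)]
      by (smt (verit) norm_triangle_ineq norm_triangle_ineq4)
    also have "t * norm v \<le> d * norm v"
      using t by (intro mult_right_mono) auto
    finally show ?thesis using uvw(3) dv by (simp add: dist_norm)
  qed
  then show "\<forall>\<^sub>F t in at_right 0. dist (S t x) x < e"
    unfolding eventually_at_right_field using d by blast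
qed

text \<open>On the domain of \<open>K\<^sup>2\<close> this is the second-order expansion. It extends to the domain of \<open>K\<close> since
  the difference quotients of \<open>S\<close> are bounded, uniformly in \<open>t\<close>, by the graph norm.\<close>

lemma S_generator:
  assumes uv: "(u, v) \<in> K"
  shows "((\<lambda>t. (S t u - u) /\<^sub>R t) \<longlongrightarrow> - v) (at_right 0)"
proof (rule tendstoI)
  fix e :: real assume e: "e > 0"
  obtain u' v' w' where a: "(u', v') \<in> K" "(v', w') \<in> K" "norm (v - v') < e / 3"
    using K2_dense[OF uv, of "e / 3" thesis] e by auto
  define d where "d = e / (3 * (norm w' + 1))"
  have d: "d > 0" using e by (simp add: d_def add_nonneg_pos)
  have dw: "d * norm w' < e / 3"
  proof -
    have "d * norm w' < d * (norm w' + 1)" using d by simp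
    also have "\<dots> = e / 3" by (simp add: d_def add_nonneg_eq_0_iff field_simps)
    finally show ?thesis .
  qed
  have "dist ((S t u - u) /\<^sub>R t) (- v) < e" if t: "0 < t" "t < d" for t
  proof -
    have 1: "norm (S t (u - u') - (u - u')) \<le> t * norm (v - v')"
      by (intro S_first_order t K_diff uv a)
    have 2: "norm (S t u' - u' + t *\<^sub>R v') \<le> t\<^sup>2 * norm w'"
      by (intro S_second_order t a)
    have "t *\<^sub>R ((S t u - u) /\<^sub>R t - (- v))
        = (S t (u - u') - (u - u')) + (S t u' - u' + t *\<^sub>R v') + t *\<^sub>R (v - v')"
      using t by (simp add: linear_diff[OF S_linear] algebra_simps)
    then have "t * norm ((S t u - u) /\<^sub>R t - (- v))
        = norm ((S t (u - u') - (u - u')) + (S t u' - u' + t *\<^sub>R v') + t *\<^sub>R (v - v'))"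
      using t by (metis abs_of_pos norm_scaleR)
    also have "\<dots> \<le> t * norm (v - v') + t\<^sup>2 * norm w' + t * norm (v - v')"
    proof (rule order_trans[OF norm_triangle_ineq add_mono[OF order_trans[OF norm_triangle_ineq add_mono[OF 1 2]]]])
      show "norm (t *\<^sub>R (v - v')) \<le> t * norm (v - v')"
        unfolding norm_scaleR abs_of_pos[OF t(1)] by (rule order_refl)
    qed
    also have "\<dots> = t * (2 * norm (v - v') + t * norm w')"
      by (simp add: power2_eq_square algebra_simps)
    finally have "norm ((S t u - u) /\<^sub>R t - (- v)) \<le> 2 * norm (v - v') + t * norm w'"
      using t by simp
    also have "t * norm w' \<le> d * norm w'"
      using t by (intro mult_right_mono) auto
    finally show ?thesis using a(3) dw by (simp add: dist_norm)
  qed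
  then show "\<forall>\<^sub>F t in at_right 0. dist ((S t u - u) /\<^sub>R t) (- v) < e"
    unfolding eventually_at_right_field using d by blast
qed

end

section \<open>Symmetric operators and operators defined by a form graph\<close>

locale symmetric_accretive_op = accretive_op +
  assumes K_symmetric: "(u, v) \<in> K \<Longrightarrow> (u', v') \<in> K \<Longrightarrow> inner v u' = inner u v'"
begin

lemma J_symmetric:
  assumes h: "h > 0"
  shows "inner (J h k) l = inner k (J h l)"
proof -
  have "inner ((k - J h k) /\<^sub>R h) (J h l) = inner (J h k) ((l - J h l) /\<^sub>R h)"
    by (intro K_symmetric J_in_K h)
  then show ?thesis
    using h by (simp add: inner_diff)
qed

text \<open>For \<open>(f, g)\<close> in the graph of the adjoint, symmetry of the resolvent gives \<open>f = J 1 (f + g)\<close>, which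
  lies in the domain of \<open>K\<close>.\<close>

lemma K_maximal:
  assumes "\<And>u v. (u, v) \<in> K \<Longrightarrow> inner v f = inner u g"
  shows "(f, g) \<in> K"
proof -
  have one: "(1::real) > 0" by simp
  have JK: "(J 1 k, k - J 1 k) \<in> K" for k
    using J_in_K[OF one, of k] by simp
  have "inner k f = inner k (J 1 (f + g))" for k
    using assms[OF JK[of k]] J_symmetric[OF one, of k "f + g"]
    by (simp add: inner_diff inner_add)
  then have "inner (f - J 1 (f + g)) (f - J 1 (f + g)) = 0"
    by (simp add: inner_diff_right)
  then have "J 1 (f + g) = f" by simp
  then show ?thesis using JK[of "f + g"] by simp
qed

lemma E_symmetric:
  assumes t: "t > 0"
  shows "inner (E k t x) y = inner x (E k t y)"
proof -
  have h: "t / 2 ^ k > 0" using t by simp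
  have "inner ((J (t / 2 ^ k) ^^ n) x) y = inner x ((J (t / 2 ^ k) ^^ n) y)" for n x y
  proof (induction n arbitrary: x y)
    case (Suc n)
    have "inner ((J (t / 2 ^ k) ^^ Suc n) x) y = inner ((J (t / 2 ^ k) ^^ n) x) (J (t / 2 ^ k) y)"
      by (simp add: J_symmetric[OF h])
    also have "\<dots> = inner x ((J (t / 2 ^ k) ^^ n) (J (t / 2 ^ k) y))" by (rule Suc)
    finally show ?case by (simp add: funpow_swap1)
  qed simp
  then show ?thesis unfolding E_def .
qed

lemma S_symmetric:
  assumes t: "t > 0"
  shows "inner (S t x) y = inner x (S t y)"
proof (rule LIMSEQ_unique)
  show "(\<lambda>k. inner (E k t x) y) \<longlonglongrightarrow> inner (S t x) y"
    by (intro tendsto_inner tendsto_const E_tendsto_S t)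
  show "(\<lambda>k. inner (E k t x) y) \<longlonglongrightarrow> inner x (S t y)"
    unfolding E_symmetric[OF t] by (intro tendsto_inner tendsto_const E_tendsto_S t)
qed

text \<open>The generator of a semigroup of symmetric operators is symmetric. Hence its negative, which extends
  \<open>K\<close>, is contained in the adjoint of \<open>K\<close>, and this is \<open>K\<close> itself.\<close>

lemma generator_subset_K:
  assumes lim: "((\<lambda>t. (S t u - u) /\<^sub>R t) \<longlongrightarrow> - v) (at_right 0)"
  shows "(u, v) \<in> K"
proof (rule K_maximal)
  fix a b assume ab: "(a, b) \<in> K"
  have "((\<lambda>t. inner ((S t a - a) /\<^sub>R t) u) \<longlongrightarrow> inner (- b) u) (at_right 0)"
    by (intro tendsto_inner tendsto_const S_generator ab)
  moreover have "((\<lambda>t. inner ((S t a - a) /\<^sub>R t) u) \<longlongrightarrow> inner a (- v)) (at_right 0)"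
  proof (rule Lim_transform_eventually)
    show "((\<lambda>t. inner a ((S t u - u) /\<^sub>R t)) \<longlongrightarrow> inner a (- v)) (at_right 0)"
      by (intro tendsto_inner tendsto_const lim)
    show "\<forall>\<^sub>F t in at_right 0. inner a ((S t u - u) /\<^sub>R t) = inner ((S t a - a) /\<^sub>R t) u"
      using eventually_at_right_less[of "0::real"]
      by eventually_elim (simp add: inner_diff S_symmetric)
  qed
  ultimately have "inner (- b) u = inner a (- v)"
    by (rule tendsto_unique[rotated]) simp
  then show "inner b u = inner a v" by simp
qed

end

text \<open>For a graph \<open>G\<close> of an operator \<open>T\<close> this is \<open>T\<^sup>* T\<close>, that is, the operator of the quadratic form
  \<open>\<parallel>T u\<parallel>\<^sup>2\<close>. The definition makes sense for arbitrary \<open>G\<close>, in particular before \<open>G\<close> is known to be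
  single-valued.\<close>

definition form_op :: "('a::real_inner \<times> 'a) set \<Rightarrow> ('a \<times> 'a) set" where
  "form_op G = {(u, v). \<exists>g. (u, g) \<in> G \<and> (\<forall>(a, b)\<in>G. inner b g = inner a v)}"

lemma form_opI:
  "(u, g) \<in> G \<Longrightarrow> (\<And>a b. (a, b) \<in> G \<Longrightarrow> inner b g = inner a v) \<Longrightarrow> (u, v) \<in> form_op G"
  unfolding form_op_def by blast

text \<open>The functional minimised by the resolvent, with the square completed. The mixed terms cancel by the
  Euler-Lagrange equation \<open>el\<close>.\<close>

lemma form_op_variational:
  fixes G :: "('a::real_inner \<times> 'a) set"
  assumes G: "subspace G" and h: "h > 0" and ug: "(u, g) \<in> G"
    and el: "\<And>a b. (a, b) \<in> G \<Longrightarrow> inner b g = inner a ((f - u) /\<^sub>R h)" and ab: "(a, b) \<in> G"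
  shows "(norm (a - f))\<^sup>2 + h * (norm b)\<^sup>2
    = (norm (u - f))\<^sup>2 + h * (norm g)\<^sup>2 + (norm (a - u))\<^sup>2 + h * (norm (b - g))\<^sup>2"
proof -
  have "(a - u, b - g) \<in> G"
    using subspace_diff[OF G ab ug] by simp
  from el[OF this] have "h * inner (b - g) g = inner (a - u) (f - u)"
    using h by simp
  then show ?thesis
    unfolding power2_norm_eq_inner by (simp add: inner_diff inner_commute algebra_simps)
qed

lemma form_op_zero:
  fixes G :: "('a::real_inner \<times> 'a) set"
  assumes dense: "closure (Domain G) = UNIV" and "(0, x) \<in> form_op G"
  shows "x = 0"
proof -
  obtain g where g: "(0, g) \<in> G" "\<And>a b. (a, b) \<in> G \<Longrightarrow> inner b g = inner a x"
    using assms(2) unfolding form_op_def by blast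
  have "inner g g = 0" using g(2)[OF g(1)] by simp
  then have "inner a x = 0" if "a \<in> Domain G" for a
    using g(2) that by auto
  then have "Domain G \<subseteq> {a. inner a x = 0}" by blast
  moreover have "closed {a. inner a x = 0}"
    by (intro closed_Collect_eq continuous_intros)
  ultimately have "closure (Domain G) \<subseteq> {a. inner a x = 0}"
    by (rule closure_minimal)
  then have "inner x x = 0" unfolding dense by blast
  then show ?thesis by simp
qed

text \<open>The resolvent \<open>u\<close> of \<open>f\<close> with step \<open>h\<close> comes from the orthogonal projection of \<open>(f, 0)\<close> onto the
  graph of \<open>\<surd>h T\<close>; orthogonality is the Euler-Lagrange equation.\<close>

lemma symmetric_accretive_form_op:
  fixes G :: "('a::{real_inner,banach} \<times> 'a) set"
  assumes closed: "closed G" and G: "subspace G" and dense: "closure (Domain G) = UNIV"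
  shows "symmetric_accretive_op (form_op G)"
proof -
  have add: "(u + u', v + v') \<in> form_op G" if "(u, v) \<in> form_op G" "(u', v') \<in> form_op G" for u v u' v'
  proof -
    obtain g where g: "(u, g) \<in> G" "\<And>a b. (a, b) \<in> G \<Longrightarrow> inner b g = inner a v"
      using \<open>(u, v) \<in> form_op G\<close> unfolding form_op_def by blast
    obtain g' where g': "(u', g') \<in> G" "\<And>a b. (a, b) \<in> G \<Longrightarrow> inner b g' = inner a v'"
      using \<open>(u', v') \<in> form_op G\<close> unfolding form_op_def by blast
    show ?thesis
      using subspace_add[OF G g(1) g'(1)] g(2) g'(2)
      by (intro form_opI[of _ "g + g'"]) (simp_all add: inner_add_right)
  qed
  have scale: "(r *\<^sub>R u, r *\<^sub>R v) \<in> form_op G" if uv: "(u, v) \<in> form_op G" for r u v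
  proof -
    obtain g where g: "(u, g) \<in> G" "\<And>a b. (a, b) \<in> G \<Longrightarrow> inner b g = inner a v"
      using uv unfolding form_op_def by blast
    show ?thesis
      using subspace_scale[OF G g(1), of r] g(2)
      by (intro form_opI[of _ "r *\<^sub>R g"]) simp_all
  qed
  have accretive: "0 \<le> inner u v" if uv: "(u, v) \<in> form_op G" for u v
  proof -
    obtain g where g: "(u, g) \<in> G" "\<And>a b. (a, b) \<in> G \<Longrightarrow> inner b g = inner a v"
      using uv unfolding form_op_def by blast
    show ?thesis using g(2)[OF g(1)] by (metis inner_ge_zero)
  qed
  have range: "\<exists>u. (u, (f - u) /\<^sub>R h) \<in> form_op G" if h: "h > 0" for h f
  proof -
    \<comment> \<open>On the graph \<open>G'\<close> of \<open>\<surd>h T\<close> the functional \<open>\<parallel>a - f\<parallel>\<^sup>2 + h \<parallel>b\<parallel>\<^sup>2\<close> becomes the squared distance to \<open>(f, 0)\<close>.\<close>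
    define s where "s = sqrt h"
    have s: "s > 0" "s * s = h" using h by (simp_all add: s_def)
    define G' where "G' = (\<lambda>(a, b). (a, b /\<^sub>R s)) -` G"
    have "closed G'"
      unfolding G'_def using closed
      by (rule closed_vimage) (auto simp: case_prod_beta intro!: continuous_intros)
    moreover have "subspace G'"
      unfolding G'_def using G
      by (intro linear_subspace_vimage linearI) (auto simp: scaleR_add_right)
    ultimately obtain p where p: "p \<in> G'" "\<And>q. q \<in> G' \<Longrightarrow> inner q ((f, 0) - p) = 0"
      using orthogonal_projection_exists by blast
    define u where "u = fst p"
    define g where "g = snd p /\<^sub>R s"
    have ug: "(u, g) \<in> G" using p(1) by (simp add: G'_def u_def g_def case_prod_beta)
    have "inner b g = inner a ((f - u) /\<^sub>R h)" if ab: "(a, b) \<in> G" for a b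
    proof -
      have "(a, s *\<^sub>R b) \<in> G'" using ab s(1) by (simp add: G'_def)
      from p(2)[OF this] have "inner a (f - u) = inner (s *\<^sub>R b) (snd p)"
        by (simp add: inner_prod_def u_def)
      also have "\<dots> = (s * s) * inner b g"
        using s(1) by (simp add: g_def)
      finally show ?thesis
        using s h by simp
    qed
    with ug show ?thesis by (blast intro: form_opI)
  qed
  have dom: "closure (Domain (form_op G)) = UNIV"
  proof (rule dense_subspace_if_no_orthogonal)
    show "subspace (Domain (form_op G))"
    proof (rule subspaceI)
      show "0 \<in> Domain (form_op G)"
        using form_opI[of 0 0 G 0] subspace_0[OF G] by (auto simp: zero_prod_def)
    qed (use add scale in blast)+
    fix x assume orth: "\<And>m. m \<in> Domain (form_op G) \<Longrightarrow> inner m x = 0"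
    obtain u where u: "(u, (x - u) /\<^sub>R 1) \<in> form_op G"
      using range[of 1 x] by auto
    then have "inner u x = 0" "0 \<le> inner u (x - u)"
      using orth accretive[OF u] by auto
    then have "inner u u \<le> 0" by (simp add: inner_diff_right)
    then have "u = 0" by (metis inner_eq_zero_iff inner_ge_zero antisym)
    then show "x = 0" using form_op_zero[OF dense] u by simp
  qed
  have sym: "inner v u' = inner u v'" if "(u, v) \<in> form_op G" "(u', v') \<in> form_op G" for u v u' v'
  proof -
    obtain g where g: "(u, g) \<in> G" "\<And>a b. (a, b) \<in> G \<Longrightarrow> inner b g = inner a v"
      using \<open>(u, v) \<in> form_op G\<close> unfolding form_op_def by blast
    obtain g' where g': "(u', g') \<in> G" "\<And>a b. (a, b) \<in> G \<Longrightarrow> inner b g' = inner a v'"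
      using \<open>(u', v') \<in> form_op G\<close> unfolding form_op_def by blast
    show ?thesis
      using g(2)[OF g'(1)] g'(2)[OF g(1)] by (metis inner_commute)
  qed
  show ?thesis
    by unfold_locales (fact add scale accretive range dom sym)+
qed

section \<open>The space of square-integrable functions\<close>

lemma square_integrable_measurable [measurable_dest]:
  "square_integrable f \<Longrightarrow> f \<in> borel_measurable lborel"
  by (simp add: square_integrable_def)

lemma abs_rep_L2: "abs_L2 (rep_L2 u) = u"
  by (rule Quotient3_abs_rep[OF Quotient3_L2])

lemma square_integrable_rep_L2: "square_integrable (rep_L2 u)"
  using Quotient3_rep_reflp[OF Quotient3_L2, of u] by (simp add: L2_eq_def)

lemma L2_eq_refl: "square_integrable f \<Longrightarrow> L2_eq f f"
  by (simp add: L2_eq_def)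

lemma rep_abs_L2: "square_integrable f \<Longrightarrow> AE x in lborel. rep_L2 (abs_L2 f) x = f x"
  using Quotient3_rep_abs[OF Quotient3_L2, of f] L2_eq_refl[of f] unfolding L2_eq_def by blast

lemma abs_L2_eqI:
  assumes "square_integrable f" "square_integrable g" "AE x in lborel. f x = g x"
  shows "abs_L2 f = abs_L2 g"
  using Quotient3_rel[OF Quotient3_L2, of f g] assms by (auto simp: L2_eq_def)

lemma abs_L2_eqD:
  assumes "square_integrable f" "square_integrable g" "abs_L2 f = abs_L2 g"
  shows "AE x in lborel. f x = g x"
  using Quotient3_rel[OF Quotient3_L2, of f g] assms by (auto simp: L2_eq_def)

lemma square_integrable_diff:
  assumes "square_integrable f" "square_integrable g"
  shows "square_integrable (\<lambda>x. f x - g x)"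
  using square_integrable_add[OF assms(1) square_integrable_uminus[OF assms(2)]] by simp

lemma abs_L2_add:
  "square_integrable f \<Longrightarrow> square_integrable g \<Longrightarrow> abs_L2 f + abs_L2 g = abs_L2 (\<lambda>x. f x + g x)"
  by (intro plus_L2.abs_eq L2_eq_refl)

lemma abs_L2_diff:
  "square_integrable f \<Longrightarrow> square_integrable g \<Longrightarrow> abs_L2 f - abs_L2 g = abs_L2 (\<lambda>x. f x - g x)"
  by (simp add: minus_L2_def uminus_L2.abs_eq L2_eq_refl abs_L2_add square_integrable_uminus)

lemma abs_L2_scaleR:
  "square_integrable f \<Longrightarrow> r *\<^sub>R abs_L2 f = abs_L2 (\<lambda>x. r *\<^sub>R f x)"
  by (intro scaleR_L2.abs_eq L2_eq_refl)

lemma abs_L2_scaleC: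
  "square_integrable f \<Longrightarrow> scaleC_L2 a (abs_L2 f) = abs_L2 (\<lambda>x. a * f x)"
  by (intro scaleC_L2.abs_eq L2_eq_refl)

lemma inner_abs_L2:
  "square_integrable f \<Longrightarrow> square_integrable g \<Longrightarrow>
    inner (abs_L2 f) (abs_L2 g) = (\<integral>x. inner (f x) (g x) \<partial>lborel)"
  by (intro inner_L2.abs_eq L2_eq_refl)

lemma norm_abs_L2:
  assumes "square_integrable f"
  shows "(norm (abs_L2 f))\<^sup>2 = (\<integral>x. (norm (f x))\<^sup>2 \<partial>lborel)"
  unfolding power2_norm_eq_inner inner_abs_L2[OF assms assms] ..

lemma norm_abs_L2_mono:
  assumes f: "square_integrable f" and g: "square_integrable g"
    and "AE x in lborel. norm (f x) \<le> norm (g x)"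
  shows "norm (abs_L2 f) \<le> norm (abs_L2 g)"
proof -
  have "(norm (abs_L2 f))\<^sup>2 \<le> (norm (abs_L2 g))\<^sup>2"
    unfolding norm_abs_L2[OF f] norm_abs_L2[OF g]
  proof (rule integral_mono_AE)
    show "integrable lborel (\<lambda>x. (norm (f x))\<^sup>2)" "integrable lborel (\<lambda>x. (norm (g x))\<^sup>2)"
      using f g by (simp_all add: square_integrable_def)
    show "AE x in lborel. (norm (f x))\<^sup>2 \<le> (norm (g x))\<^sup>2"
      using assms(3) by eventually_elim (rule power_mono, simp_all)
  qed
  then show ?thesis
    by (rule power2_le_imp_le) simp
qed

lemma square_integrable_bound:
  fixes f g :: "real \<Rightarrow> complex"
  assumes "square_integrable g" "f \<in> borel_measurable lborel"
    "AE x in lborel. norm (f x) \<le> norm (g x)"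
  shows "square_integrable f"
  unfolding square_integrable_def
proof
  have [measurable]: "f \<in> borel_measurable lborel" by fact
  show "integrable lborel (\<lambda>x. (norm (f x))\<^sup>2)"
  proof (rule Bochner_Integration.integrable_bound)
    show "integrable lborel (\<lambda>x. (norm (g x))\<^sup>2)"
      using assms(1) by (simp add: square_integrable_def)
    show "AE x in lborel. norm ((norm (f x))\<^sup>2) \<le> norm ((norm (g x))\<^sup>2)"
      using assms(3) by eventually_elim (auto intro!: power_mono)
  qed measurable
qed fact

lemma cinner_abs_L2:
  "square_integrable f \<Longrightarrow> square_integrable g \<Longrightarrow>
    cinner_L2 (abs_L2 f) (abs_L2 g) = (\<integral>x. f x * cnj (g x) \<partial>lborel)"
  by (intro cinner_L2.abs_eq L2_eq_refl)

lemma L2_cases: obtains f where "square_integrable f" "u = abs_L2 f"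
  using square_integrable_rep_L2 abs_rep_L2 by metis

lemma scaleC_add: "scaleC_L2 a (u + v) = scaleC_L2 a u + scaleC_L2 a v"
proof -
  obtain f g where "square_integrable f" "u = abs_L2 f" "square_integrable g" "v = abs_L2 g"
    using L2_cases by metis
  then show ?thesis
    by (simp add: abs_L2_add abs_L2_scaleC square_integrable_add square_integrable_scale algebra_simps)
qed

lemma scaleC_of_real: "scaleC_L2 (of_real r) u = r *\<^sub>R u"
proof -
  obtain f where "square_integrable f" "u = abs_L2 f"
    using L2_cases by metis
  then show ?thesis
    by (simp add: abs_L2_scaleR abs_L2_scaleC scaleR_conv_of_real)
qed

lemma scaleC_scaleC: "scaleC_L2 a (scaleC_L2 b u) = scaleC_L2 (a * b) u"
proof -
  obtain f where "square_integrable f" "u = abs_L2 f"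
    using L2_cases by metis
  then show ?thesis
    by (simp add: abs_L2_scaleC square_integrable_scale mult.assoc)
qed

lemma norm_scaleC: "norm (scaleC_L2 a u) = norm a * norm u"
proof -
  obtain f where f: "square_integrable f" "u = abs_L2 f"
    using L2_cases by metis
  have "(norm (scaleC_L2 a u))\<^sup>2 = (norm a * norm u)\<^sup>2"
    unfolding f(2) abs_L2_scaleC[OF f(1)] power_mult_distrib norm_abs_L2[OF f(1)]
      norm_abs_L2[OF square_integrable_scale[OF f(1)]]
    by (simp add: norm_mult power_mult_distrib)
  then show ?thesis
    using power2_eq_iff_nonneg[of "norm (scaleC_L2 a u)" "norm a * norm u"] by simp
qed

lemma scaleC_scaleR: "scaleC_L2 a (r *\<^sub>R u) = r *\<^sub>R scaleC_L2 a u"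
  unfolding scaleC_of_real[symmetric] scaleC_scaleC by (simp add: mult.commute)

lemma bounded_linear_scaleC: "bounded_linear (scaleC_L2 a)"
  by (rule bounded_linear_intro[of _ "norm a"])
     (simp_all add: scaleC_add scaleC_scaleR norm_scaleC mult.commute)

lemma scaleC_diff: "scaleC_L2 a (u - v) = scaleC_L2 a u - scaleC_L2 a v"
  by (rule linear_diff[OF bounded_linear.linear[OF bounded_linear_scaleC]])

text \<open>Real inner products determine complex ones, so that for complex-linear operators all identities
  between inner products may be checked on real parts.\<close>

lemma cinner_eq_inner: "cinner_L2 u v = Complex (inner u v) (inner (scaleC_L2 (- \<i>) u) v)"
proof -
  obtain f g where f: "square_integrable f" "u = abs_L2 f" and g: "square_integrable g" "v = abs_L2 g"
    using L2_cases by metis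
  note i = square_integrable_prod[OF f(1) g(1)]
  show ?thesis
    unfolding f(2) g(2) abs_L2_scaleC[OF f(1)] cinner_abs_L2[OF f(1) g(1)] inner_abs_L2[OF f(1) g(1)]
      inner_abs_L2[OF square_integrable_scale[OF f(1)] g(1)]
    using integral_Re[OF i] integral_Im[OF i]
    by (intro complex_eqI) (simp_all add: inner_complex_def algebra_simps)
qed

lemma Re_cinner: "Re (cinner_L2 u v) = inner u v"
  by (simp add: cinner_eq_inner)

lemma adjoint_op_imp_inner:
  assumes "(f, g) \<in> adjoint_op K" "(u, v) \<in> K"
  shows "inner v f = inner u g"
proof -
  have "cinner_L2 v f = cinner_L2 u g"
    using assms by (auto simp: adjoint_op_def)
  then show ?thesis by (metis Re_cinner)
qed

lemma adjoint_op_real: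
  assumes "\<And>a u v. (u, v) \<in> K \<Longrightarrow> (scaleC_L2 a u, scaleC_L2 a v) \<in> K"
  shows "(f, g) \<in> adjoint_op K \<longleftrightarrow> (\<forall>(u, v)\<in>K. inner v f = inner u g)"
proof
  assume "(f, g) \<in> adjoint_op K"
  then show "\<forall>(u, v)\<in>K. inner v f = inner u g"
    using adjoint_op_imp_inner by blast
next
  assume a: "\<forall>(u, v)\<in>K. inner v f = inner u g"
  then have "inner (scaleC_L2 (- \<i>) v) f = inner (scaleC_L2 (- \<i>) u) g" if "(u, v) \<in> K" for u v
    using assms that by blast
  then show "(f, g) \<in> adjoint_op K"
    unfolding adjoint_op_def cinner_eq_inner using a by auto
qed

lemma closed_adjoint_op: "closed (adjoint_op K)"
proof -
  have "adjoint_op K = (\<Inter>p\<in>K. {x. inner (snd p) (fst x) = inner (fst p) (snd x) \<and>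
      inner (scaleC_L2 (- \<i>) (snd p)) (fst x) = inner (scaleC_L2 (- \<i>) (fst p)) (snd x)})"
    unfolding adjoint_op_def cinner_eq_inner by (force simp: case_prod_beta)
  also have "closed \<dots>"
    by (intro closed_INT ballI) (auto intro!: closed_Collect_conj closed_Collect_eq continuous_intros)
  finally show ?thesis .
qed

text \<open>Such a weight transfers \<open>L\<^sup>2\<close> statements to \<open>L\<^sup>1\<close>, since its product with a square-integrable function is
  integrable.\<close>

lemma positive_square_integrable_function:
  obtains k :: "real \<Rightarrow> real" where "square_integrable (\<lambda>x. of_real (k x))" "\<And>x. k x > 0"
proof -
  obtain h :: "real \<Rightarrow> ennreal" where h: "h \<in> borel_measurable lborel" "integral\<^sup>N lborel h \<noteq> \<infinity>"
    "\<And>x. 0 < h x \<and> h x < \<infinity>"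
    using sigma_finite_measure.Ex_finite_integrable_function[OF sigma_finite_lborel] by auto
  note [measurable] = h(1)
  define k where "k x = sqrt (enn2real (h x))" for x
  have pos: "k x > 0" for x
    using h(3)[of x] by (simp add: k_def enn2real_positive_iff)
  have "integrable lborel (\<lambda>x. enn2real (h x))"
  proof (rule integrableI_bounded)
    have "(\<integral>\<^sup>+ x. ennreal (norm (enn2real (h x))) \<partial>lborel) = integral\<^sup>N lborel h"
      using h(3) by (intro nn_integral_cong) (simp add: )
    then show "(\<integral>\<^sup>+ x. ennreal (norm (enn2real (h x))) \<partial>lborel) < \<infinity>"
      using h(2) by (simp add: less_top)
  qed measurable
  then have "integrable lborel (\<lambda>x. (norm (complex_of_real (k x)))\<^sup>2)"
    by (simp add: k_def)
  moreover have "(\<lambda>x. complex_of_real (k x)) \<in> borel_measurable lborel"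
    unfolding k_def by measurable
  ultimately show thesis
    using that[of k] pos by (simp add: square_integrable_def)
qed

lemma square_integrable_norm:
  assumes "square_integrable f"
  shows "square_integrable (\<lambda>x. complex_of_real (norm (f x)))"
proof -
  have [measurable]: "f \<in> borel_measurable lborel" using assms by measurable
  show ?thesis using assms by (auto simp: square_integrable_def)
qed

text \<open>Multiplying by a positive square-integrable weight turns an \<open>L\<^sup>2\<close>-Cauchy sequence into an
  \<open>L\<^sup>1\<close>-Cauchy one, which has an almost everywhere convergent subsequence; Fatou's lemma identifies
  its limit as the \<open>L\<^sup>2\<close>-limit.\<close>

lemma Cauchy_L2_convergent:
  fixes X :: "nat \<Rightarrow> L2"
  assumes "Cauchy X"
  shows "convergent X"
proof -
  obtain k :: "real \<Rightarrow> real" where k: "square_integrable (\<lambda>x. of_real (k x))" "\<And>x. k x > 0"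
    using positive_square_integrable_function by blast
  define f where "f n = rep_L2 (X n)" for n
  have f: "square_integrable (f n)" for n
    unfolding f_def by (rule square_integrable_rep_L2)
  have Xf: "X n = abs_L2 (f n)" for n
    unfolding f_def by (simp add: abs_rep_L2)
  have fm [measurable]: "f n \<in> borel_measurable borel" for n
    using f[of n] by (simp add: square_integrable_def)
  define s where "s n x = f n x * cnj (of_real (k x))" for n x
  have s_int: "integrable lborel (s n)" for n
    unfolding s_def by (intro square_integrable_prod f k)
  have s_diff: "(\<integral>x. norm (s i x - s j x) \<partial>lborel) \<le> norm (X i - X j) * norm (abs_L2 (\<lambda>x. of_real (k x)))" for i j
  proof -
    define d where "d x = complex_of_real (norm (f i x - f j x))" for x
    have d: "square_integrable d"
      unfolding d_def by (intro square_integrable_norm square_integrable_diff f)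
    have "(\<integral>x. norm (s i x - s j x) \<partial>lborel) = (\<integral>x. inner (d x) (of_real (k x)) \<partial>lborel)"
      using k(2) by (intro Bochner_Integration.integral_cong)
        (auto simp: s_def d_def inner_complex_def norm_mult left_diff_distrib[symmetric] less_imp_le)
    also have "\<dots> = inner (abs_L2 d) (abs_L2 (\<lambda>x. of_real (k x)))"
      by (rule inner_abs_L2[OF d k(1), symmetric])
    also have "\<dots> \<le> norm (abs_L2 d) * norm (abs_L2 (\<lambda>x. of_real (k x)))"
      by (rule norm_cauchy_schwarz)
    also have "norm (abs_L2 d) \<le> norm (X i - X j)"
      unfolding Xf abs_L2_diff[OF f f]
      by (intro norm_abs_L2_mono d square_integrable_diff f) (simp add: d_def)
    finally show ?thesis by (simp add: mult_right_mono)
  qed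
  have s_Cauchy: "\<exists>N. \<forall>i\<ge>N. \<forall>j\<ge>N. (\<integral>x. norm (s i x - s j x) \<partial>lborel) < e" if "e > 0" for e
  proof -
    define C where "C = norm (abs_L2 (\<lambda>x. of_real (k x))) + 1"
    have C: "C > 0" by (simp add: C_def add_nonneg_pos)
    have "e / C > 0" using C that by simp
    then obtain N where N: "\<And>i j. i \<ge> N \<Longrightarrow> j \<ge> N \<Longrightarrow> norm (X i - X j) < e / C"
      using assms unfolding Cauchy_iff by blast
    have "(\<integral>x. norm (s i x - s j x) \<partial>lborel) < e" if "i \<ge> N" "j \<ge> N" for i j
    proof -
      have "(\<integral>x. norm (s i x - s j x) \<partial>lborel) \<le> norm (X i - X j) * C"
        by (rule order_trans[OF s_diff]) (simp add: C_def mult_left_mono)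
      also have "\<dots> < e"
        using N[OF that] C by (simp add: pos_less_divide_eq)
      finally show ?thesis .
    qed
    then show ?thesis by blast
  qed
  obtain r where r: "strict_mono r" "AE x in lborel. Cauchy (\<lambda>i. s (r i) x)"
    using cauchy_L1_AE_cauchy_subseq[of lborel s, OF s_int s_Cauchy] by blast
  define g where "g x = lim (\<lambda>i. f (r i) x)" for x
  have g_meas [measurable]: "g \<in> borel_measurable borel"
    unfolding g_def by (rule borel_measurable_lim_metric) measurable
  have lim: "AE x in lborel. (\<lambda>i. f (r i) x) \<longlonglongrightarrow> g x"
    using r(2)
  proof eventually_elim
    case (elim x)
    then obtain l where "(\<lambda>i. s (r i) x) \<longlonglongrightarrow> l"
      using Cauchy_convergent convergent_def by blast
    then have "(\<lambda>i. s (r i) x / of_real (k x)) \<longlonglongrightarrow> l / of_real (k x)"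
      by (intro tendsto_divide tendsto_const) (use k(2)[of x] in auto)
    moreover have "s (r i) x / of_real (k x) = f (r i) x" for i
      using k(2)[of x] by (simp add: s_def)
    ultimately have "(\<lambda>i. f (r i) x) \<longlonglongrightarrow> l / of_real (k x)"
      by simp
    then show ?case
      unfolding g_def using limI by metis
  qed
  have fatou: "square_integrable (\<lambda>x. g x - f m x) \<and> norm (abs_L2 (\<lambda>x. g x - f m x)) \<le> e"
    if e: "e > 0" and N: "\<And>i. i \<ge> N \<Longrightarrow> norm (X i - X m) \<le> e" for e m N
  proof -
    have "(\<integral>\<^sup>+x. ennreal ((norm (g x - f m x))\<^sup>2) \<partial>lborel)
        = (\<integral>\<^sup>+x. liminf (\<lambda>i. ennreal ((norm (f (r i) x - f m x))\<^sup>2)) \<partial>lborel)"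
    proof (rule nn_integral_cong_AE)
      show "AE x in lborel. ennreal ((norm (g x - f m x))\<^sup>2) = liminf (\<lambda>i. ennreal ((norm (f (r i) x - f m x))\<^sup>2))"
        using lim
      proof eventually_elim
        case (elim x)
        then have "(\<lambda>i. ennreal ((norm (f (r i) x - f m x))\<^sup>2)) \<longlonglongrightarrow> ennreal ((norm (g x - f m x))\<^sup>2)"
          by (intro tendsto_intros)
        from lim_imp_Liminf[OF _ this] show ?case by simp
      qed
    qed
    also have "\<dots> \<le> liminf (\<lambda>i. \<integral>\<^sup>+x. ennreal ((norm (f (r i) x - f m x))\<^sup>2) \<partial>lborel)"
      by (rule nn_integral_liminf) measurable
    also have "\<dots> \<le> liminf (\<lambda>i::nat. ennreal (e\<^sup>2))"
    proof (rule Liminf_mono)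
      have "(\<integral>\<^sup>+x. ennreal ((norm (f (r i) x - f m x))\<^sup>2) \<partial>lborel) \<le> ennreal (e\<^sup>2)" if "i \<ge> N" for i
      proof -
        have sq: "square_integrable (\<lambda>x. f (r i) x - f m x)"
          by (intro square_integrable_diff f)
        have "(\<integral>\<^sup>+x. ennreal ((norm (f (r i) x - f m x))\<^sup>2) \<partial>lborel)
            = ennreal ((norm (X (r i) - X m))\<^sup>2)"
          unfolding Xf abs_L2_diff[OF f f] norm_abs_L2[OF sq]
          using sq by (intro nn_integral_eq_integral) (auto simp: square_integrable_def)
        also have "r i \<ge> N" using that seq_suble[OF r(1), of i] by simp
        then have "ennreal ((norm (X (r i) - X m))\<^sup>2) \<le> ennreal (e\<^sup>2)"
          using N by (intro ennreal_leI power_mono) auto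
        finally show ?thesis .
      qed
      then show "\<forall>\<^sub>F i in sequentially. (\<integral>\<^sup>+x. ennreal ((norm (f (r i) x - f m x))\<^sup>2) \<partial>lborel) \<le> ennreal (e\<^sup>2)"
        using eventually_sequentially by blast
    qed
    also have "\<dots> = ennreal (e\<^sup>2)" by (simp add: Liminf_const)
    finally have le: "(\<integral>\<^sup>+x. ennreal ((norm (g x - f m x))\<^sup>2) \<partial>lborel) \<le> ennreal (e\<^sup>2)" .
    have int: "integrable lborel (\<lambda>x. (norm (g x - f m x))\<^sup>2)"
      by (rule integrableI_bounded) (use le in \<open>auto intro: le_less_trans[OF le]\<close>)
    then have sq: "square_integrable (\<lambda>x. g x - f m x)"
      by (simp add: square_integrable_def)
    have "ennreal (\<integral>x. (norm (g x - f m x))\<^sup>2 \<partial>lborel) \<le> ennreal (e\<^sup>2)"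
      unfolding nn_integral_eq_integral[OF int AE_I2[OF zero_le_power2], symmetric] by (rule le)
    then have "(norm (abs_L2 (\<lambda>x. g x - f m x)))\<^sup>2 \<le> e\<^sup>2"
      unfolding norm_abs_L2[OF sq] using ennreal_le_iff[OF zero_le_power2] by blast
    then have "norm (abs_L2 (\<lambda>x. g x - f m x)) \<le> e"
      using e by (rule power2_le_imp_le[OF _ less_imp_le])
    with sq show ?thesis by blast
  qed
  have Cau: "\<exists>N. \<forall>m\<ge>N. \<forall>i\<ge>N. norm (X i - X m) \<le> e" if "e > 0" for e
    using assms that unfolding Cauchy_iff by (meson less_imp_le)
  obtain N0 where N0: "\<And>m i. m \<ge> N0 \<Longrightarrow> i \<ge> N0 \<Longrightarrow> norm (X i - X m) \<le> 1"
    using Cau[of 1] by auto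
  have "square_integrable (\<lambda>x. g x - f N0 x)"
    using fatou[of 1 N0 N0] N0 by simp
  from square_integrable_add[OF this f[of N0]] have g: "square_integrable g" by simp
  have "X \<longlonglongrightarrow> abs_L2 g"
  proof (rule metric_LIMSEQ_I)
    fix e :: real assume "e > 0"
    then have e2: "e / 2 > 0" by simp
    then obtain N where N: "\<And>m i. m \<ge> N \<Longrightarrow> i \<ge> N \<Longrightarrow> norm (X i - X m) \<le> e / 2"
      using Cau by blast
    have "dist (X m) (abs_L2 g) < e" if "m \<ge> N" for m
      using fatou[OF e2, of N m] N that \<open>e > 0\<close>
      by (simp add: dist_norm norm_minus_commute Xf abs_L2_diff[OF g f])
    then show "\<exists>no. \<forall>n\<ge>no. dist (X n) (abs_L2 g) < e" by blast
  qed
  then show ?thesis using convergent_def by blast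
qed

instance L2 :: banach
  by standard (rule Cauchy_L2_convergent)

lemma dominated_convergence_L2:
  assumes f: "\<And>n. square_integrable (f n)" and g: "square_integrable g"
    and lim: "AE x in lborel. (\<lambda>n. f n x) \<longlonglongrightarrow> g x"
    and dom: "square_integrable h" "\<And>n. AE x in lborel. norm (f n x - g x) \<le> norm (h x)"
  shows "(\<lambda>n. abs_L2 (f n)) \<longlonglongrightarrow> abs_L2 g"
proof -
  have d: "square_integrable (\<lambda>x. f n x - g x)" for n
    by (intro square_integrable_diff f g)
  have "(\<lambda>n. \<integral>x. (norm (f n x - g x))\<^sup>2 \<partial>lborel) \<longlonglongrightarrow> (LINT x|(lborel :: real measure). (0::real))"
  proof (rule integral_dominated_convergence)
    show "integrable lborel (\<lambda>x. (norm (h x))\<^sup>2)"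
      using dom(1) by (simp add: square_integrable_def)
    show "(\<lambda>x. (norm (f n x - g x))\<^sup>2) \<in> borel_measurable lborel" for n
      using d[of n] unfolding square_integrable_def by (intro borel_measurable_integrable) simp
    show "AE x in lborel. (\<lambda>n. (norm (f n x - g x))\<^sup>2) \<longlonglongrightarrow> 0"
      using lim
    proof eventually_elim
      case (elim x)
      then have "(\<lambda>n. (norm (f n x - g x))\<^sup>2) \<longlonglongrightarrow> (norm (g x - g x))\<^sup>2"
        by (intro tendsto_intros)
      then show ?case by simp
    qed
    show "AE x in lborel. norm ((norm (f n x - g x))\<^sup>2) \<le> (norm (h x))\<^sup>2" for n
      using dom(2)[of n] by eventually_elim (auto intro!: power_mono)
  qed simp
  then have "(\<lambda>n. (norm (abs_L2 (f n) - abs_L2 g))\<^sup>2) \<longlonglongrightarrow> 0"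
    unfolding abs_L2_diff[OF f g] norm_abs_L2[OF d] by simp
  then have "(\<lambda>n. sqrt ((norm (abs_L2 (f n) - abs_L2 g))\<^sup>2)) \<longlonglongrightarrow> sqrt 0"
    by (rule tendsto_real_sqrt)
  then have "(\<lambda>n. norm (abs_L2 (f n) - abs_L2 g)) \<longlonglongrightarrow> 0"
    unfolding real_sqrt_abs abs_norm_cancel real_sqrt_zero .
  then show ?thesis
    by (rule LIM_zero_cancel[OF tendsto_norm_zero_cancel])
qed

text \<open>The nearest-point projection of the complex plane onto the unit interval.\<close>

definition clamp01 :: "complex \<Rightarrow> complex" where
  "clamp01 z = of_real (min 1 (max 0 (Re z)))"

lemma complex_between_0_1: "(0 \<le> z \<and> z \<le> 1) \<longleftrightarrow> Im z = 0 \<and> 0 \<le> Re z \<and> Re z \<le> 1" for z :: complex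
  by (auto simp: less_eq_complex_def)

lemma clamp01_between: "0 \<le> clamp01 z \<and> clamp01 z \<le> 1"
  unfolding complex_between_0_1 by (simp add: clamp01_def)

lemma clamp01_dist_le:
  assumes "0 \<le> w \<and> w \<le> 1"
  shows "norm (clamp01 z - w) \<le> norm (z - w)" and "norm (z - clamp01 z) \<le> norm (z - w)"
proof -
  have w: "Im w = 0" "0 \<le> Re w" "Re w \<le> 1"
    using assms unfolding complex_between_0_1 by auto
  have "\<bar>min 1 (max 0 (Re z)) - Re w\<bar> \<le> \<bar>Re z - Re w\<bar>"
    using w by auto
  moreover have "clamp01 z - w = of_real (min 1 (max 0 (Re z)) - Re w)"
    using w by (intro complex_eqI) (simp_all add: clamp01_def)
  ultimately show "norm (clamp01 z - w) \<le> norm (z - w)"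
    using abs_Re_le_cmod[of "z - w"] by (simp only: norm_of_real) simp
  have "\<bar>Re z - min 1 (max 0 (Re z))\<bar> \<le> \<bar>Re z - Re w\<bar>"
    using w by auto
  then have "(Re z - min 1 (max 0 (Re z)))\<^sup>2 \<le> (Re z - Re w)\<^sup>2"
    using abs_le_square_iff by blast
  then show "norm (z - clamp01 z) \<le> norm (z - w)"
    using w by (simp add: clamp01_def cmod_def)
qed

lemma borel_measurable_clamp01 [measurable]: "clamp01 \<in> borel_measurable borel"
  unfolding clamp01_def by (intro borel_measurable_continuous_onI continuous_intros)

lemma between_0_1_rep: "between_0_1 u \<longleftrightarrow> (AE x in lborel. 0 \<le> rep_L2 u x \<and> rep_L2 u x \<le> 1)"
  using between_0_1.abs_eq[OF L2_eq_refl[OF square_integrable_rep_L2], of u] by (simp add: abs_rep_L2)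

lemma between_0_1_abs:
  "square_integrable f \<Longrightarrow> between_0_1 (abs_L2 f) \<longleftrightarrow> (AE x in lborel. 0 \<le> f x \<and> f x \<le> 1)"
  by (intro between_0_1.abs_eq L2_eq_refl)

text \<open>The distance of \<open>u\<close> to its pointwise truncation is at most its distance to any function with values
  in the unit interval.\<close>

lemma between_0_1_closed:
  assumes "\<And>n. between_0_1 (X n)" "X \<longlonglongrightarrow> u"
  shows "between_0_1 u"
proof -
  define f where "f = rep_L2 u"
  have f: "square_integrable f" and uf: "u = abs_L2 f"
    by (simp_all add: f_def square_integrable_rep_L2 abs_rep_L2)
  have [measurable]: "f \<in> borel_measurable borel" using f by (simp add: square_integrable_def)
  have le: "AE x in lborel. norm (f x - clamp01 (f x)) \<le> norm (f x - rep_L2 (X n) x)" for n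
    using assms(1)[of n] unfolding between_0_1_rep by eventually_elim (rule clamp01_dist_le)
  have sq: "square_integrable (\<lambda>x. f x - rep_L2 (X n) x)" for n
    by (intro square_integrable_diff f square_integrable_rep_L2)
  have sq0: "square_integrable (\<lambda>x. f x - clamp01 (f x))"
    by (rule square_integrable_bound[OF sq[of 0] _ le]) measurable
  have "norm (abs_L2 (\<lambda>x. f x - clamp01 (f x))) \<le> norm (u - X n)" for n
  proof -
    have "u - X n = abs_L2 (\<lambda>x. f x - rep_L2 (X n) x)"
      unfolding uf by (subst abs_rep_L2[of "X n", symmetric]) (rule abs_L2_diff[OF f square_integrable_rep_L2])
    then show ?thesis
      using norm_abs_L2_mono[OF sq0 sq le] by simp
  qed
  moreover have "(\<lambda>n. norm (u - X n)) \<longlonglongrightarrow> 0"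
    using tendsto_norm[OF tendsto_diff[OF tendsto_const assms(2)], of u] by simp
  ultimately have "norm (abs_L2 (\<lambda>x. f x - clamp01 (f x))) \<le> 0"
    by (intro LIMSEQ_le_const[of "\<lambda>n. norm (u - X n)"]) auto
  then have "abs_L2 (\<lambda>x. f x - clamp01 (f x)) = abs_L2 (\<lambda>x. 0)"
    by (simp add: zero_L2_def)
  from abs_L2_eqD[OF sq0 square_integrable_zero this]
  have "AE x in lborel. 0 \<le> f x \<and> f x \<le> 1"
    by eventually_elim (metis clamp01_between right_minus_eq)
  then show ?thesis
    unfolding uf between_0_1_abs[OF f] .
qed

lemma between_0_1_combine:
  assumes "between_0_1 u" "between_0_1 v" "a \<ge> 0" "b \<ge> 0" "a + b \<le> 1"
  shows "between_0_1 (a *\<^sub>R u + b *\<^sub>R v)"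
proof -
  obtain f g where f: "square_integrable f" "u = abs_L2 f" and g: "square_integrable g" "v = abs_L2 g"
    using L2_cases by metis
  have eq: "a *\<^sub>R u + b *\<^sub>R v = abs_L2 (\<lambda>x. a *\<^sub>R f x + b *\<^sub>R g x)"
    unfolding f(2) g(2)
    by (simp add: abs_L2_scaleR abs_L2_add f(1) g(1) square_integrable_scaleR)
  have sq: "square_integrable (\<lambda>x. a *\<^sub>R f x + b *\<^sub>R g x)"
    by (intro square_integrable_add square_integrable_scaleR f g)
  have "AE x in lborel. 0 \<le> f x \<and> f x \<le> 1" "AE x in lborel. 0 \<le> g x \<and> g x \<le> 1"
    using assms(1,2) between_0_1_abs f g by auto
  then have "AE x in lborel. 0 \<le> a *\<^sub>R f x + b *\<^sub>R g x \<and> a *\<^sub>R f x + b *\<^sub>R g x \<le> 1"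
  proof eventually_elim
    case (elim x)
    then have *: "Im (f x) = 0" "0 \<le> Re (f x)" "Re (f x) \<le> 1" "Im (g x) = 0" "0 \<le> Re (g x)" "Re (g x) \<le> 1"
      unfolding complex_between_0_1 by auto
    have "a * Re (f x) + b * Re (g x) \<le> a * 1 + b * 1"
      using * assms(3,4) by (intro add_mono mult_left_mono) auto
    then show ?case
      unfolding complex_between_0_1 using * assms(3-5) by simp
  qed
  then show ?thesis
    unfolding eq between_0_1_abs[OF sq] .
qed

lemma between_0_1_zero: "between_0_1 0"
  unfolding zero_L2_def between_0_1_abs[OF square_integrable_zero] complex_between_0_1 by simp

text \<open>Multiples of functions with values in the unit interval approximate non-negative functions by
  truncation from above, and every function is a complex combination of four non-negative ones.\<close>

lemma L2_closed_span_between_0_1: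
  assumes "closed D" and add: "\<And>u v. u \<in> D \<Longrightarrow> v \<in> D \<Longrightarrow> u + v \<in> D"
    and scale: "\<And>a u. u \<in> D \<Longrightarrow> scaleC_L2 a u \<in> D"
    and unit: "\<And>u. between_0_1 u \<Longrightarrow> u \<in> D"
  shows "u \<in> D"
proof -
  have nonneg: "abs_L2 (\<lambda>x. of_real (g x)) \<in> D"
    if sq: "square_integrable (\<lambda>x. of_real (g x))" and pos: "\<And>x. 0 \<le> g x" for g :: "real \<Rightarrow> real"
  proof -
    have m: "(\<lambda>x. complex_of_real (g x)) \<in> borel_measurable borel"
      using sq by (simp add: square_integrable_def)
    have "(\<lambda>x. Re (complex_of_real (g x))) \<in> borel_measurable borel"
      using m by measurable
    then have [measurable]: "g \<in> borel_measurable borel" by simp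
    have sqn: "square_integrable (\<lambda>x. of_real (min (g x) (Suc n)))" for n
      by (rule square_integrable_bound[OF sq]) (use pos in auto)
    have sqn': "square_integrable (\<lambda>x. of_real (inverse (Suc n) * min (g x) (Suc n)))" for n
      using square_integrable_scale[OF sqn, of "of_real (inverse (Suc n))" n] by simp
    have mem: "abs_L2 (\<lambda>x. of_real (min (g x) (Suc n))) \<in> D" for n
    proof -
      have "between_0_1 (abs_L2 (\<lambda>x. of_real (inverse (Suc n) * min (g x) (Suc n))))"
        unfolding between_0_1_abs[OF sqn'] complex_between_0_1
        using pos by (auto simp: field_simps min_def simp del: of_nat_Suc)
      then have "scaleC_L2 (of_real (real (Suc n))) (abs_L2 (\<lambda>x. of_real (inverse (Suc n) * min (g x) (Suc n)))) \<in> D"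
        using unit scale by blast
      moreover have "of_real (real (Suc n)) * complex_of_real (inverse (Suc n) * min (g x) (Suc n))
          = of_real (min (g x) (Suc n))" for x
        unfolding of_real_mult[symmetric] by (simp del: of_nat_Suc)
      ultimately show ?thesis
        unfolding abs_L2_scaleC[OF sqn'] by (simp only:)
    qed
    have "(\<lambda>n. abs_L2 (\<lambda>x. of_real (min (g x) (Suc n)))) \<longlonglongrightarrow> abs_L2 (\<lambda>x. of_real (g x))"
    proof (rule dominated_convergence_L2[OF sqn sq _ sq])
      have "(\<lambda>n. complex_of_real (min (g x) (Suc n))) \<longlonglongrightarrow> of_real (g x)" for x
      proof (rule tendsto_eventually)
        obtain N where N: "g x \<le> real N" using real_arch_simple by blast
        then have "complex_of_real (min (g x) (Suc n)) = of_real (g x)" if "n \<ge> N" for n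
          using that by (simp add: min_def)
        then show "\<forall>\<^sub>F n in sequentially. complex_of_real (min (g x) (Suc n)) = of_real (g x)"
          using eventually_sequentially by blast
      qed
      then show "AE x in lborel. (\<lambda>n. complex_of_real (min (g x) (Suc n))) \<longlonglongrightarrow> of_real (g x)"
        by simp
      have "norm (complex_of_real (min (g x) (Suc n)) - of_real (g x)) \<le> norm (complex_of_real (g x))" for n x
        unfolding of_real_diff[symmetric] norm_of_real using pos[of x] by (auto simp: min_def)
      then show "AE x in lborel. norm (complex_of_real (min (g x) (Suc n)) - of_real (g x)) \<le> norm (complex_of_real (g x))" for n
        by simp
    qed
    then show ?thesis
      by (rule closed_sequentially[OF assms(1) mem])
  qed
  define f where "f = rep_L2 u"
  have f: "square_integrable f" and uf: "u = abs_L2 f"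
    by (simp_all add: f_def square_integrable_rep_L2 abs_rep_L2)
  have [measurable]: "f \<in> borel_measurable borel" using f by (simp add: square_integrable_def)
  have sq: "square_integrable (\<lambda>x. complex_of_real (max 0 (s * Re (f x))))"
    "square_integrable (\<lambda>x. complex_of_real (max 0 (s * Im (f x))))" if "s = 1 \<or> s = -1" for s
  proof -
    show "square_integrable (\<lambda>x. complex_of_real (max 0 (s * Re (f x))))"
    proof (rule square_integrable_bound[OF f])
      have "norm (complex_of_real (max 0 (s * Re (f x)))) \<le> norm (f x)" for x
        using that abs_Re_le_cmod[of "f x"] by (auto simp: max_def)
      then show "AE x in lborel. norm (complex_of_real (max 0 (s * Re (f x)))) \<le> norm (f x)"
        by (intro AE_I2)
    qed measurable
    show "square_integrable (\<lambda>x. complex_of_real (max 0 (s * Im (f x))))"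
    proof (rule square_integrable_bound[OF f])
      have "norm (complex_of_real (max 0 (s * Im (f x)))) \<le> norm (f x)" for x
        using that abs_Im_le_cmod[of "f x"] by (auto simp: max_def)
      then show "AE x in lborel. norm (complex_of_real (max 0 (s * Im (f x)))) \<le> norm (f x)"
        by (intro AE_I2)
    qed measurable
  qed
  define part where "part a g = scaleC_L2 a (abs_L2 (\<lambda>x. complex_of_real (max 0 (g x))))" for a and g :: "real \<Rightarrow> real"
  have part_mem: "part a (\<lambda>x. s * Re (f x)) \<in> D" "part a (\<lambda>x. s * Im (f x)) \<in> D"
    if "s = 1 \<or> s = -1" for a s
    unfolding part_def using sq[OF that] by (auto intro!: scale nonneg)
  have sq_part: "square_integrable (\<lambda>x. a * complex_of_real (max 0 (s * Re (f x))))"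
    "square_integrable (\<lambda>x. a * complex_of_real (max 0 (s * Im (f x))))"
    if "s = 1 \<or> s = -1" for a s
    using sq[OF that] by (auto intro!: square_integrable_scale)
  have part_abs: "part a (\<lambda>x. s * Re (f x)) = abs_L2 (\<lambda>x. a * complex_of_real (max 0 (s * Re (f x))))"
    "part a (\<lambda>x. s * Im (f x)) = abs_L2 (\<lambda>x. a * complex_of_real (max 0 (s * Im (f x))))"
    if "s = 1 \<or> s = -1" for a s
    unfolding part_def using sq[OF that] by (auto simp: abs_L2_scaleC)
  have re: "part 1 (\<lambda>x. 1 * Re (f x)) + part (-1) (\<lambda>x. (-1) * Re (f x)) = abs_L2 (\<lambda>x. of_real (Re (f x)))"
    unfolding part_abs(1)[OF disjI1[OF refl]] part_abs(1)[OF disjI2[OF refl]]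
      abs_L2_add[OF sq_part(1)[OF disjI1[OF refl]] sq_part(1)[OF disjI2[OF refl]]]
    by (intro arg_cong[where f = abs_L2] ext) (simp add: max_def)
  have im: "part \<i> (\<lambda>x. 1 * Im (f x)) + part (- \<i>) (\<lambda>x. (-1) * Im (f x)) = abs_L2 (\<lambda>x. \<i> * of_real (Im (f x)))"
    unfolding part_abs(2)[OF disjI1[OF refl]] part_abs(2)[OF disjI2[OF refl]]
      abs_L2_add[OF sq_part(2)[OF disjI1[OF refl]] sq_part(2)[OF disjI2[OF refl]]]
    by (intro arg_cong[where f = abs_L2] ext) (simp add: max_def)
  have sq_re: "square_integrable (\<lambda>x. complex_of_real (Re (f x)))"
    and sq_im: "square_integrable (\<lambda>x. \<i> * complex_of_real (Im (f x)))"
    by (rule square_integrable_bound[OF f]; auto simp: abs_Re_le_cmod abs_Im_le_cmod norm_mult)+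
  have "u = (part 1 (\<lambda>x. 1 * Re (f x)) + part (-1) (\<lambda>x. (-1) * Re (f x)))
      + (part \<i> (\<lambda>x. 1 * Im (f x)) + part (- \<i>) (\<lambda>x. (-1) * Im (f x)))"
    unfolding re im uf abs_L2_add[OF sq_re sq_im]
    by (intro arg_cong[where f = abs_L2] ext) (simp add: complex_eq)
  also have "\<dots> \<in> D"
    by (intro add part_mem) simp_all
  finally show ?thesis .
qed

section \<open>Smooth functions and test functions\<close>

text \<open>Differentiability of order \<open>n\<close> is defined by recursion on \<open>n\<close> so that closure under sums, products
  and compositions follows by induction, with no explicit formulas for higher derivatives.\<close>

primrec k_diff :: "nat \<Rightarrow> (real \<Rightarrow> 'a::real_normed_vector) \<Rightarrow> bool" where
  "k_diff 0 f \<longleftrightarrow> True"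
| "k_diff (Suc n) f \<longleftrightarrow> (\<exists>f'. (\<forall>x. (f has_vector_derivative f' x) (at x)) \<and> k_diff n f')"

lemma k_diff_SucD: "k_diff (Suc n) f \<Longrightarrow> k_diff n f"
proof (induction n arbitrary: f)
  case (Suc n)
  then obtain f' where "\<forall>x. (f has_vector_derivative f' x) (at x)" "k_diff (Suc n) f'"
    by auto
  then show ?case using Suc.IH by auto
qed simp

lemma k_diff_derivative:
  assumes "k_diff (Suc n) f" "\<And>x. (f has_vector_derivative f' x) (at x)"
  shows "k_diff n f'"
proof -
  obtain g where g: "\<And>x. (f has_vector_derivative g x) (at x)" "k_diff n g"
    using assms(1) by auto
  have "g = f'"
    using vector_derivative_unique_at[OF g(1) assms(2)] by blast
  then show ?thesis using g(2) by simp
qed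

definition smooth :: "(real \<Rightarrow> 'a::real_normed_vector) \<Rightarrow> bool" where
  "smooth f \<longleftrightarrow> (\<forall>n. k_diff n f)"

lemma smooth_derivative:
  assumes "smooth f"
  obtains f' where "smooth f'" "\<And>x. (f has_vector_derivative f' x) (at x)"
proof -
  have "k_diff (Suc 0) f" using assms by (simp add: smooth_def)
  then obtain f' where f': "\<And>x. (f has_vector_derivative f' x) (at x)" by auto
  then have "smooth f'"
    using assms k_diff_derivative unfolding smooth_def by blast
  then show thesis using that f' by blast
qed

lemma smooth_has_derivative:
  "smooth f \<Longrightarrow> (f has_vector_derivative vector_derivative f (at x)) (at x)"
  by (metis smooth_derivative vector_derivative_at)

lemma smooth_vector_derivative:
  assumes "smooth f"
  shows "smooth (\<lambda>x. vector_derivative f (at x))"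
  unfolding smooth_def
proof
  fix n
  have "k_diff (Suc n) f" using assms unfolding smooth_def by blast
  then show "k_diff n (\<lambda>x. vector_derivative f (at x))"
    by (rule k_diff_derivative) (rule smooth_has_derivative[OF assms])
qed

lemma smoothI_derivative:
  assumes "smooth f'" "\<And>x. (f has_vector_derivative f' x) (at x)"
  shows "smooth f"
  unfolding smooth_def
proof
  fix n show "k_diff n f"
    using assms by (cases n) (auto simp: smooth_def)
qed

lemma smooth_continuous: "smooth f \<Longrightarrow> continuous_on A f"
  by (meson continuous_at_imp_continuous_on has_vector_derivative_continuous smooth_has_derivative)

lemma k_diff_add: "k_diff n f \<Longrightarrow> k_diff n g \<Longrightarrow> k_diff n (\<lambda>x. f x + g x)"
proof (induction n arbitrary: f g)
  case (Suc n)
  then obtain f' g' where *: "\<forall>x. (f has_vector_derivative f' x) (at x)" "k_diff n f'"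
    "\<forall>x. (g has_vector_derivative g' x) (at x)" "k_diff n g'" by auto
  then show ?case
    using Suc.IH by (auto intro!: exI[of _ "\<lambda>x. f' x + g' x"] has_vector_derivative_add)
qed simp

lemma smooth_add: "smooth f \<Longrightarrow> smooth g \<Longrightarrow> smooth (\<lambda>x. f x + g x)"
  by (simp add: smooth_def k_diff_add)

lemma k_diff_const: "k_diff n (\<lambda>x. c)"
proof (induction n arbitrary: c)
  case (Suc n)
  then show ?case
    unfolding k_diff.simps by (intro exI[of _ "\<lambda>x. 0"]) auto
qed simp

lemma smooth_const: "smooth (\<lambda>x. c)"
  by (simp add: smooth_def k_diff_const)

lemma smooth_ident: "smooth (\<lambda>x. x)"
  by (rule smoothI_derivative[OF smooth_const[of 1]]) auto

lemma k_diff_linear: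
  assumes "bounded_linear L"
  shows "k_diff n f \<Longrightarrow> k_diff n (\<lambda>x. L (f x))"
proof (induction n arbitrary: f)
  case (Suc n)
  then obtain f' where *: "\<forall>x. (f has_vector_derivative f' x) (at x)" "k_diff n f'" by auto
  then have "\<forall>x. ((\<lambda>x. L (f x)) has_vector_derivative L (f' x)) (at x)"
    using bounded_linear.has_vector_derivative[OF assms] by blast
  then show ?case using Suc.IH * by auto
qed simp

lemma smooth_linear: "bounded_linear L \<Longrightarrow> smooth f \<Longrightarrow> smooth (\<lambda>x. L (f x))"
  by (simp add: smooth_def k_diff_linear)

lemma k_diff_scaleR:
  fixes f :: "real \<Rightarrow> real"
  shows "k_diff n f \<Longrightarrow> k_diff n g \<Longrightarrow> k_diff n (\<lambda>x. f x *\<^sub>R g x)"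
proof (induction n arbitrary: f g)
  case (Suc n)
  then obtain f' g' where *: "\<forall>x. (f has_vector_derivative f' x) (at x)" "k_diff n f'"
    "\<forall>x. (g has_vector_derivative g' x) (at x)" "k_diff n g'" by auto
  have "((\<lambda>x. f x *\<^sub>R g x) has_vector_derivative (f x *\<^sub>R g' x + f' x *\<^sub>R g x)) (at x)" for x
    using * by (intro has_vector_derivative_scaleR) (auto simp: has_real_derivative_iff_has_vector_derivative)
  moreover have "k_diff n (\<lambda>x. f x *\<^sub>R g' x + f' x *\<^sub>R g x)"
    using Suc.IH * k_diff_SucD[OF Suc.prems(1)] k_diff_SucD[OF Suc.prems(2)] k_diff_add by blast
  ultimately show ?case
    unfolding k_diff.simps by (intro exI[of _ "\<lambda>x. f x *\<^sub>R g' x + f' x *\<^sub>R g x"]) blast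
qed simp

lemma smooth_scaleR:
  fixes f :: "real \<Rightarrow> real"
  shows "smooth f \<Longrightarrow> smooth g \<Longrightarrow> smooth (\<lambda>x. f x *\<^sub>R g x)"
  by (simp add: smooth_def k_diff_scaleR)

lemma smooth_mult:
  fixes f g :: "real \<Rightarrow> real"
  shows "smooth f \<Longrightarrow> smooth g \<Longrightarrow> smooth (\<lambda>x. f x * g x)"
  using smooth_scaleR[of f g] by simp

lemma k_diff_compose:
  fixes g :: "real \<Rightarrow> real"
  shows "k_diff n f \<Longrightarrow> k_diff n g \<Longrightarrow> k_diff n (\<lambda>x. f (g x))"
proof (induction n arbitrary: f)
  case (Suc n)
  then obtain f' g' where *: "\<forall>x. (f has_vector_derivative f' x) (at x)" "k_diff n f'"
    "\<forall>x. (g has_vector_derivative g' x) (at x)" "k_diff n g'" by auto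
  have "((\<lambda>x. f (g x)) has_vector_derivative (g' x *\<^sub>R f' (g x))) (at x)" for x
    using vector_diff_chain_at[of g "g' x" x f "f' (g x)"] * by (auto simp: comp_def)
  moreover have "k_diff n (\<lambda>x. g' x *\<^sub>R f' (g x))"
    using Suc.IH * k_diff_SucD[OF Suc.prems(2)] by (intro k_diff_scaleR) auto
  ultimately show ?case
    unfolding k_diff.simps by (intro exI[of _ "\<lambda>x. g' x *\<^sub>R f' (g x)"]) blast
qed simp

lemma smooth_compose:
  fixes g :: "real \<Rightarrow> real"
  shows "smooth f \<Longrightarrow> smooth g \<Longrightarrow> smooth (\<lambda>x. f (g x))"
  by (simp add: smooth_def k_diff_compose)

lemma test_function_iff: "test_function f \<longleftrightarrow> smooth f \<and> bounded {x. f x \<noteq> 0}"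
proof -
  have "smooth f" if "D 0 = f" "\<forall>n x. (D n has_vector_derivative D (Suc n) x) (at x)" for D :: "nat \<Rightarrow> real \<Rightarrow> 'a"
  proof -
    have "k_diff n (D m)" for n m
      by (induction n arbitrary: m) (use that(2) in auto)
    then show ?thesis using that(1) by (auto simp: smooth_def)
  qed
  moreover have "\<exists>D. D 0 = f \<and> (\<forall>n x. (D n has_vector_derivative D (Suc n) x) (at x))" if "smooth f"
  proof -
    define D where "D n = ((\<lambda>f x. vector_derivative f (at x)) ^^ n) f" for n
    have "smooth (D n)" for n
      by (induction n) (auto simp: D_def that smooth_vector_derivative)
    then show ?thesis
      using smooth_has_derivative by (intro exI[of _ D]) (auto simp: D_def)
  qed
  ultimately show ?thesis
    unfolding test_function_def compact_closure by blast
qed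

lemma test_function_smooth: "test_function f \<Longrightarrow> smooth f"
  by (simp add: test_function_iff)

lemma test_function_support:
  assumes "test_function f"
  obtains R where "R > 0" "\<And>x. \<bar>x\<bar> \<ge> R \<Longrightarrow> f x = 0"
proof -
  have "bounded {x. f x \<noteq> 0}"
    using assms by (simp add: test_function_iff)
  then obtain B where B: "B > 0" "\<forall>x\<in>{x. f x \<noteq> 0}. norm x \<le> B"
    using bounded_pos by blast
  then have "f x = 0" if "\<bar>x\<bar> \<ge> B + 1" for x using that by fastforce
  then show thesis using that[of "B + 1"] B(1) by simp
qed

lemma bounded_real_setI: "(\<And>x. x \<in> A \<Longrightarrow> \<bar>x\<bar> \<le> R) \<Longrightarrow> bounded A" for A :: "real set"
  by (rule boundedI[of _ R]) simp

lemma test_functionI: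
  assumes "smooth f" "\<And>x. \<bar>x\<bar> \<ge> R \<Longrightarrow> f x = 0"
  shows "test_function f"
  unfolding test_function_iff
proof
  show "bounded {x. f x \<noteq> 0}"
    by (rule bounded_real_setI[of _ R]) (use assms(2) linear in blast)
qed fact

lemma test_function_derivative:
  assumes "test_function f"
  shows "test_function (\<lambda>x. vector_derivative f (at x))"
proof -
  obtain R where R: "R > 0" "\<And>x. \<bar>x\<bar> \<ge> R \<Longrightarrow> f x = 0"
    using test_function_support[OF assms] by blast
  have "vector_derivative f (at x) = 0" if "\<bar>x\<bar> \<ge> R + 1" for x
  proof (rule vector_derivative_at)
    show "(f has_vector_derivative 0) (at x)"
    proof (rule has_vector_derivative_transform_within_open[of "\<lambda>_. 0" _ _ "ball x 1"])
      fix y assume "y \<in> ball x 1"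
      then have "\<bar>y\<bar> \<ge> R" using that by (auto simp: dist_real_def)
      then show "0 = f y" using R(2) by simp
    qed auto
  qed
  then show ?thesis
    using smooth_vector_derivative assms test_functionI by (metis test_function_iff)
qed

lemma test_function_linear:
  assumes "bounded_linear L" "test_function f"
  shows "test_function (\<lambda>x. L (f x))"
proof -
  have "L 0 = 0" using assms(1) by (simp add: linear_0 bounded_linear.linear)
  then have "bounded {x. L (f x) \<noteq> 0}"
    using assms(2) unfolding test_function_iff by (auto elim!: bounded_subset)
  then show ?thesis
    using assms by (simp add: test_function_iff smooth_linear)
qed

lemma test_function_add:
  assumes "test_function f" "test_function g"
  shows "test_function (\<lambda>x. f x + g x)"
proof -
  have "bounded ({x. f x \<noteq> 0} \<union> {x. g x \<noteq> 0})"
    using assms by (simp add: test_function_iff)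
  then have "bounded {x. f x + g x \<noteq> 0}"
    by (rule bounded_subset) auto
  then show ?thesis
    using assms by (simp add: test_function_iff smooth_add)
qed

lemma test_function_scaleR:
  fixes f :: "real \<Rightarrow> real"
  assumes "smooth f" "test_function g"
  shows "test_function (\<lambda>x. f x *\<^sub>R g x)"
proof -
  have "bounded {x. f x *\<^sub>R g x \<noteq> 0}"
    using assms(2) unfolding test_function_iff by (auto elim!: bounded_subset)
  then show ?thesis
    using assms by (simp add: test_function_iff smooth_scaleR)
qed

lemma test_function_bounded:
  assumes "test_function f"
  obtains B where "B > 0" "\<And>x. norm (f x) \<le> B"
proof -
  obtain R where R: "R > 0" "\<And>x. \<bar>x\<bar> \<ge> R \<Longrightarrow> f x = 0"
    using test_function_support[OF assms] by blast
  have "compact (f ` {-R..R})"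
    using assms by (intro compact_continuous_image smooth_continuous) (auto simp: test_function_iff)
  then obtain B where B: "B > 0" "\<forall>y\<in>f ` {-R..R}. norm y \<le> B"
    using compact_imp_bounded bounded_pos by metis
  have "norm (f x) \<le> B" for x
  proof (cases "\<bar>x\<bar> \<ge> R")
    case False
    then have "x \<in> {-R..R}" by auto
    then show ?thesis using B by blast
  qed (use R B in auto)
  then show thesis using that B by blast
qed

lemma test_function_measurable:
  fixes f :: "real \<Rightarrow> 'a::real_normed_vector"
  shows "test_function f \<Longrightarrow> f \<in> borel_measurable borel"
  by (intro borel_measurable_continuous_onI smooth_continuous test_function_smooth)

text \<open>The functions \<open>P (1 / x) exp (- 1 / x)\<close>, extended by \<open>0\<close> to the left. With all polynomials \<open>P\<close> admitted,
  the family is closed under differentiation, hence consists of smooth functions.\<close>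

definition exp_tail :: "real poly \<Rightarrow> real \<Rightarrow> real" where
  "exp_tail P x = (if x > 0 then poly P (inverse x) * exp (- inverse x) else 0)"

lemma poly_exp_tendsto_0: "((\<lambda>y. poly P y * exp (- y)) \<longlongrightarrow> 0) at_top" for P :: "real poly"
proof -
  have "((\<lambda>y. \<Sum>i\<le>degree P. coeff P i * (y ^ i / exp y)) \<longlongrightarrow> (\<Sum>i\<le>degree P. coeff P i * 0)) at_top"
    by (intro tendsto_sum tendsto_mult tendsto_const tendsto_power_div_exp_0)
  then show ?thesis
    by (simp add: poly_altdef sum_distrib_right exp_minus divide_inverse mult.assoc)
qed

lemma exp_tail_derivative:
  "(exp_tail P has_vector_derivative exp_tail ([:0, 0, 1:] * (P - pderiv P)) x) (at x)"
proof -
  consider "x > 0" | "x < 0" | "x = 0" by linarith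
  then have "(exp_tail P has_real_derivative exp_tail ([:0, 0, 1:] * (P - pderiv P)) x) (at x)"
  proof cases
    case 1
    have "((\<lambda>x. poly P (inverse x) * exp (- inverse x)) has_real_derivative
        exp_tail ([:0, 0, 1:] * (P - pderiv P)) x) (at x)"
      using 1 by (auto intro!: derivative_eq_intros DERIV_chain2[OF poly_DERIV]
          simp: exp_tail_def power2_eq_square algebra_simps)
    then show ?thesis
      by (rule has_field_derivative_transform_within_open[of _ _ _ "{0<..}"]) (use 1 in \<open>auto simp: exp_tail_def\<close>)
  next
    case 2
    have "((\<lambda>x. 0) has_real_derivative exp_tail ([:0, 0, 1:] * (P - pderiv P)) x) (at x)"
      using 2 by (simp add: exp_tail_def)
    then show ?thesis
      by (rule has_field_derivative_transform_within_open[of _ _ _ "{..<0}"]) (use 2 in \<open>auto simp: exp_tail_def\<close>)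
  next
    case 3
    have "((\<lambda>y. poly ([:0, 1:] * P) y * exp (- y)) \<longlongrightarrow> 0) at_top"
      by (rule poly_exp_tendsto_0)
    then have "((\<lambda>h. poly ([:0, 1:] * P) (inverse h) * exp (- inverse h)) \<longlongrightarrow> 0) (at_right 0)"
      by (rule filterlim_compose) (rule filterlim_inverse_at_top_right)
    then have "((\<lambda>h. (exp_tail P (0 + h) - exp_tail P 0) / h) \<longlongrightarrow> 0) (at_right 0)"
      by (rule Lim_transform_eventually)
         (auto simp: exp_tail_def eventually_at_right_less divide_inverse mult.commute mult.left_commute
           intro: eventually_mono[OF eventually_at_right_less[of 0]])
    moreover have "((\<lambda>h. (exp_tail P (0 + h) - exp_tail P 0) / h) \<longlongrightarrow> 0) (at_left 0)"
    proof (rule tendsto_eventually)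
      show "\<forall>\<^sub>F h in at_left 0. (exp_tail P (0 + h) - exp_tail P 0) / h = 0"
        by (auto simp: exp_tail_def eventually_at_left_field intro: exI[of _ "-1"])
    qed
    ultimately have "((\<lambda>h. (exp_tail P (0 + h) - exp_tail P 0) / h) \<longlongrightarrow> 0) (at 0)"
      by (simp add: filterlim_split_at)
    then show ?thesis
      using 3 by (simp add: DERIV_def exp_tail_def)
  qed
  then show ?thesis
    by (simp add: has_real_derivative_iff_has_vector_derivative)
qed

lemma smooth_exp_tail: "smooth (exp_tail P)"
proof -
  have "k_diff n (exp_tail P)" for n
    by (induction n arbitrary: P) (use exp_tail_derivative in auto)
  then show ?thesis by (simp add: smooth_def)
qed

text \<open>A product of two one-sided cut-offs, which increases to the indicator of the open interval as the
  steepness \<open>k\<close> tends to infinity.\<close>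

definition bump :: "real \<Rightarrow> real \<Rightarrow> real \<Rightarrow> real \<Rightarrow> real" where
  "bump k a b x = exp_tail 1 (k * (x - a)) * exp_tail 1 (k * (b - x))"

lemma exp_tail_1_bounds: "0 \<le> exp_tail 1 x" "exp_tail 1 x \<le> 1"
  by (auto simp: exp_tail_def)

lemma bump_bounds: "0 \<le> bump k a b x" "bump k a b x \<le> 1"
  unfolding bump_def using exp_tail_1_bounds by (auto intro: mult_le_one)

lemma bump_outside: "k > 0 \<Longrightarrow> x \<notin> {a<..<b} \<Longrightarrow> bump k a b x = 0"
  unfolding bump_def exp_tail_def by (auto simp: zero_less_mult_iff)

lemma smooth_bump: "smooth (bump k a b)"
proof -
  have "smooth (\<lambda>x. k * (x - a))" "smooth (\<lambda>x. k * (b - x))"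
    using smooth_add[OF smooth_mult[OF smooth_const[of k] smooth_ident] smooth_const[of "- k * a"]]
      smooth_add[OF smooth_mult[OF smooth_const[of "- k"] smooth_ident] smooth_const[of "k * b"]]
    by (simp_all add: algebra_simps)
  then show ?thesis
    unfolding bump_def[abs_def]
    using smooth_mult[OF smooth_compose[OF smooth_exp_tail] smooth_compose[OF smooth_exp_tail]] by blast
qed

lemma test_function_bump:
  assumes "k > 0"
  shows "test_function (bump k a b)"
proof (rule test_functionI[OF smooth_bump])
  fix x :: real assume "max \<bar>a\<bar> \<bar>b\<bar> \<le> \<bar>x\<bar>"
  then have "x \<notin> {a<..<b}" by auto
  then show "bump k a b x = 0" by (rule bump_outside[OF assms])
qed

lemma bump_tendsto_indicator: "(\<lambda>n. bump (real (Suc n)) a b x) \<longlonglongrightarrow> indicator {a<..<b} x"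
proof (cases "x \<in> {a<..<b}")
  case True
  have lim: "(\<lambda>n. exp_tail 1 (real (Suc n) * y)) \<longlonglongrightarrow> 1" if "y > 0" for y
  proof -
    have "(\<lambda>n. exp (- (inverse (real (Suc n)) * inverse y))) \<longlonglongrightarrow> exp (- (0 * inverse y))"
      by (intro tendsto_intros LIMSEQ_inverse_real_of_nat)
    then have "(\<lambda>n. exp (- (inverse (real (Suc n)) * inverse y))) \<longlonglongrightarrow> 1" by simp
    moreover have "exp_tail 1 (real (Suc n) * y) = exp (- (inverse (real (Suc n)) * inverse y))" for n
      using that by (simp add: exp_tail_def del: of_nat_Suc)
    ultimately show ?thesis by simp
  qed
  have "(\<lambda>n. bump (real (Suc n)) a b x) \<longlonglongrightarrow> 1 * 1"
    unfolding bump_def using True by (intro tendsto_mult lim) auto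
  then show ?thesis using True by simp
next
  case False
  then show ?thesis by (simp add: bump_outside)
qed

lemma locally_integrable_interval:
  "locally_integrable f \<Longrightarrow> set_integrable lborel {a..b} f" for a b :: real
  unfolding locally_integrable_def using compact_Icc by blast

lemma locally_integrableI:
  fixes f :: "real \<Rightarrow> 'a::{banach,second_countable_topology}"
  assumes "\<And>R. R > 0 \<Longrightarrow> set_integrable lborel {-R..R} f"
  shows "locally_integrable f"
  unfolding locally_integrable_def
proof (intro allI impI)
  fix A :: "real set" assume A: "compact A"
  then obtain R where R: "R > 0" "\<forall>x\<in>A. norm x \<le> R"
    using compact_imp_bounded bounded_pos by metis
  then have "A \<subseteq> {-R..R}" by (auto simp: abs_le_iff)
  then show "set_integrable lborel A f"
    using set_integrable_subset[OF assms[OF R(1)]] A by (simp add: borel_compact)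
qed

lemma locally_integrable_measurable:
  fixes f :: "real \<Rightarrow> 'a::{banach,second_countable_topology}"
  assumes "locally_integrable f"
  shows "f \<in> borel_measurable borel"
proof (rule borel_measurable_LIMSEQ_metric)
  show "(\<lambda>x. indicator {- real n..real n} x *\<^sub>R f x) \<in> borel_measurable borel" for n :: nat
  proof -
    have "integrable lborel (\<lambda>x. indicator {- real n..real n} x *\<^sub>R f x)"
      using locally_integrable_interval[OF assms, of "- real n" "real n"]
      unfolding set_integrable_def .
    from borel_measurable_integrable[OF this] show ?thesis by simp
  qed
  fix x :: real
  obtain N where N: "\<bar>x\<bar> \<le> real N" using real_arch_simple by blast
  have "indicator {- real n..real n} x *\<^sub>R f x = f x" if "n \<ge> N" for n
    using that N by (auto simp: indicator_def)
  then have "\<forall>\<^sub>F n in sequentially. indicator {- real n..real n} x *\<^sub>R f x = f x"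
    using eventually_sequentially by blast
  then show "(\<lambda>n. indicator {- real n..real n} x *\<^sub>R f x) \<longlonglongrightarrow> f x"
    by (rule tendsto_eventually)
qed

lemma integrable_test_times_locally_integrable:
  fixes \<psi> :: "real \<Rightarrow> real" and f :: "real \<Rightarrow> 'a::{banach,second_countable_topology}"
  assumes "test_function \<psi>" "locally_integrable f"
  shows "integrable lborel (\<lambda>x. \<psi> x *\<^sub>R f x)"
proof -
  obtain R where R: "R > 0" "\<And>x. \<bar>x\<bar> \<ge> R \<Longrightarrow> \<psi> x = 0"
    using test_function_support[OF assms(1)] by blast
  obtain B where B: "B > 0" "\<And>x. norm (\<psi> x) \<le> B"
    using test_function_bounded[OF assms(1)] by blast
  have [measurable]: "\<psi> \<in> borel_measurable borel" "f \<in> borel_measurable borel"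
    using assms test_function_measurable locally_integrable_measurable by blast+
  show ?thesis
  proof (rule Bochner_Integration.integrable_bound)
    show "integrable lborel (\<lambda>x. B *\<^sub>R (indicator {-R..R} x *\<^sub>R f x))"
      using locally_integrable_interval[OF assms(2), of "-R" R]
      by (intro integrable_scaleR_right) (auto simp: set_integrable_def)
    have "norm (\<psi> x *\<^sub>R f x) \<le> norm (B *\<^sub>R (indicator {-R..R} x *\<^sub>R f x))" for x
    proof (cases "\<bar>x\<bar> \<ge> R")
      case False
      then have "x \<in> {-R..R}" by auto
      then show ?thesis using B by (simp add: mult_right_mono)
    qed (simp add: R)
    then show "AE x in lborel. norm (\<psi> x *\<^sub>R f x) \<le> norm (B *\<^sub>R (indicator {-R..R} x *\<^sub>R f x))"
      by (intro AE_I2)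
    show "(\<lambda>x. \<psi> x *\<^sub>R f x) \<in> borel_measurable lborel"
      by measurable
  qed
qed

section \<open>Primitives and weak derivatives on the line\<close>

text \<open>Primitives are described by their increments, so that no base point has to be chosen.\<close>

definition primitive :: "(real \<Rightarrow> real) \<Rightarrow> (real \<Rightarrow> real) \<Rightarrow> bool" where
  "primitive F f \<longleftrightarrow> locally_integrable f \<and>
     (\<forall>a b. a \<le> b \<longrightarrow> F b - F a = (LINT x:{a..b}|lborel. f x))"

lemma locally_integrable_add:
  fixes f g :: "real \<Rightarrow> real"
  shows "locally_integrable f \<Longrightarrow> locally_integrable g \<Longrightarrow> locally_integrable (\<lambda>x. f x + g x)"
  by (auto simp: locally_integrable_def)

lemma locally_integrable_cmult:
  fixes f :: "real \<Rightarrow> real"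
  shows "locally_integrable f \<Longrightarrow> locally_integrable (\<lambda>x. r * f x)"
  by (auto simp: locally_integrable_def)

lemma locally_integrable_continuous:
  fixes f :: "real \<Rightarrow> real"
  assumes "continuous_on UNIV f"
  shows "locally_integrable f"
  unfolding locally_integrable_def
  using borel_integrable_compact[OF _ continuous_on_subset[OF assms subset_UNIV]]
  by (auto simp: set_integrable_def indicator_def if_distrib mult.commute cong: if_cong)

lemma primitive_exists:
  assumes "locally_integrable f"
  obtains F where "primitive F f"
proof -
  define F where "F x = (LBINT y=(0::real)..(x::real). f y)" for x
  have "F b - F a = (LINT x:{a..b}|lborel. f x)" if "a \<le> b" for a b :: real
  proof -
    have "interval_lebesgue_integrable lborel (ereal p) (ereal q) f" for p q :: real
    proof -
      have sub: "{min p q<..<max p q} \<subseteq> {min p q..max p q}" by auto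
      show ?thesis
        using set_integrable_subset[OF locally_integrable_interval[OF assms] _ sub]
        by (cases "p \<le> q") (auto simp: interval_lebesgue_integrable_def)
    qed
    then have "(LBINT y=(0::real)..a. f y) + (LBINT y=a..b. f y) = (LBINT y=(0::real)..b. f y)"
      by (intro interval_integral_sum) (simp add: ereal_min[symmetric] ereal_max[symmetric] del: ereal_min ereal_max zero_ereal_def[symmetric])
    then show ?thesis
      using interval_integral_Icc[OF that, of f] by (simp add: F_def)
  qed
  then show thesis
    using that assms by (auto simp: primitive_def)
qed

lemma primitive_add:
  "primitive F f \<Longrightarrow> primitive G g \<Longrightarrow> primitive (\<lambda>x. F x + G x) (\<lambda>x. f x + g x)"
  unfolding primitive_def
  by (auto simp: locally_integrable_add locally_integrable_interval algebra_simps)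

lemma primitive_cmult: "primitive F f \<Longrightarrow> primitive (\<lambda>x. r * F x) (\<lambda>x. r * f x)"
  unfolding primitive_def by (auto simp: locally_integrable_cmult right_diff_distrib[symmetric])

lemma primitive_const: "primitive (\<lambda>x. c) (\<lambda>x. 0)"
  by (simp add: primitive_def locally_integrable_continuous set_lebesgue_integral_def)

lemma primitive_C1:
  assumes "\<And>x. (F has_real_derivative f x) (at x)" "continuous_on UNIV f"
  shows "primitive F f"
  unfolding primitive_def
proof (intro conjI allI impI)
  show loc: "locally_integrable f"
    by (rule locally_integrable_continuous) fact
  fix a b :: real assume "a \<le> b"
  then have "(f has_integral F b - F a) {a..b}"
    by (intro fundamental_theorem_of_calculus)
       (use assms(1) in \<open>auto simp: has_real_derivative_iff_has_vector_derivative[symmetric] intro: DERIV_subset\<close>)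
  then show "F b - F a = (LINT x:{a..b}|lborel. f x)"
    using set_borel_integral_eq_integral(2)[OF locally_integrable_interval[OF loc]] integral_unique by metis
qed

lemma primitive_bound:
  assumes F: "primitive F f" and ab: "a \<le> b"
    and bound: "AE x in lborel. x \<in> {a..b} \<longrightarrow> \<bar>f x\<bar> \<le> L"
  shows "\<bar>F b - F a\<bar> \<le> L * (b - a)"
proof -
  have int: "set_integrable lborel {a..b} f"
    using F locally_integrable_interval by (auto simp: primitive_def)
  have "\<bar>LINT x:{a..b}|lborel. f x\<bar> \<le> (\<integral>x. norm (indicator {a..b} x *\<^sub>R f x) \<partial>lborel)"
    unfolding set_lebesgue_integral_def real_norm_def[symmetric] by (rule integral_norm_bound)
  also have "\<dots> \<le> (\<integral>x. indicator {a..b} x *\<^sub>R L \<partial>lborel)"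
  proof (rule integral_mono_AE)
    show "integrable lborel (\<lambda>x. norm (indicator {a..b} x *\<^sub>R f x))"
      using int unfolding set_integrable_def by (rule integrable_norm)
    show "integrable lborel (\<lambda>x. indicator {a..b} x *\<^sub>R L)"
      using ab by (simp add: integrable_scaleR_left)
    show "AE x in lborel. norm (indicator {a..b} x *\<^sub>R f x) \<le> indicator {a..b} x *\<^sub>R L"
      using bound by eventually_elim (auto simp: indicator_def)
  qed
  also have "\<dots> = L * (b - a)"
    using ab by simp
  finally show ?thesis
    using F ab by (auto simp: primitive_def)
qed

lemma Linf_loc_measurable: "Linf_loc f \<Longrightarrow> f \<in> borel_measurable borel"
  by (simp add: Linf_loc_def)

lemma Linf_loc_bound:
  assumes "Linf_loc f"
  obtains L where "L > 0" "AE x in lborel. x \<in> {a..b} \<longrightarrow> \<bar>f x\<bar> \<le> L"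
proof -
  obtain B where B: "AE x in lborel. x \<in> {a..b} \<longrightarrow> \<bar>f x\<bar> \<le> B"
    using assms compact_Icc unfolding Linf_loc_def by blast
  have "AE x in lborel. x \<in> {a..b} \<longrightarrow> \<bar>f x\<bar> \<le> max B 1"
    using B by eventually_elim auto
  then show thesis using that[of "max B 1"] by auto
qed

lemma Linf_locI:
  assumes "f \<in> borel_measurable borel" "\<And>R. R > 0 \<Longrightarrow> \<exists>B. AE x in lborel. x \<in> {-R..R} \<longrightarrow> \<bar>f x\<bar> \<le> B"
  shows "Linf_loc f"
  unfolding Linf_loc_def
proof (intro conjI allI impI)
  fix A :: "real set" assume "compact A"
  then obtain R where R: "R > 0" "\<forall>x\<in>A. norm x \<le> R"
    using compact_imp_bounded bounded_pos by metis
  obtain B where "AE x in lborel. x \<in> {-R..R} \<longrightarrow> \<bar>f x\<bar> \<le> B"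
    using assms(2) R(1) by blast
  then have "AE x in lborel. x \<in> A \<longrightarrow> \<bar>f x\<bar> \<le> B"
    by eventually_elim (use R(2) in \<open>auto simp: abs_le_iff minus_le_iff\<close>)
  then show "\<exists>B. AE x in lborel. x \<in> A \<longrightarrow> \<bar>f x\<bar> \<le> B" ..
qed (use assms(1) in simp)

lemma Linf_loc_continuous:
  assumes "continuous_on UNIV f"
  shows "Linf_loc f"
proof (rule Linf_locI)
  show "f \<in> borel_measurable borel" by (rule borel_measurable_continuous_onI[OF assms])
  fix R :: real
  have "compact (f ` {-R..R})"
    by (intro compact_continuous_image continuous_on_subset[OF assms]) auto
  then obtain B where "\<forall>y\<in>f ` {-R..R}. norm y \<le> B"
    using compact_imp_bounded bounded_iff by metis
  then have "\<bar>f x\<bar> \<le> B" if "x \<in> {-R..R}" for x using that by simp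
  then show "\<exists>B. AE x in lborel. x \<in> {-R..R} \<longrightarrow> \<bar>f x\<bar> \<le> B" by (intro exI[of _ B] AE_I2) blast
qed

lemma Linf_loc_add:
  assumes "Linf_loc f" "Linf_loc g"
  shows "Linf_loc (\<lambda>x. f x + g x)"
proof (rule Linf_locI)
  show "(\<lambda>x. f x + g x) \<in> borel_measurable borel"
    using assms by (intro borel_measurable_add Linf_loc_measurable)
  fix R :: real
  obtain L where L: "AE x in lborel. x \<in> {-R..R} \<longrightarrow> \<bar>f x\<bar> \<le> L" using Linf_loc_bound[OF assms(1)] by blast
  obtain M where M: "AE x in lborel. x \<in> {-R..R} \<longrightarrow> \<bar>g x\<bar> \<le> M" using Linf_loc_bound[OF assms(2)] by blast
  have "AE x in lborel. x \<in> {-R..R} \<longrightarrow> \<bar>f x + g x\<bar> \<le> L + M"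
    using L M by eventually_elim auto
  then show "\<exists>B. AE x in lborel. x \<in> {-R..R} \<longrightarrow> \<bar>f x + g x\<bar> \<le> B" ..
qed

lemma Linf_loc_mult:
  assumes "Linf_loc f" "Linf_loc g"
  shows "Linf_loc (\<lambda>x. f x * g x)"
proof (rule Linf_locI)
  show "(\<lambda>x. f x * g x) \<in> borel_measurable borel"
    using assms by (intro borel_measurable_times Linf_loc_measurable)
  fix R :: real
  obtain L where L: "L > 0" "AE x in lborel. x \<in> {-R..R} \<longrightarrow> \<bar>f x\<bar> \<le> L" using Linf_loc_bound[OF assms(1)] by blast
  obtain M where M: "M > 0" "AE x in lborel. x \<in> {-R..R} \<longrightarrow> \<bar>g x\<bar> \<le> M" using Linf_loc_bound[OF assms(2)] by blast
  have "AE x in lborel. x \<in> {-R..R} \<longrightarrow> \<bar>f x * g x\<bar> \<le> L * M"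
    using L(2) M(2) by eventually_elim (use L(1) in \<open>auto simp: abs_mult intro!: mult_mono\<close>)
  then show "\<exists>B. AE x in lborel. x \<in> {-R..R} \<longrightarrow> \<bar>f x * g x\<bar> \<le> B" ..
qed

lemma Linf_loc_locally_integrable:
  assumes "Linf_loc f"
  shows "locally_integrable f"
proof (rule locally_integrableI)
  fix R :: real assume R: "R > 0"
  obtain L where L: "L > 0" "AE x in lborel. x \<in> {-R..R} \<longrightarrow> \<bar>f x\<bar> \<le> L" using Linf_loc_bound[OF assms] by blast
  have [measurable]: "f \<in> borel_measurable borel" using assms by (rule Linf_loc_measurable)
  show "set_integrable lborel {-R..R} f"
    unfolding set_integrable_def
  proof (rule Bochner_Integration.integrable_bound)
    show "integrable lborel (\<lambda>x. indicator {-R..R} x *\<^sub>R L)"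
      using R by (simp add: integrable_scaleR_left)
    show "AE x in lborel. norm (indicator {-R..R} x *\<^sub>R f x) \<le> norm (indicator {-R..R} x *\<^sub>R L)"
      using L(2) by eventually_elim (auto simp: indicator_def)
  qed measurable
qed

lemma primitive_Lipschitz:
  assumes "primitive F f" "Linf_loc f"
  obtains L where "L > 0" "\<forall>x\<in>{a..b}. \<forall>y\<in>{a..b}. \<bar>F y - F x\<bar> \<le> L * \<bar>y - x\<bar>"
    "AE x in lborel. x \<in> {a..b} \<longrightarrow> \<bar>f x\<bar> \<le> L"
proof -
  obtain L where L: "L > 0" "AE x in lborel. x \<in> {a..b} \<longrightarrow> \<bar>f x\<bar> \<le> L"
    using Linf_loc_bound[OF assms(2)] by blast
  have le: "\<bar>F y - F x\<bar> \<le> L * (y - x)" if "x \<in> {a..b}" "y \<in> {a..b}" "x \<le> y" for x y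
    by (rule primitive_bound[OF assms(1) that(3)]) (use L(2) in eventually_elim, use that in auto)
  have "\<bar>F y - F x\<bar> \<le> L * \<bar>y - x\<bar>" if "x \<in> {a..b}" "y \<in> {a..b}" for x y
    using le[OF that] le[OF that(2,1)] by (cases "x \<le> y") (auto simp: abs_minus_commute)
  then show thesis using that[OF L(1) _ L(2)] by blast
qed

lemma primitive_continuous:
  assumes "primitive F f" "Linf_loc f"
  shows "continuous_on UNIV F"
proof (rule continuous_at_imp_continuous_on, rule ballI)
  fix x :: real
  obtain L where L: "L > 0" "\<forall>z\<in>{x-1..x+1}. \<forall>y\<in>{x-1..x+1}. \<bar>F y - F z\<bar> \<le> L * \<bar>y - z\<bar>"
    using primitive_Lipschitz[OF assms] by blast
  show "isCont F x"
    unfolding isCont_def LIM_eq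
  proof (intro allI impI)
    fix r :: real assume "r > 0"
    show "\<exists>s>0. \<forall>y. y \<noteq> x \<and> norm (y - x) < s \<longrightarrow> norm (F y - F x) < r"
    proof (intro exI[of _ "min 1 (r / L)"] conjI allI impI)
      fix y assume y: "y \<noteq> x \<and> norm (y - x) < min 1 (r / L)"
      then have "\<bar>F y - F x\<bar> \<le> L * \<bar>y - x\<bar>" by (intro L(2)[rule_format]) auto
      also have "\<dots> < r" using y L(1) by (simp add: pos_less_divide_eq mult.commute)
      finally show "norm (F y - F x) < r" by simp
    qed (use L(1) \<open>r > 0\<close> in simp)
  qed
qed

text \<open>Together with the mean value theorem this serves to recognise constant functions without
  differentiating anything almost everywhere.\<close>

lemma derivative_0_if_quadratic:
  fixes \<Phi> :: "real \<Rightarrow> real"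
  assumes "d > 0" "\<And>y. \<bar>y - x\<bar> < d \<Longrightarrow> \<bar>\<Phi> y - \<Phi> x\<bar> \<le> C * (y - x)\<^sup>2"
  shows "(\<Phi> has_real_derivative 0) (at x)"
  unfolding DERIV_def
proof (rule Lim_null_comparison)
  show "\<forall>\<^sub>F h in at 0. norm ((\<Phi> (x + h) - \<Phi> x) / h) \<le> C * \<bar>h\<bar>"
    unfolding eventually_at
  proof (intro exI[of _ d] conjI ballI impI assms(1))
    fix h :: real assume h: "h \<noteq> 0 \<and> dist h 0 < d"
    then have "\<bar>\<Phi> (x + h) - \<Phi> x\<bar> \<le> C * h\<^sup>2" using assms(2)[of "x + h"] by simp
    then show "norm ((\<Phi> (x + h) - \<Phi> x) / h) \<le> C * \<bar>h\<bar>"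
      using h by (simp add: divide_le_eq power2_eq_square abs_mult_self mult.assoc)
  qed
  show "(\<lambda>h. C * \<bar>h\<bar>) \<midarrow>0\<rightarrow> 0"
    by (auto intro!: tendsto_eq_intros)
qed

text \<open>Let \<open>H\<close> be a primitive of \<open>f G + F g\<close>. The increments of \<open>F G - H\<close> over an interval are quadratic in its
  length, as \<open>F\<close> and \<open>G\<close> are locally Lipschitz; so this difference has derivative \<open>0\<close> everywhere.\<close>

lemma primitive_mult:
  assumes F: "primitive F f" and G: "primitive G g" and f: "Linf_loc f" and g: "Linf_loc g"
  shows "primitive (\<lambda>x. F x * G x) (\<lambda>x. f x * G x + F x * g x)"
proof -
  let ?k = "\<lambda>x. f x * G x + F x * g x"
  have cF: "continuous_on UNIV F" and cG: "continuous_on UNIV G"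
    using primitive_continuous assms by blast+
  have k: "Linf_loc ?k"
    by (intro Linf_loc_add Linf_loc_mult f g Linf_loc_continuous cF cG)
  obtain H where H: "primitive H ?k"
    using primitive_exists[OF Linf_loc_locally_integrable[OF k]] by blast
  define \<Phi> where "\<Phi> x = F x * G x - H x" for x
  have "(\<Phi> has_real_derivative 0) (at z)" for z
  proof -
    obtain L where L: "L > 0" "\<forall>x\<in>{z-1..z+1}. \<forall>y\<in>{z-1..z+1}. \<bar>F y - F x\<bar> \<le> L * \<bar>y - x\<bar>"
      "AE x in lborel. x \<in> {z-1..z+1} \<longrightarrow> \<bar>f x\<bar> \<le> L"
      using primitive_Lipschitz[OF F f] by blast
    obtain M where M: "M > 0" "\<forall>x\<in>{z-1..z+1}. \<forall>y\<in>{z-1..z+1}. \<bar>G y - G x\<bar> \<le> M * \<bar>y - x\<bar>"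
      "AE x in lborel. x \<in> {z-1..z+1} \<longrightarrow> \<bar>g x\<bar> \<le> M"
      using primitive_Lipschitz[OF G g] by blast
    have le: "\<bar>\<Phi> y - \<Phi> x\<bar> \<le> 2 * L * M * (y - x)\<^sup>2" if "x \<in> {z-1..z+1}" "y \<in> {z-1..z+1}" "x \<le> y" for x y
    proof -
      have \<Psi>: "primitive (\<lambda>s. F y * G s + (G x * F s + (-1) * H s)) (\<lambda>s. F y * g s + (G x * f s + (-1) * ?k s))"
        by (intro primitive_add primitive_cmult F G H)
      have "\<bar>(F y * G y + (G x * F y + (-1) * H y)) - (F y * G x + (G x * F x + (-1) * H x))\<bar> \<le> (2 * L * M * (y - x)) * (y - x)"
      proof (rule primitive_bound[OF \<Psi> that(3)])
        show "AE s in lborel. s \<in> {x..y} \<longrightarrow> \<bar>F y * g s + (G x * f s + (-1) * ?k s)\<bar> \<le> 2 * L * M * (y - x)"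
          using L(3) M(3)
        proof eventually_elim
          case (elim s)
          show ?case
          proof
            assume s: "s \<in> {x..y}"
            have 1: "\<bar>F y - F s\<bar> \<le> L * (y - x)"
              using L(2)[rule_format, of s y] s that L(1) by (smt (verit) atLeastAtMost_iff mult_left_mono)
            have 2: "\<bar>G s - G x\<bar> \<le> M * (y - x)"
              using M(2)[rule_format, of x s] s that M(1) by (smt (verit) atLeastAtMost_iff mult_left_mono)
            have "F y * g s + (G x * f s + (-1) * ?k s) = (F y - F s) * g s - (G s - G x) * f s"
              by (simp add: algebra_simps)
            also have "\<bar>\<dots>\<bar> \<le> \<bar>F y - F s\<bar> * \<bar>g s\<bar> + \<bar>G s - G x\<bar> * \<bar>f s\<bar>"
              unfolding abs_mult[symmetric] by (rule abs_triangle_ineq4)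
            also have "\<dots> \<le> (L * (y - x)) * M + (M * (y - x)) * L"
              using elim s that 1 2 L(1) M(1) by (intro add_mono mult_mono) auto
            finally show "\<bar>F y * g s + (G x * f s + (-1) * ?k s)\<bar> \<le> 2 * L * M * (y - x)"
              by (simp add: algebra_simps)
          qed
        qed
      qed
      then show ?thesis
        by (simp add: \<Phi>_def power2_eq_square algebra_simps)
    qed
    show ?thesis
    proof (rule derivative_0_if_quadratic[of 1])
      fix y :: real assume "\<bar>y - z\<bar> < 1"
      then show "\<bar>\<Phi> y - \<Phi> z\<bar> \<le> 2 * L * M * (y - z)\<^sup>2"
        using le[of y z] le[of z y] by (cases "y \<le> z") (auto simp: abs_minus_commute power2_commute)
    qed simp
  qed
  then have "\<Phi> x = \<Phi> y" for x y
    using DERIV_isconst_all by blast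
  then have "F b * G b - F a * G a = H b - H a" for a b
    by (metis (no_types, lifting) \<Phi>_def diff_diff_eq2 diff_add_cancel add_diff_eq add.commute)
  then show ?thesis
    using H by (simp add: primitive_def)
qed

text \<open>Each such point is followed by a rational number that lies before all later points of \<open>Z\<close>.\<close>

lemma countable_right_isolated:
  fixes Z :: "real set"
  shows "countable {x \<in> Z. \<exists>d>0. \<forall>y. x < y \<and> y < x + d \<longrightarrow> y \<notin> Z}" (is "countable ?I")
proof -
  have "\<exists>q::rat. x < of_rat q \<and> (\<forall>y. x < y \<and> y \<le> of_rat q \<longrightarrow> y \<notin> Z)" if "x \<in> ?I" for x
  proof -
    obtain d where d: "d > 0" "\<forall>y. x < y \<and> y < x + d \<longrightarrow> y \<notin> Z" using \<open>x \<in> ?I\<close> by blast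
    then obtain q where q: "x < of_rat q" "of_rat q < x + d"
      using of_rat_dense[of x "x + d"] by auto
    then show ?thesis using d(2) by (intro exI[of _ q]) auto
  qed
  then have "\<forall>x\<in>?I. \<exists>q::rat. x < of_rat q \<and> (\<forall>y. x < y \<and> y \<le> of_rat q \<longrightarrow> y \<notin> Z)"
    by (rule ballI)
  from bchoice[OF this] obtain q :: "real \<Rightarrow> rat"
    where q: "\<forall>x\<in>?I. x < of_rat (q x) \<and> (\<forall>y. x < y \<and> y \<le> of_rat (q x) \<longrightarrow> y \<notin> Z)" ..
  have "inj_on q ?I"
  proof (rule inj_onI)
    fix x y assume x: "x \<in> ?I" and y: "y \<in> ?I" and eq: "q x = q y"
    have "\<not> x < y" if "x \<in> ?I" "y \<in> ?I" "q x = q y" for x y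
    proof
      assume "x < y"
      moreover have "y < of_rat (q x)"
        using bspec[OF q that(2)] that(3) by simp
      ultimately have "y \<notin> Z"
        using bspec[OF q that(1)] by simp
      then show False using that(2) by simp
    qed
    from this[OF x y eq] this[OF y x eq[symmetric]] show "x = y" by simp
  qed
  then show ?thesis by (rule countableI') 
qed

lemma AE_lborel_negligible: "negligible N \<Longrightarrow> AE x in lborel. x \<notin> N"
  using AE_not_in[of N lebesgue] AE_completion_iff[of "\<lambda>x. x \<notin> N" lborel] by (simp add: negligible_iff_null_sets)

text \<open>At almost every zero \<open>x\<close> of \<open>F\<close> the right derivative of \<open>F\<close> is \<open>f x\<close>, and, outside a countable set,
  further zeros accumulate at \<open>x\<close> from the right.\<close>

lemma primitive_zero_set:
  assumes "primitive F f"
  shows "AE x in lborel. F x = 0 \<longrightarrow> f x = 0"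
proof -
  have f: "locally_integrable f" and F: "\<And>a b. a \<le> b \<Longrightarrow> F b - F a = (LINT x:{a..b}|lborel. f x)"
    using assms by (auto simp: primitive_def)
  have int: "f integrable_on cbox a b" for a b
    using set_borel_integral_eq_integral(1)[OF locally_integrable_interval[OF f]] by simp
  obtain N where N: "negligible N" "\<And>x e. x \<notin> N \<Longrightarrow> 0 < e \<Longrightarrow>
      \<exists>d>0. \<forall>h. 0 < h \<and> h < d \<longrightarrow> norm (integral (cbox x (x + h *\<^sub>R One)) f /\<^sub>R h ^ DIM(real) - f x) < e"
    using integrable_ccontinuous_explicit[OF int] by blast
  define Z where "Z = {x. F x = 0}"
  let ?I = "{x \<in> Z. \<exists>d>0. \<forall>y. x < y \<and> y < x + d \<longrightarrow> y \<notin> Z}"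
  have "AE x in lborel. x \<notin> N" by (rule AE_lborel_negligible[OF N(1)])
  moreover have "AE x in lborel. x \<notin> ?I"
    by (rule AE_not_in[OF countable_imp_null_set_lborel[OF countable_right_isolated]])
  ultimately show ?thesis
  proof eventually_elim
    case (elim x)
    show ?case
    proof
      assume "F x = 0"
      then have "x \<in> Z" by (simp add: Z_def)
      have "\<bar>f x\<bar> < e" if e: "e > 0" for e
      proof -
        obtain d where d: "d > 0" "\<forall>h. 0 < h \<and> h < d \<longrightarrow> norm (integral (cbox x (x + h *\<^sub>R One)) f /\<^sub>R h ^ DIM(real) - f x) < e"
          using N(2)[OF elim(1) e] by blast
        obtain y where y: "x < y" "y < x + d" "y \<in> Z"
          using elim(2) \<open>x \<in> Z\<close> d(1) by blast
        have "integral {x..y} f = F y - F x"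
          using F[of x y] y(1) set_borel_integral_eq_integral(2)[OF locally_integrable_interval[OF f]] by simp
        also have "\<dots> = 0" using y(3) \<open>F x = 0\<close> by (simp add: Z_def)
        finally show ?thesis
          using d(2)[rule_format, of "y - x"] y by simp
      qed
      then show "f x = 0" by (metis abs_le_zero_iff linorder_not_le less_irrefl zero_less_abs_iff)
    qed
  qed
qed

lemma test_function_DERIV:
  assumes "test_function \<psi>"
  shows "(\<psi> has_real_derivative deriv \<psi> x) (at x)"
  using smooth_has_derivative[OF test_function_smooth[OF assms], of x]
  by (metis DERIV_deriv_iff_has_field_derivative has_real_derivative_iff_has_vector_derivative DERIV_imp_deriv)

lemma deriv_eq_vector_derivative:
  fixes \<psi> :: "real \<Rightarrow> real"
  assumes "test_function \<psi>"
  shows "vector_derivative \<psi> (at x) = deriv \<psi> x"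
  using test_function_DERIV[OF assms, of x]
  by (simp add: has_real_derivative_iff_has_vector_derivative vector_derivative_at)

lemma test_function_deriv:
  fixes \<psi> :: "real \<Rightarrow> real"
  assumes "test_function \<psi>"
  shows "test_function (deriv \<psi>)"
  using test_function_derivative[OF assms] deriv_eq_vector_derivative[OF assms] by simp

lemma primitive_test_function:
  assumes "test_function \<psi>"
  shows "primitive \<psi> (deriv \<psi>)" "Linf_loc (deriv \<psi>)" "continuous_on UNIV \<psi>"
  using test_function_DERIV[OF assms] smooth_continuous test_function_smooth test_function_deriv[OF assms] assms
  by (auto intro!: primitive_C1 Linf_loc_continuous)

lemma integral_eq_set_integral:
  fixes f :: "real \<Rightarrow> real"
  assumes "\<And>x. x \<notin> A \<Longrightarrow> f x = 0"
  shows "(\<integral>x. f x \<partial>lborel) = (LINT x:A|lborel. f x)"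
  unfolding set_lebesgue_integral_def
  by (rule Bochner_Integration.integral_cong) (use assms in \<open>auto simp: indicator_def\<close>)

lemma integration_by_parts:
  assumes F: "primitive F f" and f: "Linf_loc f" and \<psi>: "test_function \<psi>"
  shows "(\<integral>x. deriv \<psi> x * F x \<partial>lborel) = - (\<integral>x. \<psi> x * f x \<partial>lborel)"
proof -
  obtain R where R: "R > 0" "\<And>x. \<bar>x\<bar> \<ge> R \<Longrightarrow> \<psi> x = 0"
    using test_function_support[OF \<psi>] by blast
  obtain R' where R': "R' > 0" "\<And>x. \<bar>x\<bar> \<ge> R' \<Longrightarrow> deriv \<psi> x = 0"
    using test_function_support[OF test_function_deriv[OF \<psi>]] by blast
  define M where "M = max R R'"
  have 1: "primitive (\<lambda>x. \<psi> x * F x) (\<lambda>x. deriv \<psi> x * F x + \<psi> x * f x)"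
    using primitive_mult[OF primitive_test_function(1)[OF \<psi>] F primitive_test_function(2)[OF \<psi>] f] .
  have "(\<integral>x. deriv \<psi> x * F x \<partial>lborel) + (\<integral>x. \<psi> x * f x \<partial>lborel) = (\<integral>x. deriv \<psi> x * F x + \<psi> x * f x \<partial>lborel)"
    using integrable_test_times_locally_integrable[OF \<psi> Linf_loc_locally_integrable[OF f]]
      integrable_test_times_locally_integrable[OF test_function_deriv[OF \<psi>]
        locally_integrable_continuous[OF primitive_continuous[OF F f]]] by simp
  also have "\<dots> = (LINT x:{-M..M}|lborel. deriv \<psi> x * F x + \<psi> x * f x)"
    by (rule integral_eq_set_integral) (use R R' in \<open>auto simp: M_def\<close>)
  also have "\<dots> = \<psi> M * F M - \<psi> (-M) * F (-M)"
    using 1 R(1) by (auto simp: primitive_def M_def)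
  also have "\<dots> = 0" using R by (simp add: M_def)
  finally show ?thesis by simp
qed

lemma integral_bump_tendsto:
  fixes f :: "real \<Rightarrow> real"
  assumes f: "locally_integrable f"
  shows "(\<lambda>n. \<integral>x. bump (real (Suc n)) a b x * f x \<partial>lborel) \<longlonglongrightarrow> (LINT x:{a<..<b}|lborel. f x)"
  unfolding set_lebesgue_integral_def
proof (rule integral_dominated_convergence)
  have [measurable]: "f \<in> borel_measurable borel" by (rule locally_integrable_measurable[OF f])
  have [measurable]: "bump (real (Suc n)) a b \<in> borel_measurable borel" for n
    by (intro borel_measurable_continuous_onI smooth_continuous smooth_bump)
  show "(\<lambda>x. indicator {a<..<b} x *\<^sub>R f x) \<in> borel_measurable lborel" by measurable
  show "(\<lambda>x. bump (real (Suc n)) a b x * f x) \<in> borel_measurable lborel" for n by measurable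
  show "integrable lborel (\<lambda>x. norm (indicator {a..b} x *\<^sub>R f x))"
    using locally_integrable_interval[OF f, of a b] unfolding set_integrable_def by (rule integrable_norm)
  show "AE x in lborel. (\<lambda>n. bump (real (Suc n)) a b x * f x) \<longlonglongrightarrow> indicator {a<..<b} x *\<^sub>R f x"
    using bump_tendsto_indicator[of a b] by (intro AE_I2) (simp del: of_nat_Suc add: tendsto_mult_right)
  have "norm (bump (real (Suc n)) a b x * f x) \<le> norm (indicator {a..b} x *\<^sub>R f x)" for n x
  proof (cases "x \<in> {a<..<b}")
    case True
    then show ?thesis
      using bump_bounds[of "real (Suc n)" a b x] by (auto simp: abs_mult mult_left_le_one_le simp del: of_nat_Suc)
  qed (simp add: bump_outside)
  then show "AE x in lborel. norm (bump (real (Suc n)) a b x * f x) \<le> norm (indicator {a..b} x *\<^sub>R f x)" for n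
    by (intro AE_I2)
qed

lemma set_integral_Ioo_Icc: "(LINT x:{a<..<b}|lborel. f x) = (LINT x:{a..b}|lborel. f x)" for f :: "real \<Rightarrow> real"
  by (rule set_integral_discrete_difference[where X = "{a, b}"]) auto

text \<open>Bump functions exhaust the indicators of intervals, so \<open>0\<close> is a primitive of \<open>f\<close>.\<close>

lemma fundamental_lemma:
  fixes f :: "real \<Rightarrow> real"
  assumes f: "locally_integrable f" and zero: "\<And>\<psi>. test_function \<psi> \<Longrightarrow> (\<integral>x. \<psi> x * f x \<partial>lborel) = 0"
  shows "AE x in lborel. f x = 0"
proof -
  have "(LINT x:{a..b}|lborel. f x) = 0" for a b
    using integral_bump_tendsto[OF f, of a b] zero[OF test_function_bump]
    by (simp add: LIMSEQ_const_iff set_integral_Ioo_Icc)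
  then have "primitive (\<lambda>x. 0) f"
    using f by (simp add: primitive_def)
  from primitive_zero_set[OF this] show ?thesis by simp
qed

text \<open>The antiderivative vanishing far to the left is constant far to the right, and the constant is the
  integral of \<open>\<psi>\<close>.\<close>

lemma test_function_antiderivative:
  fixes \<psi> :: "real \<Rightarrow> real"
  assumes \<psi>: "test_function \<psi>" and "(\<integral>x. \<psi> x \<partial>lborel) = 0"
  obtains \<Psi> where "test_function \<Psi>" "deriv \<Psi> = \<psi>"
proof -
  obtain R where R: "R > 0" "\<And>x. \<bar>x\<bar> \<ge> R \<Longrightarrow> \<psi> x = 0"
    using test_function_support[OF \<psi>] by blast
  have cont: "continuous_on UNIV \<psi>" by (rule primitive_test_function(3)[OF \<psi>])
  have "\<exists>F. \<forall>x. -\<infinity> < ereal x \<longrightarrow> ereal x < \<infinity> \<longrightarrow> (F has_vector_derivative \<psi> x) (at x)"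
    using cont by (intro einterval_antiderivative) (auto simp: continuous_on_eq_continuous_at)
  then obtain F where F: "\<And>x. (F has_vector_derivative \<psi> x) (at x)" by auto
  have prim: "primitive F \<psi>"
    using F cont by (intro primitive_C1) (simp_all add: has_real_derivative_iff_has_vector_derivative)
  define \<Psi> where "\<Psi> x = F x - F (-R)" for x
  have der: "(\<Psi> has_vector_derivative \<psi> x) (at x)" for x
    unfolding \<Psi>_def[abs_def] using F[of x] by (auto intro!: derivative_eq_intros)
  have "F R - F (-R) = (\<integral>x. \<psi> x \<partial>lborel)"
    using prim R(1) integral_eq_set_integral[of "{-R..R}" \<psi>] R(2) by (force simp: primitive_def)
  then have FR: "F R = F (-R)" using assms(2) by simp
  have diff: "F y = F x" if "x \<le> y" "\<And>z. z \<in> {x..y} \<Longrightarrow> \<psi> z = 0" for x y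
    using primitive_bound[OF prim that(1), of 0] that(2) by simp
  have "\<Psi> x = 0" if "\<bar>x\<bar> \<ge> R" for x
    using that diff[of R x] diff[of x "-R"] R FR by (cases "x \<ge> 0") (auto simp: \<Psi>_def)
  then have "test_function \<Psi>"
    using smoothI_derivative[OF test_function_smooth[OF \<psi>] der] by (intro test_functionI)
  moreover have "deriv \<Psi> = \<psi>"
    using der by (auto simp: has_real_derivative_iff_has_vector_derivative[symmetric] intro!: DERIV_imp_deriv)
  ultimately show thesis using that by blast
qed

lemma test_function_integral_1:
  obtains \<eta> :: "real \<Rightarrow> real" where "test_function \<eta>" "(\<integral>x. \<eta> x \<partial>lborel) = 1"
proof -
  have "(\<lambda>n. \<integral>x. bump (real (Suc n)) 0 1 x * 1 \<partial>lborel) \<longlonglongrightarrow> (LINT x:{0<..<1::real}|lborel. 1::real)"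
    by (intro integral_bump_tendsto locally_integrable_continuous) auto
  then have lim: "(\<lambda>n. \<integral>x. bump (real (Suc n)) 0 1 x \<partial>lborel) \<longlonglongrightarrow> 1"
    by (simp add: set_lebesgue_integral_def)
  obtain n where n: "(\<integral>x. bump (real (Suc n)) 0 1 x \<partial>lborel) \<noteq> 0"
  proof (rule ccontr)
    assume "\<not> thesis"
    then have "(\<integral>x. bump (real (Suc n)) 0 1 x \<partial>lborel) = 0" for n using that by blast
    then show False using lim by (simp add: LIMSEQ_const_iff del: of_nat_Suc)
  qed
  define c where "c = inverse (\<integral>x. bump (real (Suc n)) 0 1 x \<partial>lborel)"
  have "test_function (\<lambda>x. c *\<^sub>R bump (real (Suc n)) 0 1 x)"
    by (intro test_function_scaleR smooth_const test_function_bump) simp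
  then show thesis
    using that[of "\<lambda>x. c *\<^sub>R bump (real (Suc n)) 0 1 x"] n by (simp add: c_def del: of_nat_Suc)
qed

lemma test_function_cmult: "test_function \<psi> \<Longrightarrow> test_function (\<lambda>x. c * \<psi> x)" for \<psi> :: "real \<Rightarrow> real"
  using test_function_scaleR[OF smooth_const[of c], where g = \<psi>] by simp

lemma test_function_integrable: "test_function \<psi> \<Longrightarrow> integrable lborel \<psi>" for \<psi> :: "real \<Rightarrow> real"
  using integrable_test_times_locally_integrable[of \<psi> "\<lambda>x. 1::real"] by (simp add: locally_integrable_continuous)

lemma zero_mean_decomposition:
  fixes \<psi> \<eta> :: "real \<Rightarrow> real"
  assumes \<psi>: "test_function \<psi>" and \<eta>: "test_function \<eta>" "(\<integral>x. \<eta> x \<partial>lborel) = 1"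
  obtains \<Psi> where "test_function \<Psi>" "\<And>x. deriv \<Psi> x = \<psi> x - (\<integral>x. \<psi> x \<partial>lborel) * \<eta> x"
proof -
  let ?m = "\<integral>x. \<psi> x \<partial>lborel"
  have "test_function (\<lambda>x. \<psi> x + (- ?m) * \<eta> x)"
    by (intro test_function_add test_function_cmult \<psi> \<eta>)
  moreover have "(\<integral>x. \<psi> x + (- ?m) * \<eta> x \<partial>lborel) = 0"
    using test_function_integrable[OF \<psi>] test_function_integrable[OF \<eta>(1)] \<eta>(2) by simp
  ultimately obtain \<Psi> where "test_function \<Psi>" "deriv \<Psi> = (\<lambda>x. \<psi> x + (- ?m) * \<eta> x)"
    using test_function_antiderivative by blast
  then show thesis using that by simp
qed

text \<open>The lemma of du Bois-Reymond: subtracting a multiple of a fixed function \<open>\<eta>\<close> of integral \<open>1\<close> makes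
  every test function a derivative of a test function.\<close>

lemma constant_if_weak_derivative_0:
  fixes k :: "real \<Rightarrow> real"
  assumes k: "locally_integrable k" and zero: "\<And>\<psi>. test_function \<psi> \<Longrightarrow> (\<integral>x. deriv \<psi> x * k x \<partial>lborel) = 0"
  obtains C where "AE x in lborel. k x = C"
proof -
  obtain \<eta> :: "real \<Rightarrow> real" where \<eta>: "test_function \<eta>" "(\<integral>x. \<eta> x \<partial>lborel) = 1"
    using test_function_integral_1 by blast
  define C where "C = (\<integral>x. \<eta> x * k x \<partial>lborel)"
  have "AE x in lborel. k x + - C = 0"
  proof (rule fundamental_lemma)
    show "locally_integrable (\<lambda>x. k x + - C)"
      by (intro locally_integrable_add k locally_integrable_continuous) auto
    fix \<psi> :: "real \<Rightarrow> real" assume \<psi>: "test_function \<psi>"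
    obtain \<Psi> where \<Psi>: "test_function \<Psi>" "\<And>x. deriv \<Psi> x = \<psi> x - (\<integral>x. \<psi> x \<partial>lborel) * \<eta> x"
      using zero_mean_decomposition[OF \<psi> \<eta>] by blast
    have i: "integrable lborel (\<lambda>x. \<psi> x * k x)" "integrable lborel (\<lambda>x. \<eta> x * k x)"
      using integrable_test_times_locally_integrable[OF \<psi> k] integrable_test_times_locally_integrable[OF \<eta>(1) k] by simp_all
    have "0 = (\<integral>x. (\<psi> x - (\<integral>x. \<psi> x \<partial>lborel) * \<eta> x) * k x \<partial>lborel)"
      using zero[OF \<Psi>(1)] \<Psi>(2) by simp
    also have "\<dots> = (\<integral>x. \<psi> x * k x - (\<integral>x. \<psi> x \<partial>lborel) * (\<eta> x * k x) \<partial>lborel)"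
      by (simp add: algebra_simps)
    also have "\<dots> = (\<integral>x. \<psi> x * k x \<partial>lborel) - (\<integral>x. \<psi> x \<partial>lborel) * C"
      using i by (simp add: C_def)
    also have "\<dots> = (\<integral>x. \<psi> x * k x + (- C) * \<psi> x \<partial>lborel)"
      using i test_function_integrable[OF \<psi>] by simp
    finally show "(\<integral>x. \<psi> x * (k x + - C) \<partial>lborel) = 0"
      by (simp add: algebra_simps)
  qed
  then have "AE x in lborel. k x = C" by simp
  then show thesis using that by blast
qed

text \<open>The weak derivative of \<open>k\<close> is the constant obtained by testing against \<open>- \<eta>'\<close>; subtracting the
  corresponding linear function reduces to the case of vanishing weak derivative.\<close>

lemma affine_if_second_weak_derivative_0:
  fixes k :: "real \<Rightarrow> real"
  assumes k: "locally_integrable k"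
    and zero: "\<And>\<psi>. test_function \<psi> \<Longrightarrow> (\<integral>x. deriv (deriv \<psi>) x * k x \<partial>lborel) = 0"
  obtains A B where "AE x in lborel. k x = A + B * x"
proof -
  obtain \<eta> :: "real \<Rightarrow> real" where \<eta>: "test_function \<eta>" "(\<integral>x. \<eta> x \<partial>lborel) = 1"
    using test_function_integral_1 by blast
  \<comment> \<open>the slope, found by testing \<open>k = A + B x\<close> against \<open>\<eta>'\<close>\<close>
  define B where "B = - (\<integral>x. deriv \<eta> x * k x \<partial>lborel)"
  have lin: "primitive (\<lambda>x. (- B) * x) (\<lambda>x. - B)" "Linf_loc (\<lambda>x. - B)"
    by (auto intro!: primitive_C1 Linf_loc_continuous derivative_eq_intros)
  obtain A where "AE x in lborel. k x + (- B) * x = A"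
  proof (rule constant_if_weak_derivative_0)
    show li: "locally_integrable (\<lambda>x. k x + (- B) * x)"
      by (intro locally_integrable_add k locally_integrable_continuous continuous_intros)
    fix \<psi> :: "real \<Rightarrow> real" assume \<psi>: "test_function \<psi>"
    obtain \<Psi> where \<Psi>: "test_function \<Psi>" "\<And>x. deriv \<Psi> x = \<psi> x - (\<integral>x. \<psi> x \<partial>lborel) * \<eta> x"
      using zero_mean_decomposition[OF \<psi> \<eta>] by blast
    have eq: "deriv \<Psi> = (\<lambda>x. \<psi> x - (\<integral>x. \<psi> x \<partial>lborel) * \<eta> x)" using \<Psi>(2) by blast
    have dd: "deriv (deriv \<Psi>) x = deriv \<psi> x - (\<integral>x. \<psi> x \<partial>lborel) * deriv \<eta> x" for x
      unfolding eq
      by (rule DERIV_imp_deriv) (intro DERIV_diff DERIV_cmult test_function_DERIV \<psi> \<eta>)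
    note d\<psi> = test_function_deriv[OF \<psi>] and d\<eta> = test_function_deriv[OF \<eta>(1)]
    have i: "integrable lborel (\<lambda>x. deriv \<psi> x * k x)" "integrable lborel (\<lambda>x. deriv \<eta> x * k x)"
      using integrable_test_times_locally_integrable[OF d\<psi> k] integrable_test_times_locally_integrable[OF d\<eta> k] by simp_all
    have i2: "integrable lborel (\<lambda>x. deriv \<psi> x * ((- B) * x))"
      using integrable_test_times_locally_integrable[OF d\<psi> locally_integrable_continuous[of "\<lambda>x. (- B) * x"]]
      by (simp add: continuous_intros)
    have "0 = (\<integral>x. (deriv \<psi> x - (\<integral>x. \<psi> x \<partial>lborel) * deriv \<eta> x) * k x \<partial>lborel)"
      using zero[OF \<Psi>(1)] dd by simp
    also have "\<dots> = (\<integral>x. deriv \<psi> x * k x - (\<integral>x. \<psi> x \<partial>lborel) * (deriv \<eta> x * k x) \<partial>lborel)"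
      by (simp add: algebra_simps)
    also have "\<dots> = (\<integral>x. deriv \<psi> x * k x \<partial>lborel) + (\<integral>x. \<psi> x \<partial>lborel) * B"
      using i by (simp add: B_def)
    also have "(\<integral>x. \<psi> x \<partial>lborel) * B = - (\<integral>x. \<psi> x * (- B) \<partial>lborel)"
      by simp
    also have "\<dots> = (\<integral>x. deriv \<psi> x * ((- B) * x) \<partial>lborel)"
      by (rule integration_by_parts[OF lin \<psi>, symmetric])
    also have "(\<integral>x. deriv \<psi> x * k x \<partial>lborel) + \<dots> = (\<integral>x. deriv \<psi> x * (k x + (- B) * x) \<partial>lborel)"
      unfolding distrib_left by (rule Bochner_Integration.integral_add[OF i(1) i2, symmetric])
    finally show "(\<integral>x. deriv \<psi> x * (k x + (- B) * x) \<partial>lborel) = 0" by simp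
  qed
  then have "AE x in lborel. k x = A + B * x" by (auto elim!: AE_mp)
  then show thesis using that by blast
qed

text \<open>Functions with locally bounded weak derivative are locally Lipschitz after a change on a null set.\<close>

lemma weak_derivative_primitive:
  fixes h f :: "real \<Rightarrow> real"
  assumes "has_weak_derivative h f" "Linf_loc f"
  obtains F where "primitive F f" "AE x in lborel. h x = F x"
proof -
  have h: "locally_integrable h" and f: "locally_integrable f"
    and eq: "\<And>\<psi>. test_function \<psi> \<Longrightarrow> (\<integral>x. deriv \<psi> x * h x \<partial>lborel) = - (\<integral>x. \<psi> x * f x \<partial>lborel)"
    using assms(1) by (auto simp: has_weak_derivative_def)
  obtain F where F: "primitive F f" using primitive_exists[OF f] by blast
  have cF: "locally_integrable F"
    by (rule locally_integrable_continuous[OF primitive_continuous[OF F assms(2)]])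
  obtain C where C: "AE x in lborel. h x + (-1) * F x = C"
  proof (rule constant_if_weak_derivative_0)
    show "locally_integrable (\<lambda>x. h x + (-1) * F x)"
      by (intro locally_integrable_add locally_integrable_cmult h cF)
    fix \<psi> :: "real \<Rightarrow> real" assume \<psi>: "test_function \<psi>"
    note d\<psi> = test_function_deriv[OF \<psi>]
    have i: "integrable lborel (\<lambda>x. deriv \<psi> x * h x)" "integrable lborel (\<lambda>x. deriv \<psi> x * F x)"
      using integrable_test_times_locally_integrable[OF d\<psi> h] integrable_test_times_locally_integrable[OF d\<psi> cF] by simp_all
    have "(\<integral>x. deriv \<psi> x * (h x + (-1) * F x) \<partial>lborel) = (\<integral>x. deriv \<psi> x * h x \<partial>lborel) - (\<integral>x. deriv \<psi> x * F x \<partial>lborel)"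
      using i by (simp add: right_diff_distrib)
    then show "(\<integral>x. deriv \<psi> x * (h x + (-1) * F x) \<partial>lborel) = 0"
      using eq[OF \<psi>] integration_by_parts[OF F assms(2) \<psi>] by simp
  qed
  have "primitive (\<lambda>x. F x + C) (\<lambda>x. f x + 0)"
    by (intro primitive_add F primitive_const)
  moreover have "AE x in lborel. h x = F x + C" using C by eventually_elim simp
  ultimately show thesis using that by simp
qed

section \<open>Bounded square-integrable solutions of the degenerate equation\<close>

text \<open>Here \<open>W\<close> solves \<open>(C W')' = \<mu> W\<close> with flux \<open>p = C W'\<close> where \<open>C\<close> is positive, and \<open>p W\<close> increases. If it were
  positive somewhere, then \<open>W\<^sup>2\<close> would increase to the right: up to infinity, which \<open>no_escape\<close> forbids, or
  up to the first zero of \<open>C\<close>, where the Lipschitz bound on \<open>C\<close> forces a logarithmic singularity.\<close>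

lemma flux_nonpos:
  fixes C p W :: "real \<Rightarrow> real"
  assumes lam: "\<mu> > 0"
    and C_cont: "continuous_on UNIV C" and C_nonneg: "\<And>x. 0 \<le> C x"
    and C_Lip: "\<And>a b. \<exists>L>0. \<forall>x\<in>{a..b}. \<forall>y\<in>{a..b}. \<bar>C y - C x\<bar> \<le> L * \<bar>y - x\<bar>"
    and p': "\<And>x. C x > 0 \<Longrightarrow> (p has_real_derivative \<mu> * W x) (at x)"
    and W': "\<And>x. C x > 0 \<Longrightarrow> (W has_real_derivative p x / C x) (at x)"
    and W_bound: "\<And>x. C x > 0 \<Longrightarrow> \<bar>W x\<bar> \<le> M"
    and no_escape: "\<And>a d. d > 0 \<Longrightarrow> (\<And>x. x \<ge> a \<Longrightarrow> C x > 0) \<Longrightarrow> \<exists>x\<ge>a. (W x)\<^sup>2 < d"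
    and x0: "C x0 > 0"
  shows "p x0 * W x0 \<le> 0"
proof (rule ccontr)
  assume pos_flux: "\<not> ?thesis"
  define \<delta> where "\<delta> = p x0 * W x0"
  have \<delta>: "\<delta> > 0" using pos_flux by (simp add: \<delta>_def)
  have flux: "p x * W x \<ge> \<delta>" if "x \<ge> x0" "\<And>y. y \<in> {x0..x} \<Longrightarrow> C y > 0" for x
    unfolding \<delta>_def
  proof (rule DERIV_nonneg_imp_nondecreasing[OF that(1)])
    fix y assume "x0 \<le> y" "y \<le> x"
    then have y: "C y > 0" using that(2) by simp
    have "((\<lambda>y. p y * W y) has_real_derivative \<mu> * (W y)\<^sup>2 + (p y)\<^sup>2 / C y) (at y)"
      using p'[OF y] W'[OF y] by (auto intro!: derivative_eq_intros simp: power2_eq_square algebra_simps)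
    moreover have "\<mu> * (W y)\<^sup>2 + (p y)\<^sup>2 / C y \<ge> 0"
      using lam y by simp
    ultimately show "\<exists>z. ((\<lambda>y. p y * W y) has_real_derivative z) (at y) \<and> 0 \<le> z" by blast
  qed
  have W2: "((\<lambda>y. (W y)\<^sup>2) has_real_derivative 2 * (p y * W y) / C y) (at y)" if "C y > 0" for y
    using W'[OF that] by (auto intro!: derivative_eq_intros simp: field_simps)
  show False
  proof (cases "\<exists>b\<ge>x0. C b = 0")
    case False
    then have pos: "C x > 0" if "x \<ge> x0" for x
      using C_nonneg[of x] that by (metis order_le_less)
    have "(W x)\<^sup>2 \<ge> (W x0)\<^sup>2" if "x \<ge> x0" for x
    proof (rule DERIV_nonneg_imp_nondecreasing[OF that])
      fix y assume y: "x0 \<le> y" "y \<le> x"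
      have "0 \<le> 2 * (p y * W y) / C y"
        using flux[OF y(1)] pos \<delta> y(1) by (auto intro!: divide_nonneg_pos)
      then show "\<exists>z. ((\<lambda>y. (W y)\<^sup>2) has_real_derivative z) (at y) \<and> 0 \<le> z"
        using W2 pos y(1) by blast
    qed
    moreover have "(W x0)\<^sup>2 > 0"
      using \<delta> by (auto simp: \<delta>_def)
    ultimately show False
      using no_escape[of "(W x0)\<^sup>2" x0] pos by force
  next
    case True
    define Z where "Z = {y. y \<ge> x0 \<and> C y = 0}"
    have "Z = {x0..} \<inter> {y. C y = 0}" by (auto simp: Z_def)
    also have "closed \<dots>"
      by (intro closed_Int closed_atLeast closed_Collect_eq C_cont continuous_on_const)
    finally have "closed Z" .
    moreover have ne: "Z \<noteq> {}" and bdd: "bdd_below Z"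
      using True by (auto simp: Z_def)
    ultimately have "Inf Z \<in> Z" by (intro closed_contains_Inf)
    \<comment> \<open>the first zero of \<open>C\<close> to the right of \<open>x0\<close>\<close>
    define b where "b = Inf Z"
    have b: "b > x0" "C b = 0"
      using \<open>Inf Z \<in> Z\<close> x0 by (auto simp: Z_def b_def order_less_le)
    have pos: "C x > 0" if "x0 \<le> x" "x < b" for x
    proof -
      have "x \<notin> Z" using that(2) cInf_lower[OF _ bdd, of x] by (force simp: b_def)
      then show ?thesis using that(1) C_nonneg[of x] by (auto simp: Z_def order_less_le)
    qed
    obtain L where L: "L > 0" "\<forall>x\<in>{x0..b}. \<forall>y\<in>{x0..b}. \<bar>C y - C x\<bar> \<le> L * \<bar>y - x\<bar>"
      using C_Lip by blast
    have C_le: "C x \<le> L * (b - x)" if "x0 \<le> x" "x < b" for x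
      using L(2)[rule_format, of b x] that b C_nonneg[of x] by auto
    have grow: "(W x)\<^sup>2 \<ge> (2 * \<delta> / L) * (ln (b - x0) - ln (b - x))" if "x0 \<le> x" "x < b" for x
    proof -
      have "(W x0)\<^sup>2 + (2 * \<delta> / L) * ln (b - x0) \<le> (W x)\<^sup>2 + (2 * \<delta> / L) * ln (b - x)"
      proof (rule DERIV_nonneg_imp_nondecreasing[OF that(1)])
        fix y assume y: "x0 \<le> y" "y \<le> x"
        then have yb: "y < b" using that by simp
        have Cy: "C y > 0" using pos y yb by simp
        have "((\<lambda>y. (W y)\<^sup>2 + (2 * \<delta> / L) * ln (b - y)) has_real_derivative
            2 * (p y * W y) / C y - (2 * \<delta> / L) / (b - y)) (at y)"
        proof -
          have "((\<lambda>y. ln (b - y)) has_real_derivative - 1 / (b - y)) (at y)"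
            using yb by (auto intro!: derivative_eq_intros)
          from DERIV_add[OF W2[OF Cy] DERIV_cmult[OF this, of "2 * \<delta> / L"]] show ?thesis by simp
        qed
        moreover have "(2 * \<delta> / L) / (b - y) \<le> 2 * (p y * W y) / C y"
        proof -
          have "(2 * \<delta> / L) / (b - y) = 2 * \<delta> / (L * (b - y))" by simp
          also have "\<dots> \<le> 2 * \<delta> / C y"
            using C_le[OF y(1) yb] Cy \<delta> by (intro divide_left_mono) auto
          also have "\<dots> \<le> 2 * (p y * W y) / C y"
            using flux[OF y(1)] pos yb Cy by (intro divide_right_mono mult_left_mono) auto
          finally show ?thesis .
        qed
        ultimately show "\<exists>z. ((\<lambda>y. (W y)\<^sup>2 + (2 * \<delta> / L) * ln (b - y)) has_real_derivative z) (at y) \<and> 0 \<le> z"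
          by (metis diff_ge_0_iff_ge)
      qed
      then show ?thesis
        unfolding right_diff_distrib using zero_le_power2[of "W x0"] by linarith
    qed
    \<comment> \<open>At the point \<open>x\<close> with \<open>ln (b - x) = ln (b - x0) - N\<close> the lower bound for \<open>W\<^sup>2\<close> is \<open>M\<^sup>2 + 1\<close>.\<close>
    define N where "N = (M\<^sup>2 + 1) * L / (2 * \<delta>)"
    have N: "N > 0" using L(1) \<delta> by (auto simp: N_def intro!: divide_pos_pos mult_pos_pos add_nonneg_pos)
    define r where "r = (b - x0) * exp (- N)"
    define x where "x = b - r"
    have "r \<le> (b - x0) * 1"
      unfolding r_def using b N by (intro mult_left_mono) auto
    moreover have "0 < r"
      using b by (simp add: r_def)
    ultimately have x: "x0 \<le> x" "x < b"
      by (simp_all add: x_def)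
    have "ln (b - x) = ln (b - x0) - N"
      using b by (simp add: x_def r_def ln_mult)
    then have "(2 * \<delta> / L) * N \<le> (W x)\<^sup>2"
      using grow[OF x] by simp
    moreover have "(2 * \<delta> / L) * N = M\<^sup>2 + 1"
      using L(1) \<delta> by (simp add: N_def)
    moreover have "(W x)\<^sup>2 \<le> M\<^sup>2"
      using W_bound[OF pos[OF x]] abs_le_square_iff by (metis abs_ge_self order_trans)
    ultimately show False by simp
  qed
qed

text \<open>The reflection \<open>x \<mapsto> - x\<close> preserves the equation and reverses the sign of the flux, so \<open>p W\<close> is \<open>0\<close>
  where \<open>C\<close> is positive; then so is its derivative \<open>\<mu> W\<^sup>2 + p\<^sup>2 / C\<close>, a sum of non-negative terms.\<close>

lemma flux_zero:
  fixes C p W :: "real \<Rightarrow> real"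
  assumes lam: "\<mu> > 0"
    and C_cont: "continuous_on UNIV C" and C_nonneg: "\<And>x. 0 \<le> C x"
    and C_Lip: "\<And>a b. \<exists>L>0. \<forall>x\<in>{a..b}. \<forall>y\<in>{a..b}. \<bar>C y - C x\<bar> \<le> L * \<bar>y - x\<bar>"
    and p': "\<And>x. C x > 0 \<Longrightarrow> (p has_real_derivative \<mu> * W x) (at x)"
    and W': "\<And>x. C x > 0 \<Longrightarrow> (W has_real_derivative p x / C x) (at x)"
    and W_bound: "\<And>x. C x > 0 \<Longrightarrow> \<bar>W x\<bar> \<le> M"
    and no_escape: "\<And>a d. d > 0 \<Longrightarrow> (\<And>x. x \<ge> a \<Longrightarrow> C x > 0) \<Longrightarrow> \<exists>x\<ge>a. (W x)\<^sup>2 < d"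
    and no_escape': "\<And>a d. d > 0 \<Longrightarrow> (\<And>x. x \<le> a \<Longrightarrow> C x > 0) \<Longrightarrow> \<exists>x\<le>a. (W x)\<^sup>2 < d"
    and x0: "C x0 > 0"
  shows "W x0 = 0"
proof -
  have le: "p x * W x \<le> 0" if "C x > 0" for x
    using flux_nonpos[OF lam C_cont C_nonneg C_Lip p' W' W_bound no_escape that] by blast
  have ge: "p x * W x \<ge> 0" if "C x > 0" for x
  proof -
    have "(- p (- (- x))) * W (- (- x)) \<le> 0"
    proof (rule flux_nonpos[where C = "\<lambda>x. C (- x)" and p = "\<lambda>x. - p (- x)" and W = "\<lambda>x. W (- x)" and M = M, OF lam])
      show "continuous_on UNIV (\<lambda>x. C (- x))"
        by (rule continuous_on_compose2[OF C_cont]) (auto intro: continuous_intros)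
      show "\<exists>L>0. \<forall>x\<in>{a..b}. \<forall>y\<in>{a..b}. \<bar>C (- y) - C (- x)\<bar> \<le> L * \<bar>y - x\<bar>" for a b
      proof -
        obtain L where L: "L > 0" "\<forall>x\<in>{-b..-a}. \<forall>y\<in>{-b..-a}. \<bar>C y - C x\<bar> \<le> L * \<bar>y - x\<bar>"
          using C_Lip by blast
        have "\<bar>C (- y) - C (- x)\<bar> \<le> L * \<bar>y - x\<bar>" if "x \<in> {a..b}" "y \<in> {a..b}" for x y
          using L(2)[rule_format, of "-x" "-y"] that by (simp add: abs_minus_commute)
        then show ?thesis using L(1) by blast
      qed
      fix y assume y: "C (- y) > 0"
      have "((\<lambda>x. p (- x)) has_real_derivative (\<mu> * W (- y)) * (-1)) (at y)"
        by (rule DERIV_chain2[where g = uminus, OF p'[OF y]]) (auto intro!: derivative_eq_intros)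
      from DERIV_minus[OF this] show "((\<lambda>x. - p (- x)) has_real_derivative \<mu> * W (- y)) (at y)" by simp
      have "((\<lambda>x. W (- x)) has_real_derivative (p (- y) / C (- y)) * (-1)) (at y)"
        by (rule DERIV_chain2[where g = uminus, OF W'[OF y]]) (auto intro!: derivative_eq_intros)
      then show "((\<lambda>x. W (- x)) has_real_derivative - p (- y) / C (- y)) (at y)" by simp
      show "\<bar>W (- y)\<bar> \<le> M" by (rule W_bound[OF y])
    next
      fix a d :: real assume d: "d > 0" and pos: "\<And>x. x \<ge> a \<Longrightarrow> C (- x) > 0"
      have "C x > 0" if "x \<le> - a" for x using pos[of "- x"] that by simp
      then obtain x where "x \<le> - a" "(W x)\<^sup>2 < d" using no_escape'[OF d, of "- a"] by blast
      then show "\<exists>x\<ge>a. (W (- x))\<^sup>2 < d" by (intro exI[of _ "- x"]) auto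
    qed (use C_nonneg that in auto)
    then show ?thesis by simp
  qed
  have zero: "p x * W x = 0" if "C x > 0" for x
    using le[OF that] ge[OF that] by simp
  have "open {x. 0 < C x}"
    by (intro open_Collect_less continuous_on_const C_cont)
  then have "((\<lambda>x. p x * W x) has_real_derivative 0) (at x0)"
    by (rule has_field_derivative_transform_within_open[of "\<lambda>_. 0" 0 x0, OF DERIV_const]) (use x0 zero in auto)
  moreover have "((\<lambda>y. p y * W y) has_real_derivative \<mu> * (W x0)\<^sup>2 + (p x0)\<^sup>2 / C x0) (at x0)"
    using p'[OF x0] W'[OF x0] by (auto intro!: derivative_eq_intros simp: power2_eq_square algebra_simps)
  ultimately have "\<mu> * (W x0)\<^sup>2 + (p x0)\<^sup>2 / C x0 = 0"
    using DERIV_unique by blast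
  moreover have "(p x0)\<^sup>2 / C x0 \<ge> 0" using x0 by simp
  moreover have "\<mu> * (W x0)\<^sup>2 \<ge> 0" using lam by simp
  ultimately have "\<mu> * (W x0)\<^sup>2 = 0" by linarith
  then show ?thesis using lam by simp
qed

text \<open>Transfers almost everywhere statements between continuous functions to all points.\<close>

lemma closed_full_measure_UNIV:
  fixes S :: "real set"
  assumes "closed S" "AE x in lborel. x \<in> S"
  shows "x \<in> S"
proof (rule ccontr)
  assume "x \<notin> S"
  then have "x \<in> - S" "open (- S)" using assms(1) by auto
  then obtain e where e: "e > 0" "ball x e \<subseteq> - S"
    using open_contains_ball by blast
  have "AE y in lborel. y \<notin> ball x e"
    using assms(2) by eventually_elim (use e(2) in blast)
  then have "ball x e \<in> null_sets lborel"
    by (subst AE_iff_null_sets) auto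
  then have "emeasure lborel {x - e<..<x + e} = 0"
    by (auto simp: ball_eq_greaterThanLessThan)
  then show False using e(1) by simp
qed

text \<open>A primitive is differentiable at every point where its integrand agrees, up to null sets, with a
  function continuous at that point.\<close>

lemma primitive_DERIV:
  assumes F: "primitive F f"
    and near: "\<And>e. e > 0 \<Longrightarrow> \<exists>d>0. AE s in lborel. \<bar>s - x\<bar> < d \<longrightarrow> \<bar>f s - l\<bar> \<le> e"
  shows "(F has_real_derivative l) (at x)"
proof -
  have lin: "primitive (\<lambda>x. (- l) * x) (\<lambda>x. - l)"
    by (auto intro!: primitive_C1 derivative_eq_intros)
  have G: "primitive (\<lambda>s. F s + (- l) * s) (\<lambda>s. f s + - l)"
    by (rule primitive_add[OF F lin])
  show ?thesis
    unfolding DERIV_def LIM_eq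
  proof (intro allI impI)
    fix r :: real assume "r > 0"
    then have r2: "r / 2 > 0" by simp
    then obtain d where d: "d > 0" "AE s in lborel. \<bar>s - x\<bar> < d \<longrightarrow> \<bar>f s - l\<bar> \<le> r / 2"
      using near by blast
    have est: "\<bar>(F b + (- l) * b) - (F a + (- l) * a)\<bar> \<le> r / 2 * (b - a)"
      if "a \<le> b" "\<bar>a - x\<bar> < d" "\<bar>b - x\<bar> < d" for a b
    proof (rule primitive_bound[OF G that(1)])
      show "AE s in lborel. s \<in> {a..b} \<longrightarrow> \<bar>f s + - l\<bar> \<le> r / 2"
        using d(2) by eventually_elim (use that in auto)
    qed
    have "norm ((F (x + h) - F x) / h - l) < r" if h: "h \<noteq> 0" "\<bar>h\<bar> < d" for h
    proof -
      have "\<bar>F (x + h) - F x - l * h\<bar> \<le> r / 2 * \<bar>h\<bar>"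
      proof (cases "h > 0")
        case True
        then show ?thesis using est[of x "x + h"] h d(1) by (simp add: algebra_simps)
      next
        case False
        then show ?thesis using est[of "x + h" x] h d(1) by (simp add: algebra_simps abs_minus_commute)
      qed
      moreover have "(F (x + h) - F x) / h - l = (F (x + h) - F x - l * h) / h"
        using h by (simp add: field_simps)
      ultimately have "norm ((F (x + h) - F x) / h - l) \<le> r / 2"
        using h by (simp add: abs_divide pos_divide_le_eq)
      then show ?thesis using \<open>r > 0\<close> by simp
    qed
    then show "\<exists>s>0. \<forall>h. h \<noteq> 0 \<and> norm (h - 0) < s \<longrightarrow> norm ((F (x + h) - F x) / h - l) < r"
      using d(1) by (intro exI[of _ d]) auto
  qed
qed

lemma no_lower_bound_if_integrable:
  fixes w :: "real \<Rightarrow> real"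
  assumes int: "integrable lborel (\<lambda>x. (w x)\<^sup>2)" and d: "d > 0"
    and sub: "\<And>n::nat. \<exists>a. {a..a + real n} \<subseteq> S" and ge: "AE x in lborel. x \<in> S \<longrightarrow> d \<le> (w x)\<^sup>2"
  shows False
proof -
  define I where "I = (\<integral>x. (w x)\<^sup>2 \<partial>lborel)"
  obtain n :: nat where n: "I / d < real n" using reals_Archimedean2 by blast
  obtain a where a: "{a..a + real n} \<subseteq> S" using sub by blast
  have "d * real n = (\<integral>x. indicator {a..a + real n} x *\<^sub>R d \<partial>lborel)"
    by simp
  also have "\<dots> \<le> I"
    unfolding I_def
  proof (rule integral_mono_AE[OF _ int])
    show "integrable lborel (\<lambda>x. indicator {a..a + real n} x *\<^sub>R d)"
      by (simp add: integrable_scaleR_left)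
    show "AE x in lborel. indicator {a..a + real n} x *\<^sub>R d \<le> (w x)\<^sup>2"
      using ge by eventually_elim (use a in \<open>auto simp: indicator_def\<close>)
  qed
  finally show False using n d by (simp add: pos_divide_less_eq mult.commute)
qed

text \<open>The equation is given in its weakest form, with all derivatives on the test function. Two
  integrations by parts show that \<open>c w\<close> agrees almost everywhere with a locally Lipschitz function \<open>Q\<close>
  whose derivative is \<open>w c' + p\<close>, where \<open>p' = \<mu> w\<close>. On \<open>{c > 0}\<close> this makes \<open>W = Q / c\<close> a classical
  solution with flux \<open>p\<close>, to which the monotonicity of \<open>p W\<close> applies; on \<open>{c = 0}\<close> the
  derivatives of \<open>c\<close>, \<open>Q\<close> and \<open>p\<close> vanish in turn.\<close>

theorem bounded_solution_zero:
  fixes c g w :: "real \<Rightarrow> real"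
  assumes c_weak: "has_weak_derivative c g" and c_Linf: "Linf_loc c" and g: "Linf_loc g"
    and c_nonneg: "AE x in lborel. 0 \<le> c x"
    and w_meas: "w \<in> borel_measurable borel" and w_bound: "\<And>x. \<bar>w x\<bar> \<le> M"
    and w_int: "integrable lborel (\<lambda>x. (w x)\<^sup>2)"
    and lam: "\<mu> > 0"
    and eq: "\<And>\<psi>. test_function \<psi> \<Longrightarrow>
      (\<integral>x. (g x * deriv \<psi> x + c x * deriv (deriv \<psi>) x) * w x \<partial>lborel) = \<mu> * (\<integral>x. \<psi> x * w x \<partial>lborel)"
  shows "AE x in lborel. w x = 0"
proof -
  have w: "Linf_loc w"
    by (rule Linf_locI[OF w_meas]) (use w_bound in blast)
  obtain C where C: "primitive C g" "AE x in lborel. c x = C x"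
    using weak_derivative_primitive[OF c_weak g] by blast
  have C_cont: "continuous_on UNIV C" by (rule primitive_continuous[OF C(1) g])
  have C_nonneg: "0 \<le> C x" for x
  proof -
    have "closed {x. 0 \<le> C x}" by (intro closed_Collect_le continuous_on_const C_cont)
    moreover have "AE x in lborel. x \<in> {x. 0 \<le> C x}"
      using c_nonneg C(2) by eventually_elim simp
    ultimately show ?thesis using closed_full_measure_UNIV by blast
  qed
  have \<mu>w: "Linf_loc (\<lambda>x. \<mu> * w x)"
    by (intro Linf_loc_mult w Linf_loc_continuous continuous_intros)
  obtain P where P: "primitive P (\<lambda>x. \<mu> * w x)"
    using primitive_exists[OF Linf_loc_locally_integrable[OF \<mu>w]] by blast
  have P_cont: "continuous_on UNIV P" by (rule primitive_continuous[OF P \<mu>w])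
  have wgP: "Linf_loc (\<lambda>x. w x * g x + P x)"
    by (intro Linf_loc_add Linf_loc_mult w g Linf_loc_continuous P_cont)
  obtain A where A: "primitive A (\<lambda>x. w x * g x + P x)"
    using primitive_exists[OF Linf_loc_locally_integrable[OF wgP]] by blast
  have A_cont: "continuous_on UNIV A" by (rule primitive_continuous[OF A wgP])
  have cw: "Linf_loc (\<lambda>x. c x * w x)" by (intro Linf_loc_mult c_Linf w)
  have wg: "Linf_loc (\<lambda>x. w x * g x)" by (intro Linf_loc_mult w g)
  obtain a b where ab: "AE x in lborel. c x * w x + (-1) * A x = a + b * x"
  proof (rule affine_if_second_weak_derivative_0)
    show li: "locally_integrable (\<lambda>x. c x * w x + (-1) * A x)"
      by (intro locally_integrable_add locally_integrable_cmult Linf_loc_locally_integrable cw Linf_loc_continuous A_cont)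
    fix \<psi> :: "real \<Rightarrow> real" assume \<psi>: "test_function \<psi>"
    note \<psi>1 = test_function_deriv[OF \<psi>] and \<psi>2 = test_function_deriv[OF test_function_deriv[OF \<psi>]]
    note int = integrable_test_times_locally_integrable
    have i: "integrable lborel (\<lambda>x. deriv (deriv \<psi>) x * (c x * w x))"
      "integrable lborel (\<lambda>x. deriv (deriv \<psi>) x * A x)"
      "integrable lborel (\<lambda>x. deriv \<psi> x * (w x * g x))"
      "integrable lborel (\<lambda>x. deriv \<psi> x * P x)"
      using int[OF \<psi>2 Linf_loc_locally_integrable[OF cw]]
        int[OF \<psi>2 locally_integrable_continuous[OF A_cont]]
        int[OF \<psi>1 Linf_loc_locally_integrable[OF wg]]
        int[OF \<psi>1 locally_integrable_continuous[OF P_cont]] by simp_all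
    have 1: "(\<integral>x. deriv \<psi> x * (w x * g x) \<partial>lborel) + (\<integral>x. deriv (deriv \<psi>) x * (c x * w x) \<partial>lborel)
        = \<mu> * (\<integral>x. \<psi> x * w x \<partial>lborel)"
      unfolding eq[OF \<psi>, symmetric] Bochner_Integration.integral_add[OF i(3,1), symmetric]
      by (intro Bochner_Integration.integral_cong) (simp_all add: algebra_simps)
    have 2: "(\<integral>x. deriv \<psi> x * P x \<partial>lborel) = - (\<mu> * (\<integral>x. \<psi> x * w x \<partial>lborel))"
    proof -
      have "(\<integral>x. deriv \<psi> x * P x \<partial>lborel) = - (\<integral>x. \<psi> x * (\<mu> * w x) \<partial>lborel)"
        by (rule integration_by_parts[OF P \<mu>w \<psi>])
      also have "(\<integral>x. \<psi> x * (\<mu> * w x) \<partial>lborel) = (\<integral>x. \<mu> * (\<psi> x * w x) \<partial>lborel)"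
        by (intro Bochner_Integration.integral_cong) (simp_all add: algebra_simps)
      finally show ?thesis by simp
    qed
    have 3: "(\<integral>x. deriv (deriv \<psi>) x * A x \<partial>lborel)
        = - ((\<integral>x. deriv \<psi> x * (w x * g x) \<partial>lborel) + (\<integral>x. deriv \<psi> x * P x \<partial>lborel))"
      unfolding integration_by_parts[OF A wgP \<psi>1] Bochner_Integration.integral_add[OF i(3,4), symmetric]
      by (simp add: distrib_left)
    have "(\<integral>x. deriv (deriv \<psi>) x * (c x * w x + (-1) * A x) \<partial>lborel)
        = (\<integral>x. deriv (deriv \<psi>) x * (c x * w x) - deriv (deriv \<psi>) x * A x \<partial>lborel)"
      by (intro Bochner_Integration.integral_cong) (simp_all add: algebra_simps)
    also have "\<dots> = (\<integral>x. deriv (deriv \<psi>) x * (c x * w x) \<partial>lborel) - (\<integral>x. deriv (deriv \<psi>) x * A x \<partial>lborel)"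
      by (rule Bochner_Integration.integral_diff[OF i(1,2)])
    also have "\<dots> = 0" using 1 2 3 by simp
    finally show "(\<integral>x. deriv (deriv \<psi>) x * (c x * w x + (-1) * A x) \<partial>lborel) = 0" .
  qed
  \<comment> \<open>The slope \<open>b\<close> is the constant of integration that makes \<open>p\<close> the flux.\<close>
  define p where "p x = P x + b" for x
  define Q where "Q x = A x + (a + b * x)" for x
  have p: "primitive p (\<lambda>x. \<mu> * w x)"
    using primitive_add[OF P primitive_const[of b]] by (simp add: p_def[abs_def])
  have p_cont: "continuous_on UNIV p" by (rule primitive_continuous[OF p \<mu>w])
  have Q: "primitive Q (\<lambda>x. w x * g x + p x)"
  proof -
    have "primitive (\<lambda>x. a + b * x) (\<lambda>x. b)"
      by (auto intro!: primitive_C1 derivative_eq_intros)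
    from primitive_add[OF A this] show ?thesis by (simp add: Q_def[abs_def] p_def[abs_def] add.assoc)
  qed
  have Q_Linf: "Linf_loc (\<lambda>x. w x * g x + p x)"
    by (intro Linf_loc_add wg Linf_loc_continuous p_cont)
  have Q_cont: "continuous_on UNIV Q" by (rule primitive_continuous[OF Q Q_Linf])
  have Q_eq: "AE x in lborel. Q x = C x * w x"
    using ab C(2) by eventually_elim (simp add: Q_def)
  have Q_bound: "\<bar>Q x\<bar> \<le> M * C x" for x
  proof -
    have "closed {x. \<bar>Q x\<bar> \<le> M * C x}"
      by (intro closed_Collect_le continuous_intros Q_cont C_cont)
    moreover have "AE x in lborel. x \<in> {x. \<bar>Q x\<bar> \<le> M * C x}"
      using Q_eq
    proof eventually_elim
      case (elim x)
      then show ?case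
        using mult_right_mono[OF w_bound[of x] C_nonneg[of x]] C_nonneg[of x] by (simp add: abs_mult mult.commute)
    qed
    ultimately show ?thesis using closed_full_measure_UNIV by blast
  qed
  define W where "W x = Q x / C x" for x
  have W_eq: "AE x in lborel. C x > 0 \<longrightarrow> w x = W x"
    using Q_eq by eventually_elim (simp add: W_def)
  have W_cont: "isCont W x" if "C x > 0" for x
    unfolding W_def using Q_cont C_cont that
    by (intro continuous_intros) (auto simp: continuous_on_eq_continuous_at)
  have W_near: "\<exists>d>0. \<forall>s. \<bar>s - x\<bar> < d \<longrightarrow> C s > 0 \<and> \<bar>W s - W x\<bar> < e \<and> \<bar>p s - p x\<bar> < e"
    if x: "C x > 0" and e: "e > 0" for x e
  proof -
    have "isCont C x" "isCont p x" using C_cont p_cont by (auto simp: continuous_on_eq_continuous_at)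
    then have "\<forall>\<^sub>F s in nhds x. C s > 0 \<and> dist (W s) (W x) < e \<and> dist (p s) (p x) < e"
      using W_cont[OF x] x e
      by (intro eventually_conj order_tendstoD(1)[of C "C x"] tendstoD) (auto simp: isCont_def tendsto_at_iff_tendsto_nhds)
    then show ?thesis
      unfolding eventually_nhds_metric dist_real_def by blast
  qed
  have p': "(p has_real_derivative \<mu> * W x) (at x)" if x: "C x > 0" for x
  proof (rule primitive_DERIV[OF p])
    fix e :: real assume e: "e > 0"
    then have "e / \<mu> > 0" using lam by simp
    from W_near[OF x this] obtain d where d: "d > 0" "\<forall>s. \<bar>s - x\<bar> < d \<longrightarrow> C s > 0 \<and> \<bar>W s - W x\<bar> < e / \<mu>"
      by blast
    have "AE s in lborel. \<bar>s - x\<bar> < d \<longrightarrow> \<bar>\<mu> * w s - \<mu> * W x\<bar> \<le> e"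
      using W_eq
    proof eventually_elim
      case (elim s)
      show ?case
      proof
        assume s: "\<bar>s - x\<bar> < d"
        then have "\<bar>w s - W x\<bar> < e / \<mu>" using elim d(2) by simp
        then have "\<mu> * \<bar>w s - W x\<bar> \<le> e" using lam by (simp add: field_simps)
        then show "\<bar>\<mu> * w s - \<mu> * W x\<bar> \<le> e"
          using lam by (simp add: right_diff_distrib[symmetric] abs_mult)
      qed
    qed
    then show "\<exists>d>0. AE s in lborel. \<bar>s - x\<bar> < d \<longrightarrow> \<bar>\<mu> * w s - \<mu> * W x\<bar> \<le> e"
      using d(1) by blast
  qed
  have W': "(W has_real_derivative p x / C x) (at x)" if x: "C x > 0" for x
  proof -
    \<comment> \<open>The numerator of \<open>W s - W x\<close>. It is differentiable at \<open>x\<close> although \<open>C\<close> and \<open>Q\<close> separately need not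
      be: the contributions of \<open>g\<close> cancel up to a factor \<open>W s - W x\<close>, which is small near \<open>x\<close>.\<close>
    define \<Psi> where "\<Psi> s = C x * Q s + (- Q x) * C s" for s
    have \<Psi>: "primitive \<Psi> (\<lambda>s. C x * (w s * g s + p s) + (- Q x) * g s)"
      unfolding \<Psi>_def[abs_def] by (intro primitive_add primitive_cmult Q C)
    have "(\<Psi> has_real_derivative C x * p x) (at x)"
    proof (rule primitive_DERIV[OF \<Psi>])
      fix e :: real assume e: "e > 0"
      obtain L where L: "L > 0" "AE s in lborel. s \<in> {x-1..x+1} \<longrightarrow> \<bar>g s\<bar> \<le> L"
        using Linf_loc_bound[OF g] by blast
      define e' where "e' = e / (C x * (L + 1))"
      have e': "e' > 0" using e x L(1) by (simp add: e'_def)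
      obtain d where d: "d > 0" "\<forall>s. \<bar>s - x\<bar> < d \<longrightarrow> C s > 0 \<and> \<bar>W s - W x\<bar> < e' \<and> \<bar>p s - p x\<bar> < e'"
        using W_near[OF x e'] by blast
      have "AE s in lborel. \<bar>s - x\<bar> < min d 1 \<longrightarrow> \<bar>C x * (w s * g s + p s) + (- Q x) * g s - C x * p x\<bar> \<le> e"
        using W_eq L(2)
      proof eventually_elim
        case (elim s)
        show ?case
        proof
          assume s: "\<bar>s - x\<bar> < min d 1"
          then have ws: "w s = W s" and near: "\<bar>W s - W x\<bar> < e'" "\<bar>p s - p x\<bar> < e'"
            using elim(1) d(2) by simp_all
          have gs: "\<bar>g s\<bar> \<le> L" using elim(2) s by (auto simp: abs_le_iff abs_less_iff)
          have "C x * (w s * g s + p s) + (- Q x) * g s - C x * p x = C x * ((p s - p x) + g s * (W s - W x))"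
            using x by (simp add: ws W_def algebra_simps)
          also have "\<bar>\<dots>\<bar> = C x * \<bar>(p s - p x) + g s * (W s - W x)\<bar>"
            using x by (simp add: abs_mult)
          also have "\<dots> \<le> C x * (e' + L * e')"
          proof (rule mult_left_mono)
            have "\<bar>g s * (W s - W x)\<bar> \<le> L * e'"
              unfolding abs_mult using gs near(1) L(1) by (intro mult_mono) auto
            then show "\<bar>(p s - p x) + g s * (W s - W x)\<bar> \<le> e' + L * e'"
              using near(2) by linarith
          qed (use x in simp)
          also have "\<dots> = e' * (C x * (L + 1))" by (simp add: algebra_simps)
          also have "\<dots> = e" using x L(1) by (simp add: e'_def)
          finally show "\<bar>C x * (w s * g s + p s) + (- Q x) * g s - C x * p x\<bar> \<le> e" .
        qed
      qed
      then show "\<exists>d>0. AE s in lborel. \<bar>s - x\<bar> < d \<longrightarrow> \<bar>C x * (w s * g s + p s) + (- Q x) * g s - C x * p x\<bar> \<le> e"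
        using d(1) by (intro exI[of _ "min d 1"]) simp
    qed
    moreover have "\<Psi> x = 0" by (simp add: \<Psi>_def)
    ultimately have lim1: "(\<lambda>h. \<Psi> (x + h) / h) \<midarrow>0\<rightarrow> C x * p x"
      by (simp add: DERIV_def)
    have "isCont C x" using C_cont by (auto simp: continuous_on_eq_continuous_at)
    then have C_lim: "(\<lambda>h. C (x + h)) \<midarrow>0\<rightarrow> C x" by (simp add: isCont_iff)
    have "(\<lambda>h. \<Psi> (x + h) / h / (C x * C (x + h))) \<midarrow>0\<rightarrow> C x * p x / (C x * C x)"
      using x by (intro tendsto_divide lim1 tendsto_mult tendsto_const C_lim) auto
    moreover have "C x * p x / (C x * C x) = p x / C x" using x by simp
    moreover have "\<forall>\<^sub>F h in at 0. \<Psi> (x + h) / h / (C x * C (x + h)) = (W (x + h) - W x) / h"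
    proof -
      have "\<forall>\<^sub>F h in at 0. C (x + h) > 0"
        using order_tendstoD(1)[OF C_lim x] .
      then show ?thesis
      proof eventually_elim
        case (elim h)
        have "\<Psi> (x + h) / (C x * C (x + h)) = W (x + h) - W x"
          using x elim by (simp add: \<Psi>_def W_def field_simps)
        then show ?case by (metis divide_divide_eq_left mult.commute)
      qed
    qed
    ultimately show ?thesis
      unfolding DERIV_def by (simp add: Lim_transform_eventually)
  qed
  have W_bound: "\<bar>W x\<bar> \<le> M" if "C x > 0" for x
    using Q_bound[of x] that by (simp add: W_def abs_divide pos_divide_le_eq)
  have C_Lip: "\<exists>L>0. \<forall>x\<in>{a..b}. \<forall>y\<in>{a..b}. \<bar>C y - C x\<bar> \<le> L * \<bar>y - x\<bar>" for a b
    using primitive_Lipschitz[OF C(1) g] by metis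
  have escape: False if "d > 0" "\<And>n::nat. \<exists>a. {a..a + real n} \<subseteq> S" "\<And>x. x \<in> S \<Longrightarrow> C x > 0 \<and> d \<le> (W x)\<^sup>2" for d S
  proof (rule no_lower_bound_if_integrable[OF w_int that(1,2)])
    show "AE x in lborel. x \<in> S \<longrightarrow> d \<le> (w x)\<^sup>2"
      using W_eq by eventually_elim (use that(3) in auto)
  qed
  have W0: "W x = 0" if "C x > 0" for x
  proof (rule flux_zero[OF lam C_cont C_nonneg C_Lip p' W' W_bound _ _ that])
    fix a d :: real assume d: "d > 0" and pos: "\<And>x. x \<ge> a \<Longrightarrow> C x > 0"
    show "\<exists>x\<ge>a. (W x)\<^sup>2 < d"
    proof (rule ccontr)
      assume "\<not> ?thesis"
      then have "C x > 0 \<and> d \<le> (W x)\<^sup>2" if "x \<in> {a..}" for x using that pos by force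
      moreover have "\<exists>a'. {a'..a' + real n} \<subseteq> {a..}" for n by (intro exI[of _ a]) auto
      ultimately show False using escape[OF d] by blast
    qed
  next
    fix a d :: real assume d: "d > 0" and pos: "\<And>x. x \<le> a \<Longrightarrow> C x > 0"
    show "\<exists>x\<le>a. (W x)\<^sup>2 < d"
    proof (rule ccontr)
      assume "\<not> ?thesis"
      then have "C x > 0 \<and> d \<le> (W x)\<^sup>2" if "x \<in> {..a}" for x using that pos by force
      moreover have "\<exists>a'. {a'..a' + real n} \<subseteq> {..a}" for n by (intro exI[of _ "a - real n"]) auto
      ultimately show False using escape[OF d] by blast
    qed
  qed
  have "AE x in lborel. C x = 0 \<longrightarrow> g x = 0" by (rule primitive_zero_set[OF C(1)])
  moreover have "AE x in lborel. Q x = 0 \<longrightarrow> w x * g x + p x = 0" by (rule primitive_zero_set[OF Q])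
  moreover have "AE x in lborel. p x = 0 \<longrightarrow> \<mu> * w x = 0" by (rule primitive_zero_set[OF p])
  ultimately show ?thesis
    using W_eq
  proof eventually_elim
    case (elim x)
    show ?case
    proof (cases "C x > 0")
      case True
      then show ?thesis using elim(4) W0 by simp
    next
      case False
      then have "C x = 0" using C_nonneg[of x] by simp
      then have "Q x = 0" using Q_bound[of x] by simp
      then show ?thesis using elim(1-3) \<open>C x = 0\<close> lam by simp
    qed
  qed
qed

section \<open>Truncation and square-integrable test functions\<close>

text \<open>The antiderivative of a bump function close to the indicator of the unit interval.\<close>

lemma smooth_truncation_real:
  assumes e: "e > 0"
  obtains N N' :: "real \<Rightarrow> real" where "smooth N" "\<And>x. (N has_real_derivative N' x) (at x)"
    "\<And>x. 0 \<le> N' x \<and> N' x \<le> 1" "N 0 = 0" "\<And>x. \<bar>N x - min 1 (max 0 x)\<bar> \<le> e"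
proof -
  have "(\<lambda>n. \<integral>x. bump (real (Suc n)) 0 1 x * 1 \<partial>lborel) \<longlonglongrightarrow> (LINT x:{0<..<1::real}|lborel. 1::real)"
    by (intro integral_bump_tendsto locally_integrable_continuous) auto
  then have lim: "(\<lambda>n. \<integral>x. bump (real (Suc n)) 0 1 x \<partial>lborel) \<longlonglongrightarrow> 1"
    by (simp add: set_lebesgue_integral_def)
  have "\<forall>\<^sub>F n in sequentially. 1 - e < (\<integral>x. bump (real (Suc n)) 0 1 x \<partial>lborel)"
    by (rule order_tendstoD(1)[OF lim]) (use e in simp)
  then obtain n where n: "1 - e < (\<integral>x. bump (real (Suc n)) 0 1 x \<partial>lborel)"
    using eventually_happens'[OF sequentially_bot] by blast
  define \<beta> where "\<beta> = bump (real (Suc n)) 0 1"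
  have \<beta>: "smooth \<beta>" "\<And>x. 0 \<le> \<beta> x" "\<And>x. \<beta> x \<le> 1" "\<And>x. x \<notin> {0<..<1} \<Longrightarrow> \<beta> x = 0"
    unfolding \<beta>_def using smooth_bump bump_bounds bump_outside[of "real (Suc n)" _ 0 1] by (auto simp del: of_nat_Suc)
  have "\<exists>F. \<forall>x. -\<infinity> < ereal x \<longrightarrow> ereal x < \<infinity> \<longrightarrow> (F has_vector_derivative \<beta> x) (at x)"
    using smooth_continuous[OF \<beta>(1), of UNIV]
    by (intro einterval_antiderivative) (auto simp: continuous_on_eq_continuous_at)
  then obtain F where F: "\<And>x. (F has_vector_derivative \<beta> x) (at x)" by auto
  define N where "N x = F x - F 0" for x
  have N: "(N has_vector_derivative \<beta> x) (at x)" for x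
    unfolding N_def[abs_def] using F[of x] by (auto intro!: derivative_eq_intros)
  then have NR: "(N has_real_derivative \<beta> x) (at x)" for x
    by (simp add: has_real_derivative_iff_has_vector_derivative)
  have prim: "primitive N \<beta>"
    by (rule primitive_C1[OF NR smooth_continuous[OF \<beta>(1)]])
  have const: "N b = N a" if "a \<le> b" "\<And>x. x \<in> {a..b} \<Longrightarrow> \<beta> x = 0" for a b
    using primitive_bound[OF prim that(1), of 0] that(2) by simp
  have N0: "N 0 = 0" by (simp add: N_def)
  have left: "N x = 0" if "x \<le> 0" for x
    using const[OF that] \<beta>(4) N0 by simp
  have right: "N x = N 1" if "1 \<le> x" for x
    using const[OF that] \<beta>(4) by simp
  have "N 1 - N 0 = (\<integral>x. \<beta> x \<partial>lborel)"
    using prim integral_eq_set_integral[of "{0..1}" \<beta>] \<beta>(4) by (force simp: primitive_def)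
  then have N1: "1 - e < N 1"
    using n N0 by (simp add: \<beta>_def)
  have diff: "a - N a \<le> b - N b" if "a \<le> b" for a b
    by (rule DERIV_nonneg_imp_nondecreasing[OF that])
       (use NR \<beta>(3) in \<open>auto intro!: exI[of _ "1 - \<beta> _"] derivative_eq_intros\<close>)
  have "\<bar>N x - min 1 (max 0 x)\<bar> \<le> e" for x
  proof -
    consider "x \<le> 0" | "0 \<le> x" "x \<le> 1" | "1 \<le> x" by linarith
    then show ?thesis
    proof cases
      case 1 then show ?thesis using left e by simp
    next
      case 2
      then show ?thesis using diff[OF 2(1)] diff[OF 2(2)] N0 N1 by simp
    next
      case 3
      then show ?thesis using diff[of 0 1] right[OF 3] N0 N1 by simp
    qed
  qed
  then show thesis
    using that[of N \<beta>] smoothI_derivative[OF \<beta>(1) N] NR \<beta>(2,3) N0 by blast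
qed

lemma square_integrable_Linf_test:
  fixes \<phi> :: "real \<Rightarrow> complex"
  assumes b: "Linf_loc b" and \<phi>: "test_function \<phi>"
  shows "square_integrable (\<lambda>x. of_real (b x) * \<phi> x)"
proof -
  have [measurable]: "b \<in> borel_measurable borel" "\<phi> \<in> borel_measurable borel"
    using Linf_loc_measurable[OF b] test_function_measurable[OF \<phi>] by auto
  obtain R where R: "R > 0" "\<And>x. \<bar>x\<bar> \<ge> R \<Longrightarrow> \<phi> x = 0" using test_function_support[OF \<phi>] by blast
  obtain B where B: "B > 0" "\<And>x. norm (\<phi> x) \<le> B" using test_function_bounded[OF \<phi>] by blast
  obtain L where L: "L > 0" "AE x in lborel. x \<in> {-R..R} \<longrightarrow> \<bar>b x\<bar> \<le> L" using Linf_loc_bound[OF b] by blast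
  have "integrable lborel (\<lambda>x. (norm (of_real (b x) * \<phi> x))\<^sup>2)"
  proof (rule Bochner_Integration.integrable_bound)
    show "integrable lborel (\<lambda>x. indicator {-R..R} x *\<^sub>R (L * B)\<^sup>2)"
      using R(1) by (simp add: integrable_scaleR_left)
    show "AE x in lborel. norm ((norm (of_real (b x) * \<phi> x))\<^sup>2) \<le> norm (indicator {-R..R} x *\<^sub>R (L * B)\<^sup>2)"
      using L(2)
    proof eventually_elim
      case (elim x)
      show ?case
      proof (cases "x \<in> {-R..R}")
        case True
        then have "norm (of_real (b x) * \<phi> x) \<le> L * B"
          unfolding norm_mult norm_of_real using elim B L(1) by (intro mult_mono) auto
        then show ?thesis using True by (simp add: power_mono)
      next
        case False
        then have "\<phi> x = 0" using R(2) by auto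
        then show ?thesis by simp
      qed
    qed
  qed measurable
  then show ?thesis by (simp add: square_integrable_def)
qed

lemma square_integrable_real_test:
  fixes \<phi> :: "real \<Rightarrow> real"
  assumes b: "Linf_loc b" and \<phi>: "test_function \<phi>"
  shows "square_integrable (\<lambda>x. of_real (b x * \<phi> x))"
  using square_integrable_Linf_test[OF b test_function_linear[OF bounded_linear_of_real \<phi>]] by simp

lemma square_integrable_test:
  fixes \<phi> :: "real \<Rightarrow> complex"
  assumes "test_function \<phi>"
  shows "square_integrable \<phi>"
  using square_integrable_Linf_test[OF Linf_loc_continuous[OF continuous_on_const[of _ 1]] assms] by simp

lemma square_integrable_locally_integrable:
  assumes f: "square_integrable f"
  shows "locally_integrable f"
proof (rule locally_integrableI)
  fix R :: real assume R: "R > 0"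
  have [measurable]: "f \<in> borel_measurable borel" using f by (simp add: square_integrable_def)
  show "set_integrable lborel {-R..R} f"
    unfolding set_integrable_def
  proof (rule Bochner_Integration.integrable_bound)
    show "integrable lborel (\<lambda>x. indicator {-R..R} x *\<^sub>R 1 + (norm (f x))\<^sup>2)"
      using f R by (intro Bochner_Integration.integrable_add) (auto simp: square_integrable_def integrable_scaleR_left)
    have "norm (indicator {-R..R} x *\<^sub>R f x) \<le> norm (indicator {-R..R} x *\<^sub>R 1 + (norm (f x))\<^sup>2)" for x
    proof -
      have "norm (f x) \<le> 1 + (norm (f x))\<^sup>2"
        using sum_squares_bound[of "norm (f x)" 1] by (smt (verit) norm_ge_zero mult_1_right one_power2)
      then show ?thesis by (auto simp: indicator_def)
    qed
    then show "AE x in lborel. norm (indicator {-R..R} x *\<^sub>R f x) \<le> norm (indicator {-R..R} x *\<^sub>R 1 + (norm (f x))\<^sup>2)"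
      by (intro AE_I2)
  qed measurable
qed

lemma locally_integrable_linear:
  fixes f :: "real \<Rightarrow> 'a::{banach,second_countable_topology}"
    and L :: "'a \<Rightarrow> 'b::{banach,second_countable_topology}"
  assumes "bounded_linear L" "locally_integrable f"
  shows "locally_integrable (\<lambda>x. L (f x))"
  unfolding locally_integrable_def set_integrable_def
proof (intro allI impI)
  fix A :: "real set" assume "compact A"
  then have "integrable lborel (\<lambda>x. indicator A x *\<^sub>R f x)"
    using assms(2) by (simp add: locally_integrable_def set_integrable_def)
  then have "integrable lborel (\<lambda>x. L (indicator A x *\<^sub>R f x))"
    by (rule integrable_bounded_linear[OF assms(1)])
  then show "integrable lborel (\<lambda>x. indicator A x *\<^sub>R L (f x))"
    by (simp add: linear_cmul bounded_linear.linear[OF assms(1)])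
qed

text \<open>By the fundamental lemma applied to the real and imaginary parts separately.\<close>

lemma orthogonal_to_test_functions:
  assumes orth: "\<And>\<phi>. test_function \<phi> \<Longrightarrow> inner (abs_L2 \<phi>) u = 0"
  shows "u = 0"
proof -
  define f where "f = rep_L2 u"
  have f: "square_integrable f" and uf: "u = abs_L2 f"
    by (simp_all add: f_def square_integrable_rep_L2 abs_rep_L2)
  have zero: "AE x in lborel. inner z (f x) = 0" for z
  proof (rule fundamental_lemma)
    show "locally_integrable (\<lambda>x. inner z (f x))"
      by (intro locally_integrable_linear[OF bounded_linear_inner_right] square_integrable_locally_integrable f)
    fix \<psi> :: "real \<Rightarrow> real" assume \<psi>: "test_function \<psi>"
    have t: "test_function (\<lambda>x. \<psi> x *\<^sub>R z)"
      by (rule test_function_linear[OF bounded_linear_scaleR_left \<psi>])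
    from orth[OF t] have "(\<integral>x. inner (\<psi> x *\<^sub>R z) (f x) \<partial>lborel) = 0"
      unfolding uf inner_abs_L2[OF square_integrable_test[OF t] f] .
    then show "(\<integral>x. \<psi> x * inner z (f x) \<partial>lborel) = 0" by simp
  qed
  have "AE x in lborel. f x = 0"
    using zero[of 1] zero[of \<i>] by eventually_elim (simp add: inner_complex_def complex_eq_iff)
  then have "abs_L2 f = abs_L2 (\<lambda>x. 0)"
    by (intro abs_L2_eqI f square_integrable_zero)
  then show ?thesis by (simp add: uf zero_L2_def)
qed

text \<open>The truncation of a test function is not smooth. A smooth function \<open>N\<close> with \<open>0 \<le> N' \<le> 1\<close> that is
  uniformly close to the truncation gives a test function with no larger gradient, and it is close
  in \<open>L\<^sup>2\<close> because both functions vanish outside the support of \<open>\<phi>\<close>.\<close>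

lemma test_function_truncation:
  fixes \<phi> :: "real \<Rightarrow> complex"
  assumes \<phi>: "test_function \<phi>" and e: "e > 0"
  obtains \<psi> :: "real \<Rightarrow> complex" where "test_function \<psi>"
    "\<And>x. norm (vector_derivative \<psi> (at x)) \<le> norm (vector_derivative \<phi> (at x))"
    "square_integrable (\<lambda>x. clamp01 (\<phi> x))"
    "norm (abs_L2 \<psi> - abs_L2 (\<lambda>x. clamp01 (\<phi> x))) \<le> e"
proof -
  obtain R where R: "R > 0" "\<And>x. \<bar>x\<bar> \<ge> R \<Longrightarrow> \<phi> x = 0" using test_function_support[OF \<phi>] by blast
  \<comment> \<open>a uniform bound \<open>e'\<close> on \<open>{-R..R}\<close> gives the bound \<open>e' sqrt (2 R)\<close> for the norm in \<open>L\<^sup>2\<close>\<close>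
  define e' where "e' = e / sqrt (2 * R)"
  have e': "e' > 0" using e R(1) by (simp add: e'_def)
  obtain N N' :: "real \<Rightarrow> real" where N: "smooth N" "\<And>x. (N has_real_derivative N' x) (at x)"
    "\<And>x. 0 \<le> N' x \<and> N' x \<le> 1" "N 0 = 0" "\<And>x. \<bar>N x - min 1 (max 0 x)\<bar> \<le> e'"
    using smooth_truncation_real[OF e'] by blast
  have Re\<phi>: "test_function (\<lambda>x. Re (\<phi> x))"
    by (rule test_function_linear[OF bounded_linear_Re \<phi>])
  define \<psi> where "\<psi> x = complex_of_real (N (Re (\<phi> x)))" for x
  have real: "test_function (\<lambda>x. N (Re (\<phi> x)))"
  proof (rule test_functionI)
    show "smooth (\<lambda>x. N (Re (\<phi> x)))" by (rule smooth_compose[OF N(1) test_function_smooth[OF Re\<phi>]])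
    show "N (Re (\<phi> x)) = 0" if "R \<le> \<bar>x\<bar>" for x using R(2)[OF that] N(4) by simp
  qed
  have \<psi>: "test_function \<psi>"
    unfolding \<psi>_def[abs_def] by (rule test_function_linear[OF bounded_linear_of_real real])
  have der: "norm (vector_derivative \<psi> (at x)) \<le> norm (vector_derivative \<phi> (at x))" for x
  proof -
    let ?d = "vector_derivative \<phi> (at x)"
    have "(\<phi> has_vector_derivative ?d) (at x)"
      by (rule smooth_has_derivative[OF test_function_smooth[OF \<phi>]])
    then have "((\<lambda>x. Re (\<phi> x)) has_real_derivative Re ?d) (at x)"
      using bounded_linear.has_vector_derivative[OF bounded_linear_Re]
      by (simp add: has_real_derivative_iff_has_vector_derivative)
    from DERIV_chain2[OF N(2) this]
    have "((\<lambda>x. N (Re (\<phi> x))) has_vector_derivative N' (Re (\<phi> x)) * Re ?d) (at x)"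
      by (simp add: has_real_derivative_iff_has_vector_derivative)
    from bounded_linear.has_vector_derivative[OF bounded_linear_of_real this]
    have "vector_derivative \<psi> (at x) = complex_of_real (N' (Re (\<phi> x)) * Re ?d)"
      unfolding \<psi>_def[abs_def] by (rule vector_derivative_at)
    then have "norm (vector_derivative \<psi> (at x)) = N' (Re (\<phi> x)) * \<bar>Re ?d\<bar>"
      using N(3)[of "Re (\<phi> x)"] by (simp add: abs_mult del: of_real_mult)
    also have "\<dots> \<le> 1 * \<bar>Re ?d\<bar>"
      using N(3) by (intro mult_right_mono) auto
    also have "\<dots> \<le> norm ?d" using abs_Re_le_cmod by simp
    finally show ?thesis .
  qed
  have [measurable]: "\<phi> \<in> borel_measurable borel" "\<psi> \<in> borel_measurable borel"
    using test_function_measurable \<phi> \<psi> by auto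
  have clamp: "square_integrable (\<lambda>x. clamp01 (\<phi> x))"
  proof (rule square_integrable_bound[OF square_integrable_test[OF \<phi>]])
    have "norm (clamp01 (\<phi> x)) \<le> norm (\<phi> x)" for x
    proof -
      have "norm (clamp01 (\<phi> x) - 0) \<le> norm (\<phi> x - 0)"
        by (rule clamp01_dist_le) (unfold complex_between_0_1, simp)
      then show ?thesis by simp
    qed
    then show "AE x in lborel. norm (clamp01 (\<phi> x)) \<le> norm (\<phi> x)" by (intro AE_I2)
  qed measurable
  have d: "square_integrable (\<lambda>x. \<psi> x - clamp01 (\<phi> x))"
    by (intro square_integrable_diff square_integrable_test \<psi> clamp)
  have "(norm (abs_L2 (\<lambda>x. \<psi> x - clamp01 (\<phi> x))))\<^sup>2 \<le> (\<integral>x. indicator {-R..R} x *\<^sub>R e'\<^sup>2 \<partial>lborel)"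
    unfolding norm_abs_L2[OF d]
  proof (rule integral_mono)
    show "integrable lborel (\<lambda>x. (norm (\<psi> x - clamp01 (\<phi> x)))\<^sup>2)"
      using d by (simp add: square_integrable_def)
    show "integrable lborel (\<lambda>x. indicator {-R..R} x *\<^sub>R e'\<^sup>2)"
      using R(1) by (simp add: integrable_scaleR_left)
    fix x :: real
    show "(norm (\<psi> x - clamp01 (\<phi> x)))\<^sup>2 \<le> indicator {-R..R} x *\<^sub>R e'\<^sup>2"
    proof (cases "x \<in> {-R..R}")
      case True
      have "norm (\<psi> x - clamp01 (\<phi> x)) \<le> e'"
        unfolding \<psi>_def clamp01_def of_real_diff[symmetric] norm_of_real by (rule N(5))
      then show ?thesis using True by (simp add: power_mono)
    next
      case False
      then have "\<phi> x = 0" using R(2) by auto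
      then show ?thesis using N(4) by (simp add: \<psi>_def clamp01_def)
    qed
  qed
  also have "\<dots> = e\<^sup>2"
    using R(1) by (simp add: e'_def power_divide)
  finally have "norm (abs_L2 (\<lambda>x. \<psi> x - clamp01 (\<phi> x))) \<le> e"
    using e by (rule power2_le_imp_le[OF _ less_imp_le])
  then have "norm (abs_L2 \<psi> - abs_L2 (\<lambda>x. clamp01 (\<phi> x))) \<le> e"
    unfolding abs_L2_diff[OF square_integrable_test[OF \<psi>] clamp] .
  then show thesis using that \<psi> der clamp by blast
qed

section \<open>The Friedrichs extension is submarkovian\<close>

lemma Linf_loc_sqrt:
  assumes "Linf_loc c"
  shows "Linf_loc (\<lambda>x. sqrt (c x))"
proof (rule Linf_locI)
  show "(\<lambda>x. sqrt (c x)) \<in> borel_measurable borel"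
    using Linf_loc_measurable[OF assms] by measurable
  fix R :: real
  obtain L where "AE x in lborel. x \<in> {-R..R} \<longrightarrow> \<bar>c x\<bar> \<le> L" using Linf_loc_bound[OF assms] by blast
  moreover have "\<bar>sqrt y\<bar> = sqrt \<bar>y\<bar>" for y :: real
    by (simp add: abs_if real_sqrt_minus)
  ultimately have "AE x in lborel. x \<in> {-R..R} \<longrightarrow> \<bar>sqrt (c x)\<bar> \<le> sqrt L"
    by (auto elim!: eventually_mono)
  then show "\<exists>B. AE x in lborel. x \<in> {-R..R} \<longrightarrow> \<bar>sqrt (c x)\<bar> \<le> B" ..
qed

text \<open>With the factor \<open>\<surd>c\<close> the inner product of two gradients is the form \<open>\<integral> c \<phi>' \<psi>'\<close>.\<close>

definition gradient :: "(real \<Rightarrow> real) \<Rightarrow> (real \<Rightarrow> complex) \<Rightarrow> L2" where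
  "gradient c \<phi> = abs_L2 (\<lambda>x. of_real (sqrt (c x)) * vector_derivative \<phi> (at x))"

definition form_graph :: "(real \<Rightarrow> real) \<Rightarrow> (L2 \<times> L2) set" where
  "form_graph c = closure {(abs_L2 \<phi>, gradient c \<phi>) | \<phi>. test_function \<phi>}"

lemma form_graph_core: "test_function \<phi> \<Longrightarrow> (abs_L2 \<phi>, gradient c \<phi>) \<in> form_graph c"
  unfolding form_graph_def by (rule subsetD[OF closure_subset]) blast

context
  fixes c :: "real \<Rightarrow> real"
  assumes c: "Linf_loc c"
begin

lemma square_integrable_gradient:
  "test_function \<phi> \<Longrightarrow> square_integrable (\<lambda>x. of_real (sqrt (c x)) * vector_derivative \<phi> (at x))"
  by (intro square_integrable_Linf_test Linf_loc_sqrt c test_function_derivative)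

lemma gradient_add:
  assumes "test_function \<phi>" "test_function \<psi>"
  shows "gradient c (\<lambda>x. \<phi> x + \<psi> x) = gradient c \<phi> + gradient c \<psi>"
proof -
  have "vector_derivative (\<lambda>x. \<phi> x + \<psi> x) (at x) = vector_derivative \<phi> (at x) + vector_derivative \<psi> (at x)" for x
    by (intro vector_derivative_at has_vector_derivative_add smooth_has_derivative test_function_smooth assms)
  then show ?thesis
    unfolding gradient_def abs_L2_add[OF square_integrable_gradient[OF assms(1)] square_integrable_gradient[OF assms(2)]]
    by (simp add: distrib_left)
qed

lemma gradient_scale:
  assumes "test_function \<phi>"
  shows "gradient c (\<lambda>x. a * \<phi> x) = scaleC_L2 a (gradient c \<phi>)"
proof -
  have "vector_derivative (\<lambda>x. a * \<phi> x) (at x) = a * vector_derivative \<phi> (at x)" for x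
    by (intro vector_derivative_at bounded_linear.has_vector_derivative[OF bounded_linear_mult_right]
        smooth_has_derivative test_function_smooth assms)
  then show ?thesis
    unfolding gradient_def abs_L2_scaleC[OF square_integrable_gradient[OF assms]]
    by (simp add: mult.left_commute)
qed

lemma form_graph_scaleC:
  assumes "(u, g) \<in> form_graph c"
  shows "(scaleC_L2 a u, scaleC_L2 a g) \<in> form_graph c"
proof -
  define f where "f = (\<lambda>p. (scaleC_L2 a (fst p), scaleC_L2 a (snd p)))"
  let ?G = "{(abs_L2 \<phi>, gradient c \<phi>) | \<phi>. test_function \<phi>}"
  have "continuous_on UNIV f"
    unfolding f_def
    by (intro continuous_on_Pair continuous_on_compose2[OF linear_continuous_on[OF bounded_linear_scaleC]]
        continuous_intros) auto
  moreover have "f ` ?G \<subseteq> closure ?G"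
  proof -
    have "f p \<in> ?G" if p: "p \<in> ?G" for p
    proof -
      obtain \<phi> where \<phi>: "test_function \<phi>" "p = (abs_L2 \<phi>, gradient c \<phi>)" using p by blast
      have "test_function (\<lambda>x. a * \<phi> x)"
        by (rule test_function_linear[OF bounded_linear_mult_right \<phi>(1)])
      moreover have "f p = (abs_L2 (\<lambda>x. a * \<phi> x), gradient c (\<lambda>x. a * \<phi> x))"
        by (simp add: f_def \<phi>(2) gradient_scale[OF \<phi>(1)] abs_L2_scaleC[OF square_integrable_test[OF \<phi>(1)]])
      ultimately show ?thesis by blast
    qed
    then show ?thesis using closure_subset by blast
  qed
  ultimately have "f ` closure ?G \<subseteq> closure ?G"
    by (intro image_closure_subset) (auto intro: continuous_on_subset)
  then show ?thesis
    using assms unfolding form_graph_def f_def by fastforce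
qed

lemma subspace_form_graph: "subspace (form_graph c)"
  unfolding form_graph_def
proof (rule subspace_closure_normed, rule subspaceI)
  let ?G = "{(abs_L2 \<phi>, gradient c \<phi>) | \<phi>. test_function \<phi>}"
  show zero: "0 \<in> ?G"
  proof -
    have t: "test_function (\<lambda>x. 0 :: complex)"
      by (rule test_functionI[OF smooth_const]) simp
    have "(0, 0) = (abs_L2 (\<lambda>x. 0), gradient c (\<lambda>x. 0))"
      by (simp add: gradient_def zero_L2_def)
    then show ?thesis using t unfolding zero_prod_def by blast
  qed
  fix x assume "x \<in> ?G"
  then obtain \<phi> where \<phi>: "test_function \<phi>" "x = (abs_L2 \<phi>, gradient c \<phi>)" by blast
  {
    fix y assume "y \<in> ?G"
    then obtain \<psi> where \<psi>: "test_function \<psi>" "y = (abs_L2 \<psi>, gradient c \<psi>)" by blast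
    have "x + y = (abs_L2 (\<lambda>x. \<phi> x + \<psi> x), gradient c (\<lambda>x. \<phi> x + \<psi> x))"
      using \<phi> \<psi> by (simp add: gradient_add abs_L2_add square_integrable_test)
    then show "x + y \<in> ?G" using test_function_add[OF \<phi>(1) \<psi>(1)] by blast
  }
  fix r :: real
  have "test_function (\<lambda>x. of_real r * \<phi> x)"
    by (rule test_function_linear[OF bounded_linear_mult_right \<phi>(1)])
  moreover have "r *\<^sub>R x = (abs_L2 (\<lambda>x. of_real r * \<phi> x), gradient c (\<lambda>x. of_real r * \<phi> x))"
    using \<phi> by (simp add: gradient_scale scaleC_of_real abs_L2_scaleR square_integrable_test scaleR_conv_of_real)
  ultimately show "r *\<^sub>R x \<in> ?G" by blast
qed

lemma dense_form_graph: "closure (Domain (form_graph c)) = UNIV"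
proof (rule dense_subspace_if_no_orthogonal)
  show "subspace (Domain (form_graph c))"
    unfolding Domain_fst by (rule linear_subspace_image[OF linear_fst subspace_form_graph])
  fix x assume orth: "\<And>m. m \<in> Domain (form_graph c) \<Longrightarrow> inner m x = 0"
  show "x = 0"
  proof (rule orthogonal_to_test_functions)
    fix \<phi> :: "real \<Rightarrow> complex" assume "test_function \<phi>"
    then show "inner (abs_L2 \<phi>) x = 0"
      using orth[OF DomainI[OF form_graph_core]] by blast
  qed
qed

abbreviation Friedrichs :: "L2_op" where
  "Friedrichs \<equiv> form_op (form_graph c)"

interpretation K: symmetric_accretive_op Friedrichs
  by (rule symmetric_accretive_form_op[OF _ subspace_form_graph dense_form_graph])
     (simp add: form_graph_def)

lemma Friedrichs_scaleC:
  assumes "(u, v) \<in> Friedrichs"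
  shows "(scaleC_L2 z u, scaleC_L2 z v) \<in> Friedrichs"
proof -
  obtain g where g: "(u, g) \<in> form_graph c" "\<And>a b. (a, b) \<in> form_graph c \<Longrightarrow> inner b g = inner a v"
    using assms unfolding form_op_def by blast
  have adj: "inner b (scaleC_L2 z x) = inner (scaleC_L2 (cnj z) b) x" for b x
  proof -
    obtain f h where "square_integrable f" "b = abs_L2 f" "square_integrable h" "x = abs_L2 h"
      using L2_cases by metis
    then show ?thesis
      by (simp add: abs_L2_scaleC inner_abs_L2 square_integrable_scale inner_complex_def algebra_simps)
  qed
  have "inner b (scaleC_L2 z g) = inner a (scaleC_L2 z v)" if "(a, b) \<in> form_graph c" for a b
    unfolding adj by (rule g(2)[OF form_graph_scaleC[OF that]])
  then show ?thesis
    using form_graph_scaleC[OF g(1)] form_opI by blast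
qed

lemma J_scaleC: "h > 0 \<Longrightarrow> K.J h (scaleC_L2 z f) = scaleC_L2 z (K.J h f)"
  using K.J_unique[OF _ Friedrichs_scaleC[OF K.J_in_K], of h h z f]
  by (simp add: scaleC_scaleR scaleC_diff)

lemma S_scaleC: "K.S t (scaleC_L2 z f) = scaleC_L2 z (K.S t f)"
proof (cases "t \<le> 0")
  case False
  then have t: "t > 0" by simp
  have E: "K.E k t (scaleC_L2 z f) = scaleC_L2 z (K.E k t f)" for k
  proof -
    have "(K.J (t / 2 ^ k) ^^ n) (scaleC_L2 z f) = scaleC_L2 z ((K.J (t / 2 ^ k) ^^ n) f)" for n
      by (induction n) (use t J_scaleC in auto)
    then show ?thesis unfolding K.E_def .
  qed
  show ?thesis
  proof (rule LIMSEQ_unique)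
    show "(\<lambda>k. K.E k t (scaleC_L2 z f)) \<longlonglongrightarrow> K.S t (scaleC_L2 z f)"
      by (rule K.E_tendsto_S[OF t])
    show "(\<lambda>k. K.E k t (scaleC_L2 z f)) \<longlonglongrightarrow> scaleC_L2 z (K.S t f)"
      unfolding E by (rule bounded_linear.tendsto[OF bounded_linear_scaleC K.E_tendsto_S[OF t]])
  qed
qed (simp add: K.S_def)

text \<open>Let \<open>\<phi> n\<close> be test functions approximating the minimiser. Their truncations \<open>y n\<close> are at least as
  close to \<open>f\<close>, and the smooth versions \<open>\<psi> n\<close> of these have no larger gradients; so the \<open>\<psi> n\<close> are again
  a minimising sequence. By the completed square they converge to the minimiser, and then so do
  the \<open>y n\<close>.\<close>

lemma J_between_0_1:
  assumes h: "h > 0" and f: "between_0_1 f"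
  shows "between_0_1 (K.J h f)"
proof -
  define u where "u = K.J h f"
  obtain g where ug: "(u, g) \<in> form_graph c"
    and el: "\<And>a b. (a, b) \<in> form_graph c \<Longrightarrow> inner b g = inner a ((f - u) /\<^sub>R h)"
    using K.J_in_K[OF h, of f] unfolding form_op_def u_def by blast
  obtain X where X: "\<And>n::nat. X n \<in> {(abs_L2 \<phi>, gradient c \<phi>) | \<phi>. test_function \<phi>}" "X \<longlonglongrightarrow> (u, g)"
    using ug unfolding form_graph_def closure_sequential by blast
  have "\<exists>\<phi>. test_function \<phi> \<and> X n = (abs_L2 \<phi>, gradient c \<phi>)" for n using X(1)[of n] by blast
  then obtain \<phi> where \<phi>: "\<And>n. test_function (\<phi> n)" "\<And>n. X n = (abs_L2 (\<phi> n), gradient c (\<phi> n))"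
    by metis
  have lim: "(\<lambda>n. abs_L2 (\<phi> n)) \<longlonglongrightarrow> u" "(\<lambda>n. gradient c (\<phi> n)) \<longlonglongrightarrow> g"
    using tendsto_fst[OF X(2)] tendsto_snd[OF X(2)] by (simp_all add: \<phi>(2))
  define y where "y n = abs_L2 (\<lambda>x. clamp01 (\<phi> n x))" for n
  have "\<exists>\<psi> :: real \<Rightarrow> complex. test_function \<psi> \<and>
      (\<forall>x. norm (vector_derivative \<psi> (at x)) \<le> norm (vector_derivative (\<phi> n) (at x))) \<and>
      square_integrable (\<lambda>x. clamp01 (\<phi> n x)) \<and> norm (abs_L2 \<psi> - y n) \<le> inverse (Suc n)" for n
    unfolding y_def using test_function_truncation[OF \<phi>(1), of "inverse (Suc n)" n] by (metis inverse_positive_iff_positive of_nat_0_less_iff zero_less_Suc)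
  then obtain \<psi> :: "nat \<Rightarrow> real \<Rightarrow> complex" where \<psi>: "\<And>n. test_function (\<psi> n)"
    "\<And>n x. norm (vector_derivative (\<psi> n) (at x)) \<le> norm (vector_derivative (\<phi> n) (at x))"
    "\<And>n. square_integrable (\<lambda>x. clamp01 (\<phi> n x))" "\<And>n. norm (abs_L2 (\<psi> n) - y n) \<le> inverse (Suc n)"
    by metis
  have y01: "between_0_1 (y n)" for n
    unfolding y_def between_0_1_abs[OF \<psi>(3)] using clamp01_between by simp
  have yf: "norm (y n - f) \<le> norm (abs_L2 (\<phi> n) - f)" for n
  proof -
    note sf = square_integrable_rep_L2[of f] and s\<phi> = square_integrable_test[OF \<phi>(1)]
    have "norm (abs_L2 (\<lambda>x. clamp01 (\<phi> n x)) - abs_L2 (rep_L2 f)) \<le> norm (abs_L2 (\<phi> n) - abs_L2 (rep_L2 f))"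
      unfolding abs_L2_diff[OF \<psi>(3) sf] abs_L2_diff[OF s\<phi> sf]
    proof (rule norm_abs_L2_mono)
      show "AE x in lborel. norm (clamp01 (\<phi> n x) - rep_L2 f x) \<le> norm (\<phi> n x - rep_L2 f x)"
        using f[unfolded between_0_1_rep] by eventually_elim (rule clamp01_dist_le)
    qed (intro square_integrable_diff \<psi> sf s\<phi>)+
    then show ?thesis unfolding y_def abs_rep_L2 .
  qed
  have grad_le: "norm (gradient c (\<psi> n)) \<le> norm (gradient c (\<phi> n))" for n
    unfolding gradient_def
    by (intro norm_abs_L2_mono square_integrable_gradient \<psi> \<phi> AE_I2)
       (auto simp: norm_mult intro!: mult_left_mono \<psi>)
  define m where "m = (norm (u - f))\<^sup>2 + h * (norm g)\<^sup>2"
  have upper: "(norm (abs_L2 (\<psi> n) - u))\<^sup>2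
      \<le> (norm (abs_L2 (\<phi> n) - f) + inverse (Suc n))\<^sup>2 + h * (norm (gradient c (\<phi> n)))\<^sup>2 - m" for n
  proof -
    have mem: "(abs_L2 (\<psi> n), gradient c (\<psi> n)) \<in> form_graph c"
      by (rule form_graph_core[OF \<psi>(1)])
    have "norm (abs_L2 (\<psi> n) - f) \<le> norm (abs_L2 (\<phi> n) - f) + inverse (Suc n)"
      using norm_triangle_ineq[of "abs_L2 (\<psi> n) - y n" "y n - f"] \<psi>(4)[of n] yf[of n] by simp
    then have "(norm (abs_L2 (\<psi> n) - f))\<^sup>2 \<le> (norm (abs_L2 (\<phi> n) - f) + inverse (Suc n))\<^sup>2"
      by (rule power_mono) simp
    moreover have "h * (norm (gradient c (\<psi> n)))\<^sup>2 \<le> h * (norm (gradient c (\<phi> n)))\<^sup>2"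
      using h grad_le by (intro mult_left_mono power_mono) auto
    moreover have "0 \<le> h * (norm (gradient c (\<psi> n) - g))\<^sup>2" using h by simp
    ultimately show ?thesis
      using form_op_variational[OF subspace_form_graph h ug el mem] unfolding m_def by linarith
  qed
  have "(\<lambda>n. (norm (abs_L2 (\<phi> n) - f) + inverse (Suc n))\<^sup>2 + h * (norm (gradient c (\<phi> n)))\<^sup>2 - m)
      \<longlonglongrightarrow> (norm (u - f) + 0)\<^sup>2 + h * (norm g)\<^sup>2 - m"
    by (intro tendsto_intros lim LIMSEQ_inverse_real_of_nat)
  then have zero: "(\<lambda>n. (norm (abs_L2 (\<phi> n) - f) + inverse (Suc n))\<^sup>2 + h * (norm (gradient c (\<phi> n)))\<^sup>2 - m) \<longlonglongrightarrow> 0"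
    by (simp add: m_def)
  have "(\<lambda>n. (norm (abs_L2 (\<psi> n) - u))\<^sup>2) \<longlonglongrightarrow> 0"
    by (rule tendsto_sandwich[OF _ _ tendsto_const zero]) (use upper in auto)
  from tendsto_real_sqrt[OF this] have "(\<lambda>n. norm (abs_L2 (\<psi> n) - u)) \<longlonglongrightarrow> 0"
    by simp
  then have \<psi>u: "(\<lambda>n. abs_L2 (\<psi> n) - u) \<longlonglongrightarrow> 0" by (rule tendsto_norm_zero_cancel)
  have "(\<lambda>n. y n - abs_L2 (\<psi> n)) \<longlonglongrightarrow> 0"
    by (rule Lim_null_comparison[OF _ LIMSEQ_inverse_real_of_nat])
       (use \<psi>(4) in \<open>auto simp: norm_minus_commute\<close>)
  from tendsto_add[OF this \<psi>u] have "(\<lambda>n. y n - u) \<longlonglongrightarrow> 0" by simp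
  then have "y \<longlonglongrightarrow> u" by (rule LIM_zero_cancel)
  from between_0_1_closed[OF y01 this] show ?thesis unfolding u_def .
qed

lemma submarkovian_S: "submarkovian K.S"
  unfolding submarkovian_def
proof (intro allI impI)
  fix t :: real and u assume t: "t > 0" and u: "between_0_1 u"
  have "between_0_1 ((K.J (t / 2 ^ k) ^^ n) u)" for n k
    by (induction n) (use u t J_between_0_1 in auto)
  then have "between_0_1 (K.E k t u)" for k unfolding K.E_def .
  then show "between_0_1 (K.S t u)"
    by (rule between_0_1_closed[OF _ K.E_tendsto_S[OF t]])
qed

lemma generates_S: "generates Friedrichs K.S"
  unfolding generates_def C0_semigroup_def
proof (intro conjI allI impI)
  show "bounded_linear (K.S t)" for t by (rule K.S_bounded_linear)
  show "K.S t (scaleC_L2 a u) = scaleC_L2 a (K.S t u)" for t a u by (rule S_scaleC)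
  show "K.S 0 u = u" for u by (simp add: K.S_def)
  show "K.S (s + t) u = K.S s (K.S t u)" if "0 \<le> s" "0 \<le> t" for s t u
  proof (cases "s = 0 \<or> t = 0")
    case True
    then show ?thesis by (auto simp: K.S_def)
  next
    case False
    then show ?thesis using that K.S_semigroup by simp
  qed
  show "((\<lambda>t. K.S t u) \<longlongrightarrow> u) (at_right 0)" for u by (rule K.S_continuous)
  show "Friedrichs = {(u, v). ((\<lambda>t. (K.S t u - u) /\<^sub>R t) \<longlongrightarrow> - v) (at_right 0)}"
    using K.S_generator K.generator_subset_K by blast
qed

lemma self_adjoint_Friedrichs: "self_adjoint_op Friedrichs"
  unfolding self_adjoint_op_def
proof (intro conjI)
  show "linear_op Friedrichs"
    unfolding linear_op_def
  proof (intro conjI)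
    show "single_valued Friedrichs"
    proof (rule single_valuedI)
      fix u v v' assume "(u, v) \<in> Friedrichs" "(u, v') \<in> Friedrichs"
      then have "(0, v - v') \<in> Friedrichs" using K.K_diff by fastforce
      then show "v = v'" using form_op_zero[OF dense_form_graph] by fastforce
    qed
    show "(0, 0) \<in> Friedrichs"
      using K.J_in_K[of 1 0] K.J_contraction[of 1 0] by simp
  qed (use K.K_add Friedrichs_scaleC in auto)
  show "closure (Domain Friedrichs) = UNIV" by (rule K.K_dense)
  show "adjoint_op Friedrichs = Friedrichs"
  proof (intro set_eqI, clarify)
    fix f g
    have "(f, g) \<in> adjoint_op Friedrichs \<longleftrightarrow> (\<forall>(u, v)\<in>Friedrichs. inner v f = inner u g)"
      by (rule adjoint_op_real) (rule Friedrichs_scaleC)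
    also have "\<dots> \<longleftrightarrow> (f, g) \<in> Friedrichs"
      using K.K_symmetric K.K_maximal by blast
    finally show "(f, g) \<in> adjoint_op Friedrichs \<longleftrightarrow> (f, g) \<in> Friedrichs" .
  qed
qed

lemma lower_semibounded_Friedrichs: "lower_semibounded Friedrichs"
  unfolding lower_semibounded_def
proof (intro exI[of _ 0] ballI, clarify)
  fix u v assume "(u, v) \<in> Friedrichs"
  then show "0 * (norm u)\<^sup>2 \<le> Re (cinner_L2 v u)"
    using K.K_accretive by (simp add: Re_cinner inner_commute)
qed

text \<open>The definition of the weak derivative, applied to the real and imaginary parts of a complex test
  function, is the form identity on the core; it extends to the closure by continuity.\<close>

lemma divergence_form_op_subset_Friedrichs:
  assumes nonneg: "AE x in lborel. 0 \<le> c x"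
  shows "divergence_form_op c \<subseteq> Friedrichs"
proof
  fix p assume "p \<in> divergence_form_op c"
  then obtain \<phi> v where p: "p = (abs_L2 \<phi>, v)" and \<phi>: "test_function \<phi>"
    and weak: "has_weak_derivative (\<lambda>x. c x *\<^sub>R vector_derivative \<phi> (at x)) (\<lambda>x. - rep_L2 v x)"
    unfolding divergence_form_op_def by blast
  define F where "F x = c x *\<^sub>R vector_derivative \<phi> (at x)" for x
  have F: "locally_integrable F" and v: "locally_integrable (rep_L2 v)"
    and eq: "\<And>\<psi> :: real \<Rightarrow> real. test_function \<psi> \<Longrightarrow>
      (\<integral>x. deriv \<psi> x *\<^sub>R F x \<partial>lborel) = (\<integral>x. \<psi> x *\<^sub>R rep_L2 v x \<partial>lborel)"
    using weak locally_integrable_linear[OF bounded_linear_minus[OF bounded_linear_ident], of "\<lambda>x. - rep_L2 v x"]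
    unfolding has_weak_derivative_def F_def by auto
  have part: "(\<integral>x. deriv \<psi> x * L (F x) \<partial>lborel) = (\<integral>x. \<psi> x * L (rep_L2 v x) \<partial>lborel)"
    if \<psi>: "test_function \<psi>" and L: "bounded_linear L" for \<psi> :: "real \<Rightarrow> real" and L :: "complex \<Rightarrow> real"
  proof -
    have lin: "L (r *\<^sub>R z) = r * L z" for r z
      using linear_cmul[OF bounded_linear.linear[OF L]] by simp
    have "(\<integral>x. L (deriv \<psi> x *\<^sub>R F x) \<partial>lborel) = (\<integral>x. L (\<psi> x *\<^sub>R rep_L2 v x) \<partial>lborel)"
      using integral_bounded_linear[OF L integrable_test_times_locally_integrable[OF test_function_deriv[OF \<psi>] F]]
        integral_bounded_linear[OF L integrable_test_times_locally_integrable[OF \<psi> v]] eq[OF \<psi>] by simp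
    then show ?thesis unfolding lin .
  qed
  have core: "inner (gradient c \<psi>) (gradient c \<phi>) = inner (abs_L2 \<psi>) v" if \<psi>: "test_function \<psi>" for \<psi>
  proof -
    have R: "test_function (\<lambda>x. Re (\<psi> x))" and I: "test_function (\<lambda>x. Im (\<psi> x))"
      by (rule test_function_linear[OF bounded_linear_Re \<psi>] test_function_linear[OF bounded_linear_Im \<psi>])+
    have d\<psi>: "(\<psi> has_vector_derivative vector_derivative \<psi> (at x)) (at x)" for x
      by (rule smooth_has_derivative[OF test_function_smooth[OF \<psi>]])
    have dR: "deriv (\<lambda>x. Re (\<psi> x)) x = Re (vector_derivative \<psi> (at x))" for x
      using bounded_linear.has_vector_derivative[OF bounded_linear_Re d\<psi>]
      by (intro DERIV_imp_deriv) (simp add: has_real_derivative_iff_has_vector_derivative)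
    have dI: "deriv (\<lambda>x. Im (\<psi> x)) x = Im (vector_derivative \<psi> (at x))" for x
      using bounded_linear.has_vector_derivative[OF bounded_linear_Im d\<psi>]
      by (intro DERIV_imp_deriv) (simp add: has_real_derivative_iff_has_vector_derivative)
    have iF: "integrable lborel (\<lambda>x. deriv (\<lambda>x. Re (\<psi> x)) x * Re (F x))"
      "integrable lborel (\<lambda>x. deriv (\<lambda>x. Im (\<psi> x)) x * Im (F x))"
      using integrable_test_times_locally_integrable[OF test_function_deriv[OF R] locally_integrable_linear[OF bounded_linear_Re F]]
        integrable_test_times_locally_integrable[OF test_function_deriv[OF I] locally_integrable_linear[OF bounded_linear_Im F]]
      by simp_all
    have iv: "integrable lborel (\<lambda>x. Re (\<psi> x) * Re (rep_L2 v x))"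
      "integrable lborel (\<lambda>x. Im (\<psi> x) * Im (rep_L2 v x))"
      using integrable_test_times_locally_integrable[OF R locally_integrable_linear[OF bounded_linear_Re v]]
        integrable_test_times_locally_integrable[OF I locally_integrable_linear[OF bounded_linear_Im v]]
      by simp_all
    have "inner (gradient c \<psi>) (gradient c \<phi>)
        = (\<integral>x. deriv (\<lambda>x. Re (\<psi> x)) x * Re (F x) + deriv (\<lambda>x. Im (\<psi> x)) x * Im (F x) \<partial>lborel)"
      unfolding gradient_def inner_abs_L2[OF square_integrable_gradient[OF \<psi>] square_integrable_gradient[OF \<phi>]]
    proof (rule integral_cong_AE)
      show "(\<lambda>x. inner (of_real (sqrt (c x)) * vector_derivative \<psi> (at x)) (of_real (sqrt (c x)) * vector_derivative \<phi> (at x))) \<in> borel_measurable lborel"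
        by (rule borel_measurable_integrable[OF square_integrable_inner[OF square_integrable_gradient[OF \<psi>] square_integrable_gradient[OF \<phi>]]])
      show "(\<lambda>x. deriv (\<lambda>x. Re (\<psi> x)) x * Re (F x) + deriv (\<lambda>x. Im (\<psi> x)) x * Im (F x)) \<in> borel_measurable lborel"
        by (rule borel_measurable_integrable[OF Bochner_Integration.integrable_add[OF iF]])
      show "AE x in lborel. inner (of_real (sqrt (c x)) * vector_derivative \<psi> (at x)) (of_real (sqrt (c x)) * vector_derivative \<phi> (at x))
          = deriv (\<lambda>x. Re (\<psi> x)) x * Re (F x) + deriv (\<lambda>x. Im (\<psi> x)) x * Im (F x)"
        using nonneg
      proof eventually_elim
        case (elim x)
        have s: "sqrt (c x) * sqrt (c x) = c x" using elim by simp
        have scale: "inner (of_real r * z) (of_real r * z') = (r * r) * inner z z'" for r and z z' :: complex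
          by (simp add: inner_complex_def algebra_simps)
        show ?case
          unfolding scale s by (simp add: F_def dR dI inner_complex_def algebra_simps)
      qed
    qed
    also have "\<dots> = (\<integral>x. Re (\<psi> x) * Re (rep_L2 v x) \<partial>lborel) + (\<integral>x. Im (\<psi> x) * Im (rep_L2 v x) \<partial>lborel)"
      unfolding Bochner_Integration.integral_add[OF iF] part[OF R bounded_linear_Re] part[OF I bounded_linear_Im] ..
    also have "\<dots> = (\<integral>x. inner (\<psi> x) (rep_L2 v x) \<partial>lborel)"
      unfolding Bochner_Integration.integral_add[OF iv, symmetric] by (simp add: inner_complex_def)
    also have "\<dots> = inner (abs_L2 \<psi>) v"
      using inner_abs_L2[OF square_integrable_test[OF \<psi>] square_integrable_rep_L2[of v]] by (simp add: abs_rep_L2)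
    finally show ?thesis .
  qed
  show "p \<in> Friedrichs"
    unfolding p
  proof (rule form_opI)
    show "(abs_L2 \<phi>, gradient c \<phi>) \<in> form_graph c"
      by (rule form_graph_core[OF \<phi>])
    have "form_graph c \<subseteq> {q. inner (snd q) (gradient c \<phi>) = inner (fst q) v}"
      unfolding form_graph_def
    proof (rule closure_minimal)
      show "closed {q. inner (snd q) (gradient c \<phi>) = inner (fst q) v}"
        by (intro closed_Collect_eq continuous_intros)
    qed (use core in auto)
    then show "inner b (gradient c \<phi>) = inner a v" if "(a, b) \<in> form_graph c" for a b
      using that by fastforce
  qed
qed

theorem submarkovian_extension_Friedrichs:
  assumes "AE x in lborel. 0 \<le> c x"
  shows "submarkovian_extension (divergence_form_op c) Friedrichs"
  unfolding submarkovian_extension_def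
  using divergence_form_op_subset_Friedrichs[OF assms] self_adjoint_Friedrichs lower_semibounded_Friedrichs
    generates_S submarkovian_S by blast

end

section \<open>Resolvents of submarkovian extensions\<close>

text \<open>A bound \<open>B\<close> on an initial time interval of length \<open>\<delta>\<close> is iterated by the semigroup law.\<close>

lemma C0_semigroup_growth:
  assumes S: "C0_semigroup S"
  obtains B \<omega> where "B \<ge> 1" "\<omega> \<ge> 0" "\<And>t u. t \<ge> 0 \<Longrightarrow> norm (S t u) \<le> B * exp (\<omega> * t) * norm u"
proof -
  have lin: "\<And>t. t \<ge> 0 \<Longrightarrow> bounded_linear (S t)" and S0: "\<And>u. S 0 u = u"
    and add: "\<And>s t u. s \<ge> 0 \<Longrightarrow> t \<ge> 0 \<Longrightarrow> S (s + t) u = S s (S t u)"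
    and cont: "\<And>u. ((\<lambda>t. S t u) \<longlongrightarrow> u) (at_right 0)"
    using S unfolding C0_semigroup_def by blast+
  obtain \<delta> B where \<delta>: "\<delta> > 0" and B: "B \<ge> 1" and bd: "\<And>t u. 0 < t \<Longrightarrow> t \<le> \<delta> \<Longrightarrow> norm (S t u) \<le> B * norm u"
    by (rule locally_bounded_if_strongly_continuous_at_0[of S, OF lin cont]) auto
  \<comment> \<open>chosen so that \<open>exp (\<omega> \<delta>) = B\<close>\<close>
  define \<omega> where "\<omega> = ln B / \<delta>"
  have \<omega>: "\<omega> \<ge> 0" using B \<delta> by (simp add: \<omega>_def)
  have eB: "exp (\<omega> * \<delta>) = B" using B \<delta> by (simp add: \<omega>_def)
  have small: "norm (S t u) \<le> B * norm u" if "0 \<le> t" "t \<le> \<delta>" for t u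
    using bd[of t u] that S0 B by (cases "t = 0") (auto intro: mult_right_le_one_le simp: mult_left_le_one_le mult_le_cancel_right1)
  have "norm (S t u) \<le> B * exp (\<omega> * t) * norm u" if "0 \<le> t" "t \<le> real n * \<delta>" for n t u
    using that
  proof (induction n arbitrary: t)
    case 0
    then have "t = 0" by simp
    then show ?case using small[of 0 u] \<delta> by simp
  next
    case (Suc n)
    show ?case
    proof (cases "t \<le> \<delta>")
      case True
      have "norm (S t u) \<le> B * norm u" using small True Suc.prems by simp
      also have "\<dots> \<le> B * exp (\<omega> * t) * norm u"
        using B \<omega> Suc.prems(1) by (intro mult_right_mono) auto
      finally show ?thesis .
    next
      case False
      then have t: "0 \<le> t - \<delta>" "t - \<delta> \<le> real n * \<delta>"
        using Suc.prems by (auto simp: algebra_simps)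
      have "S t u = S \<delta> (S (t - \<delta>) u)"
        using add[of \<delta> "t - \<delta>" u] \<delta> t by simp
      also have "norm \<dots> \<le> B * norm (S (t - \<delta>) u)"
        using small \<delta> by simp
      also have "\<dots> \<le> B * (B * exp (\<omega> * (t - \<delta>)) * norm u)"
        using Suc.IH[OF t] B by (intro mult_left_mono) auto
      also have "B * exp (\<omega> * (t - \<delta>)) = exp (\<omega> * t)"
        using B by (simp add: right_diff_distrib exp_diff eB)
      finally show ?thesis by (simp add: mult.assoc)
    qed
  qed
  moreover have "\<exists>n. t \<le> real n * \<delta>" for t
    using reals_Archimedean3[OF \<delta>] less_imp_le by blast
  ultimately have "norm (S t u) \<le> B * exp (\<omega> * t) * norm u" if "t \<ge> 0" for t u
    using that by blast
  then show thesis using that B \<omega> by blast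
qed

lemma exp_defect_lower_bound:
  fixes a :: real
  assumes "a \<ge> 0"
  shows "a / (1 + a) \<le> 1 - exp (- a)"
proof -
  have "exp (- a) \<le> 1 / (1 + a)"
    unfolding exp_minus inverse_eq_divide using exp_ge_add_one_self[of a] assms
    by (intro divide_left_mono) auto
  moreover have "1 - 1 / (1 + a) = a / (1 + a)"
    using assms by (simp add: field_simps)
  ultimately show ?thesis by simp
qed

lemma closed_between_0_1: "closed {u. between_0_1 u}"
  unfolding closed_sequential_limits using between_0_1_closed by blast

text \<open>If \<open>u = (\<mu> + K)\<^sup>-\<^sup>1 f\<close> then \<open>u\<close> is the Laplace transform \<open>\<integral> exp (- \<mu> t) S t f dt\<close>. The integral is replaced by
  the Riemann sums \<open>\<Sum>k<n. h exp (- \<mu> h k) S (h k) f\<close>, whose weights have a sum bounded uniformly in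
  \<open>n\<close>, applied to functions with values in the unit interval.\<close>

lemma resolvent_between_0_1:
  assumes S: "C0_semigroup S" "submarkovian S"
    and growth: "B \<ge> 1" "\<And>t u. t \<ge> 0 \<Longrightarrow> norm (S t u) \<le> B * exp (\<omega> * t) * norm u"
    and lam: "\<mu> > 0" "\<mu> > \<omega>"
    and gen: "((\<lambda>t. (S t u - u) /\<^sub>R t) \<longlongrightarrow> - (f - \<mu> *\<^sub>R u)) (at_right 0)"
    and f: "between_0_1 f"
  shows "between_0_1 ((\<mu> / (1 + \<mu>)) *\<^sub>R u)"
proof -
  have blin: "\<And>t. t \<ge> 0 \<Longrightarrow> bounded_linear (S t)" and S0: "\<And>u. S 0 u = u"
    and add: "\<And>s t u. s \<ge> 0 \<Longrightarrow> t \<ge> 0 \<Longrightarrow> S (s + t) u = S s (S t u)"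
    and cont: "\<And>u. ((\<lambda>t. S t u) \<longlongrightarrow> u) (at_right 0)"
    using S(1) unfolding C0_semigroup_def by blast+
  have lin: "linear (S t)" if "t \<ge> 0" for t using blin[OF that] bounded_linear.linear by blast
  \<comment> \<open>bounds the total mass \<open>h / (1 - exp (- \<mu> h))\<close> of the weights in the Riemann sums for \<open>h \<le> 1\<close>\<close>
  define \<beta> where "\<beta> = (1 + \<mu>) / \<mu>"
  have \<beta>: "\<beta> > 0" "inverse \<beta> = \<mu> / (1 + \<mu>)" using lam by (simp_all add: \<beta>_def)
  \<comment> \<open>the error in the discrete resolvent equation satisfied by \<open>u\<close>\<close>
  define r where "r h = (u - exp (- \<mu> * h) *\<^sub>R S h u) /\<^sub>R h - f" for h
  \<comment> \<open>the Riemann sum with \<open>n\<close> terms, in Horner form\<close>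
  define g where "g h n = ((\<lambda>y. h *\<^sub>R f + exp (- \<mu> * h) *\<^sub>R S h y) ^^ n) 0" for h and n :: nat
  have r_lim: "(r \<longlongrightarrow> 0) (at_right 0)"
  proof -
    have "((\<lambda>h. (1 - exp (- \<mu> * h)) / h) \<longlongrightarrow> \<mu>) (at_right 0)"
    proof -
      have "((\<lambda>h. exp (- \<mu> * h)) has_real_derivative - \<mu>) (at 0)"
        by (auto intro!: derivative_eq_intros)
      then have "((\<lambda>h. - ((exp (- \<mu> * (0 + h)) - exp (- \<mu> * 0)) / h)) \<longlongrightarrow> - (- \<mu>)) (at 0)"
        unfolding DERIV_def by (rule tendsto_minus)
      then have "((\<lambda>h. (1 - exp (- \<mu> * h)) / h) \<longlongrightarrow> \<mu>) (at 0)"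
        by (simp add: minus_divide_left)
      then show ?thesis by (rule tendsto_within_subset) simp
    qed
    then have "((\<lambda>h. - ((S h u - u) /\<^sub>R h) + ((1 - exp (- \<mu> * h)) / h) *\<^sub>R S h u - f) \<longlongrightarrow>
        - (- (f - \<mu> *\<^sub>R u)) + \<mu> *\<^sub>R u - f) (at_right 0)"
      by (intro tendsto_intros gen cont)
    moreover have "- (- (f - \<mu> *\<^sub>R u)) + \<mu> *\<^sub>R u - f = 0" by simp
    moreover have "- ((S h u - u) /\<^sub>R h) + ((1 - exp (- \<mu> * h)) / h) *\<^sub>R S h u - f = r h" for h
      unfolding r_def by (simp add: divide_inverse algebra_simps)
    ultimately show ?thesis by simp
  qed
  have g_between: "between_0_1 (g h n /\<^sub>R \<beta>)" if h: "h > 0" "h \<le> 1" for h n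
  proof (induction n)
    case 0
    then show ?case by (simp add: g_def between_0_1_zero)
  next
    case (Suc n)
    have "g h (Suc n) /\<^sub>R \<beta> = (h / \<beta>) *\<^sub>R f + exp (- \<mu> * h) *\<^sub>R S h (g h n /\<^sub>R \<beta>)"
      using linear_cmul[OF lin, of h] h by (simp add: g_def scaleR_add_right divide_inverse mult.commute)
    moreover have "between_0_1 \<dots>"
    proof (rule between_0_1_combine[OF f])
      show "between_0_1 (S h (g h n /\<^sub>R \<beta>))"
        using S(2) Suc h by (auto simp: submarkovian_def)
      have "\<mu> * h \<le> \<mu>"
        using h lam by (simp add: mult_left_le)
      then have "h * \<mu> / (1 + \<mu>) \<le> h * \<mu> / (1 + \<mu> * h)"
        using h lam by (intro divide_left_mono mult_pos_pos add_pos_pos) auto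
      then have "h / \<beta> \<le> h * \<mu> / (1 + \<mu> * h)"
        by (simp add: \<beta>_def)
      also have "\<dots> \<le> 1 - exp (- (\<mu> * h))"
        using exp_defect_lower_bound[of "\<mu> * h"] h lam by (simp add: mult.commute)
      finally show "h / \<beta> + exp (- \<mu> * h) \<le> 1" by simp
    qed (use h \<beta> in auto)
    ultimately show ?case by simp
  qed
  have expand: "u - g h n = h *\<^sub>R (\<Sum>k<n. exp (- \<mu> * (h * real k)) *\<^sub>R S (h * real k) (r h))
      + exp (- \<mu> * (h * real n)) *\<^sub>R S (h * real n) u" if h: "h > 0" for h n
  proof (induction n)
    case 0
    then show ?case by (simp add: g_def S0)
  next
    case (Suc n)
    have lh: "linear (S h)" using lin h by simp
    note l = linear_add[OF lh] linear_cmul[OF lh] linear_sum[OF lh] linear_diff[OF lh]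
    have step: "S h (S (h * real k) x) = S (h * real (Suc k)) x" for k x
      using add[of h "h * real k" x] h by (simp add: algebra_simps)
    have e: "exp (- \<mu> * h) * exp (- \<mu> * (h * real k)) = exp (- \<mu> * (h * real (Suc k)))" for k
      by (simp add: exp_add[symmetric] algebra_simps)
    have "h *\<^sub>R r h = u - exp (- \<mu> * h) *\<^sub>R S h u - h *\<^sub>R f"
      using h by (simp add: r_def scaleR_diff_right)
    then have "u - g h (Suc n) = h *\<^sub>R r h + exp (- \<mu> * h) *\<^sub>R S h (u - g h n)"
      by (simp add: g_def l scaleR_diff_right)
    also have "exp (- \<mu> * h) *\<^sub>R S h (u - g h n) =
        h *\<^sub>R (\<Sum>k<n. exp (- \<mu> * (h * real (Suc k))) *\<^sub>R S (h * real (Suc k)) (r h))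
        + exp (- \<mu> * (h * real (Suc n))) *\<^sub>R S (h * real (Suc n)) u"
    proof -
      have "exp (- \<mu> * h) *\<^sub>R h *\<^sub>R (\<Sum>k<n. exp (- \<mu> * (h * real k)) *\<^sub>R Y k)
          = h *\<^sub>R (\<Sum>k<n. exp (- \<mu> * (h * real (Suc k))) *\<^sub>R Y k)" for Y :: "nat \<Rightarrow> L2"
      proof -
        have "exp (- \<mu> * h) *\<^sub>R (\<Sum>k<n. exp (- \<mu> * (h * real k)) *\<^sub>R Y k)
            = (\<Sum>k<n. exp (- \<mu> * (h * real (Suc k))) *\<^sub>R Y k)"
          unfolding scaleR_sum_right by (simp only: scaleR_scaleR e)
        then show ?thesis by (subst scaleR_left_commute) (simp only:)
      qed
      then show ?thesis
        unfolding Suc.IH l step scaleR_add_right by (simp only: scaleR_scaleR[of "exp (- \<mu> * h)" "exp _"] e)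
    qed
    also have "h *\<^sub>R r h + (h *\<^sub>R (\<Sum>k<n. exp (- \<mu> * (h * real (Suc k))) *\<^sub>R S (h * real (Suc k)) (r h))
        + exp (- \<mu> * (h * real (Suc n))) *\<^sub>R S (h * real (Suc n)) u)
      = h *\<^sub>R (\<Sum>k<Suc n. exp (- \<mu> * (h * real k)) *\<^sub>R S (h * real k) (r h))
        + exp (- \<mu> * (h * real (Suc n))) *\<^sub>R S (h * real (Suc n)) u"
      unfolding sum.lessThan_Suc_shift by (simp add: S0 scaleR_add_right)
    finally show ?case .
  qed
  have bound: "norm (u - g h n) \<le> B * (1 + (\<mu> - \<omega>)) / (\<mu> - \<omega>) * norm (r h) + B * norm u * exp (- (\<mu> - \<omega>) * h) ^ n"
    if h: "h > 0" "h \<le> 1" for h n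
  proof -
    define q where "q = exp (- (\<mu> - \<omega>) * h)"
    have q: "0 < q" "q < 1" using mult_neg_pos[of "\<omega> - \<mu>" h] h lam by (simp_all add: q_def)
    have decay: "norm (exp (- \<mu> * (h * real k)) *\<^sub>R S (h * real k) x) \<le> B * norm x * q ^ k" for k x
    proof -
      have "norm (exp (- \<mu> * (h * real k)) *\<^sub>R S (h * real k) x)
          \<le> exp (- \<mu> * (h * real k)) * (B * exp (\<omega> * (h * real k)) * norm x)"
        using growth(2)[of "h * real k" x] h by (simp add: mult_left_mono)
      also have "\<dots> = B * norm x * (exp (- \<mu> * (h * real k)) * exp (\<omega> * (h * real k)))"
        by (simp only: mult_ac)
      also have "exp (- \<mu> * (h * real k)) * exp (\<omega> * (h * real k)) = q ^ k"
        unfolding q_def exp_of_nat_mult[symmetric] exp_add[symmetric] by (simp add: algebra_simps)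
      finally show ?thesis .
    qed
    have geo: "h * (\<Sum>k<n. q ^ k) \<le> (1 + (\<mu> - \<omega>)) / (\<mu> - \<omega>)"
    proof -
      have "(\<Sum>k<n. q ^ k) = (1 - q ^ n) / (1 - q)"
        using q by (simp add: sum_gp_strict)
      also have "\<dots> \<le> 1 / (1 - q)"
        using q by (intro divide_right_mono) auto
      finally have "h * (\<Sum>k<n. q ^ k) \<le> h * (1 / (1 - q))"
        using h by (intro mult_left_mono) auto
      also have "\<dots> = h / (1 - q)" by simp
      also have "\<dots> \<le> h / (((\<mu> - \<omega>) * h) / (1 + (\<mu> - \<omega>) * h))"
      proof (rule divide_left_mono)
        have "0 \<le> (\<mu> - \<omega>) * h" using h lam by simp
        moreover have "exp (- ((\<mu> - \<omega>) * h)) = q" unfolding q_def by (simp only: mult_minus_left)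
        ultimately show "(\<mu> - \<omega>) * h / (1 + (\<mu> - \<omega>) * h) \<le> 1 - q"
          using exp_defect_lower_bound[of "(\<mu> - \<omega>) * h"] by simp
        show "0 < (1 - q) * ((\<mu> - \<omega>) * h / (1 + (\<mu> - \<omega>) * h))"
          using h lam q by (intro mult_pos_pos divide_pos_pos add_pos_pos) auto
      qed (use h in simp)
      also have "\<dots> = (1 + (\<mu> - \<omega>) * h) / (\<mu> - \<omega>)"
        using h lam by (simp add: divide_simps)
      also have "\<dots> \<le> (1 + (\<mu> - \<omega>)) / (\<mu> - \<omega>)"
        using h lam by (intro divide_right_mono) (auto simp: mult_left_le)
      finally show ?thesis .
    qed
    have "norm (u - g h n) \<le> norm (h *\<^sub>R (\<Sum>k<n. exp (- \<mu> * (h * real k)) *\<^sub>R S (h * real k) (r h)))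
        + norm (exp (- \<mu> * (h * real n)) *\<^sub>R S (h * real n) u)"
      unfolding expand[OF h(1)] by (rule norm_triangle_ineq)
    also have "\<dots> \<le> h * (\<Sum>k<n. B * norm (r h) * q ^ k) + B * norm u * q ^ n"
    proof (rule add_mono[OF _ decay])
      have "norm (\<Sum>k<n. exp (- \<mu> * (h * real k)) *\<^sub>R S (h * real k) (r h)) \<le> (\<Sum>k<n. B * norm (r h) * q ^ k)"
        by (intro sum_norm_le decay)
      then show "norm (h *\<^sub>R (\<Sum>k<n. exp (- \<mu> * (h * real k)) *\<^sub>R S (h * real k) (r h)))
          \<le> h * (\<Sum>k<n. B * norm (r h) * q ^ k)"
        using h by (simp add: mult_left_mono)
    qed
    also have "h * (\<Sum>k<n. B * norm (r h) * q ^ k) = B * norm (r h) * (h * (\<Sum>k<n. q ^ k))"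
      by (simp add: sum_distrib_left mult_ac)
    also have "\<dots> \<le> B * norm (r h) * ((1 + (\<mu> - \<omega>)) / (\<mu> - \<omega>))"
      using geo growth(1) by (intro mult_left_mono) auto
    finally show ?thesis unfolding q_def by (simp add: mult_ac)
  qed
  have "\<exists>y\<in>{u. between_0_1 u}. dist y (u /\<^sub>R \<beta>) < e" if e: "e > 0" for e
  proof -
    define c1 where "c1 = B * (1 + (\<mu> - \<omega>)) / (\<mu> - \<omega>)"
    have c1: "c1 > 0" using growth(1) lam by (simp add: c1_def)
    have e2: "e * \<beta> / 2 > 0" using e \<beta> by simp
    then have "e * \<beta> / 2 / c1 > 0" using c1 by simp
    then have "\<forall>\<^sub>F h in at_right 0. dist (r h) 0 < e * \<beta> / 2 / c1"
      using tendstoD[OF r_lim] by blast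
    then obtain b where b: "b > 0" "\<And>h. 0 < h \<Longrightarrow> h < b \<Longrightarrow> norm (r h) < e * \<beta> / 2 / c1"
      by (auto simp: eventually_at_right_field)
    define h where "h = min (b / 2) 1"
    have h: "0 < h" "h < b" "h \<le> 1" using b(1) by (auto simp: h_def)
    have rh: "c1 * norm (r h) < e * \<beta> / 2"
      using b(2)[OF h(1,2)] c1 by (simp add: field_simps)
    have "(\<lambda>n. B * norm u * exp (- (\<mu> - \<omega>) * h) ^ n) \<longlonglongrightarrow> B * norm u * 0"
      by (intro tendsto_mult[OF tendsto_const] LIMSEQ_power_zero)
         (use mult_neg_pos[of "\<omega> - \<mu>" h] h lam in simp)
    then have lim0: "(\<lambda>n. B * norm u * exp (- (\<mu> - \<omega>) * h) ^ n) \<longlonglongrightarrow> 0" by simp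
    from order_tendstoD(2)[OF this e2]
    have "\<forall>\<^sub>F n in sequentially. B * norm u * exp (- (\<mu> - \<omega>) * h) ^ n < e * \<beta> / 2" .
    then obtain n where n: "B * norm u * exp (- (\<mu> - \<omega>) * h) ^ n < e * \<beta> / 2"
      using eventually_happens'[OF sequentially_bot] by blast
    have "norm (u - g h n) < e * \<beta>"
      using bound[OF h(1,3), of n] rh n unfolding c1_def by linarith
    moreover have "dist (g h n /\<^sub>R \<beta>) (u /\<^sub>R \<beta>) = norm (u - g h n) / \<beta>"
      using \<beta>(1) by (simp add: dist_norm scaleR_diff_right[symmetric] norm_minus_commute divide_inverse mult.commute)
    ultimately have "dist (g h n /\<^sub>R \<beta>) (u /\<^sub>R \<beta>) < e"
      using \<beta>(1) by (simp add: pos_divide_less_eq)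
    then show ?thesis using g_between[OF h(1,3)] by blast
  qed
  then have "u /\<^sub>R \<beta> \<in> closure {u. between_0_1 u}"
    unfolding closure_approachable by blast
  then have "between_0_1 (u /\<^sub>R \<beta>)"
    using closed_between_0_1 by simp
  then show ?thesis using \<beta>(2) by simp
qed

lemma linear_op_diff:
  assumes "linear_op K" "(u, v) \<in> K" "(u', v') \<in> K"
  shows "(u - u', v - v') \<in> K"
proof -
  have "(scaleC_L2 (of_real (-1)) u', scaleC_L2 (of_real (-1)) v') \<in> K"
    using assms(1,3) unfolding linear_op_def by blast
  then have "(- u', - v') \<in> K" unfolding scaleC_of_real by simp
  then have "(u + - u', v + - v') \<in> K"
    using assms(1,2) unfolding linear_op_def by blast
  then show ?thesis by simp
qed

lemma closed_self_adjoint_op: "self_adjoint_op K \<Longrightarrow> closed K"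
  using closed_adjoint_op[of K] by (simp add: self_adjoint_op_def)

lemma resolvent_contraction:
  assumes lower: "\<And>u v. (u, v) \<in> K \<Longrightarrow> m * (norm u)\<^sup>2 \<le> Re (cinner_L2 v u)"
    and lam: "\<mu> \<ge> 1 - m" and uf: "(u, f - \<mu> *\<^sub>R u) \<in> K"
  shows "norm u \<le> norm f"
proof -
  have "m * (norm u)\<^sup>2 \<le> inner (f - \<mu> *\<^sub>R u) u"
    using lower[OF uf] by (simp add: Re_cinner)
  also have "\<dots> = inner f u - \<mu> * (norm u)\<^sup>2"
    by (simp add: inner_diff_left power2_norm_eq_inner)
  finally have "(m + \<mu>) * (norm u)\<^sup>2 \<le> inner f u"
    by (simp add: algebra_simps)
  also have "\<dots> \<le> norm f * norm u" by (rule norm_cauchy_schwarz)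
  finally have "(m + \<mu>) * (norm u)\<^sup>2 \<le> norm f * norm u" .
  moreover have "1 * (norm u)\<^sup>2 \<le> (m + \<mu>) * (norm u)\<^sup>2"
    using lam by (intro mult_right_mono) auto
  ultimately have "norm u * norm u \<le> norm f * norm u"
    by (simp add: power2_eq_square)
  then show ?thesis by (cases "u = 0") auto
qed

lemma closed_resolvent_range:
  assumes lin: "\<And>u v u' v'. (u, v) \<in> K \<Longrightarrow> (u', v') \<in> K \<Longrightarrow> (u - u', v - v') \<in> K"
    and closed: "closed K"
    and contr: "\<And>u f. (u, f - \<mu> *\<^sub>R u) \<in> K \<Longrightarrow> norm u \<le> norm f"
  shows "closed {f :: L2. \<exists>u. (u, f - \<mu> *\<^sub>R u) \<in> K}"
  unfolding closed_sequential_limits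
proof (intro allI impI, elim conjE)
  fix F f assume "\<forall>n::nat. F n \<in> {f. \<exists>u. (u, f - \<mu> *\<^sub>R u) \<in> K}" and lim: "F \<longlonglongrightarrow> f"
  then have "\<forall>n. \<exists>u. (u, F n - \<mu> *\<^sub>R u) \<in> K" by simp
  then obtain u where u: "\<forall>n. (u n, F n - \<mu> *\<^sub>R u n) \<in> K"
    by (rule choice[THEN exE])
  have diff: "norm (u n - u k) \<le> norm (F n - F k)" for n k
  proof (rule contr)
    have "(F n - F k) - \<mu> *\<^sub>R (u n - u k) = (F n - \<mu> *\<^sub>R u n) - (F k - \<mu> *\<^sub>R u k)"
      by (simp add: algebra_simps)
    then show "(u n - u k, (F n - F k) - \<mu> *\<^sub>R (u n - u k)) \<in> K"
      using lin[OF u[rule_format, of n] u[rule_format, of k]] by (simp only:)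
  qed
  have "Cauchy u"
    unfolding Cauchy_iff
  proof (intro allI impI)
    fix e :: real assume "e > 0"
    then obtain N where "\<forall>n\<ge>N. \<forall>k\<ge>N. norm (F n - F k) < e"
      using LIMSEQ_imp_Cauchy[OF lim] unfolding Cauchy_iff by blast
    then show "\<exists>N. \<forall>n\<ge>N. \<forall>k\<ge>N. norm (u n - u k) < e"
      using diff le_less_trans by blast
  qed
  then obtain l where l: "u \<longlonglongrightarrow> l"
    using Cauchy_convergent convergent_def by blast
  have "(\<lambda>n. (u n, F n - \<mu> *\<^sub>R u n)) \<longlonglongrightarrow> (l, f - \<mu> *\<^sub>R l)"
    by (intro tendsto_intros l lim)
  then have "(l, f - \<mu> *\<^sub>R l) \<in> K"
    by (rule closed_sequentially[OF closed u[rule_format]])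
  then show "f \<in> {f. \<exists>u. (u, f - \<mu> *\<^sub>R u) \<in> K}" by blast
qed

text \<open>The range of \<open>\<mu> + K\<close> is closed by the bound on the inverse, and it is dense since a vector
  orthogonal to it is an eigenvector of the adjoint, which is \<open>K\<close>, for the eigenvalue \<open>- \<mu>\<close>.\<close>

lemma resolvent_exists:
  assumes K: "self_adjoint_op K"
    and contr: "\<And>u f. (u, f - \<mu> *\<^sub>R u) \<in> K \<Longrightarrow> norm u \<le> norm f"
  shows "\<exists>u. (u, f - \<mu> *\<^sub>R u) \<in> K"
proof -
  have lin: "linear_op K" and adj: "adjoint_op K = K"
    using K by (auto simp: self_adjoint_op_def)
  define R where "R = {f. \<exists>u. (u, f - \<mu> *\<^sub>R u) \<in> K}"
  have "closed R"
    unfolding R_def using linear_op_diff[OF lin] closed_self_adjoint_op[OF K] contr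
    by (rule closed_resolvent_range)
  have scale: "(scaleC_L2 a u, scaleC_L2 a v) \<in> K" if "(u, v) \<in> K" for a u v
    using lin that unfolding linear_op_def by blast
  have mem: "v + \<mu> *\<^sub>R u \<in> R" if "(u, v) \<in> K" for u v
    unfolding R_def using that by (intro CollectI exI[of _ u]) simp
  have "closure R = UNIV"
  proof (rule dense_subspace_if_no_orthogonal)
    show "subspace R"
    proof (rule subspaceI)
      show "0 \<in> R" using mem[of 0 0] lin by (simp add: linear_op_def)
      fix x assume "x \<in> R"
      then obtain u where u: "(u, x - \<mu> *\<^sub>R u) \<in> K" by (auto simp: R_def)
      {
        fix y assume "y \<in> R"
        then obtain v where v: "(v, y - \<mu> *\<^sub>R v) \<in> K" by (auto simp: R_def)
        have "(u + v, (x - \<mu> *\<^sub>R u) + (y - \<mu> *\<^sub>R v)) \<in> K"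
          using lin u v unfolding linear_op_def by blast
        from mem[OF this] show "x + y \<in> R" by (simp add: algebra_simps)
      }
      fix r :: real
      have "(r *\<^sub>R u, r *\<^sub>R (x - \<mu> *\<^sub>R u)) \<in> K"
        using scale[OF u, of "of_real r"] by (simp add: scaleC_of_real)
      from mem[OF this] show "r *\<^sub>R x \<in> R" by (simp add: algebra_simps)
    qed
    fix x assume orth: "\<And>f. f \<in> R \<Longrightarrow> inner f x = 0"
    have "inner v x = inner u (- \<mu> *\<^sub>R x)" if "(u, v) \<in> K" for u v
      using orth[OF mem[OF that]] by (simp add: inner_add_left)
    moreover have "(x, - \<mu> *\<^sub>R x) \<in> adjoint_op K \<longleftrightarrow> (\<forall>(u, v)\<in>K. inner v x = inner u (- \<mu> *\<^sub>R x))"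
      by (rule adjoint_op_real) (rule scale)
    ultimately have "(x, - \<mu> *\<^sub>R x) \<in> adjoint_op K" by blast
    then have "(x, 0 - \<mu> *\<^sub>R x) \<in> K" unfolding adj by simp
    from contr[OF this] show "x = 0" by simp
  qed
  then have "R = UNIV" using \<open>closed R\<close> by simp
  then show ?thesis unfolding R_def by blast
qed

section \<open>Uniqueness\<close>

text \<open>The product rule \<open>(c \<phi>')' = c' \<phi>' + c \<phi>''\<close> in weak form: test the weak derivative of \<open>c\<close> against
  \<open>\<psi> \<phi>'\<close>.\<close>

lemma real_test_function_in_divergence_form_op:
  fixes \<phi> :: "real \<Rightarrow> real"
  assumes c_weak: "has_weak_derivative c g" and c: "Linf_loc c" and g: "Linf_loc g"
    and \<phi>: "test_function \<phi>"
  defines "L \<equiv> \<lambda>x. g x * deriv \<phi> x + c x * deriv (deriv \<phi>) x"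
  shows "square_integrable (\<lambda>x. of_real (- L x))"
    and "(abs_L2 (\<lambda>x. of_real (\<phi> x)), abs_L2 (\<lambda>x. of_real (- L x))) \<in> divergence_form_op c"
proof -
  note \<phi>1 = test_function_deriv[OF \<phi>] and \<phi>2 = test_function_deriv[OF test_function_deriv[OF \<phi>]]
  have "square_integrable (\<lambda>x. of_real (g x * deriv \<phi> x) + of_real (c x * deriv (deriv \<phi>) x))"
    by (intro square_integrable_add square_integrable_real_test g c \<phi>1 \<phi>2)
  from square_integrable_scale[OF this, of "-1"] show sq: "square_integrable (\<lambda>x. of_real (- L x))"
    by (simp add: L_def)
  have lin: "test_function (\<lambda>x. complex_of_real (\<phi> x))"
    by (rule test_function_linear[OF bounded_linear_of_real \<phi>])
  have vd: "vector_derivative (\<lambda>x. complex_of_real (\<phi> x)) (at x) = of_real (deriv \<phi> x)" for x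
  proof (rule vector_derivative_at)
    have "(\<phi> has_vector_derivative deriv \<phi> x) (at x)"
      using test_function_DERIV[OF \<phi>, of x] by (simp add: has_real_derivative_iff_has_vector_derivative)
    from bounded_linear.has_vector_derivative[OF bounded_linear_of_real this]
    show "((\<lambda>x. complex_of_real (\<phi> x)) has_vector_derivative of_real (deriv \<phi> x)) (at x)" .
  qed
  have cont1: "continuous_on UNIV (deriv \<phi>)" "continuous_on UNIV (deriv (deriv \<phi>))"
    using primitive_test_function(3)[OF \<phi>1] primitive_test_function(3)[OF \<phi>2] .
  have L_Linf: "Linf_loc L"
    unfolding L_def by (intro Linf_loc_add Linf_loc_mult g c Linf_loc_continuous cont1)
  have c\<phi>: "Linf_loc (\<lambda>x. c x * deriv \<phi> x)"
    by (intro Linf_loc_mult c Linf_loc_continuous cont1)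
  define v where "v = abs_L2 (\<lambda>x. complex_of_real (- L x))"
  have v: "AE x in lborel. rep_L2 v x = of_real (- L x)"
    unfolding v_def by (rule rep_abs_L2[OF sq])
  have byparts: "(\<integral>x. deriv \<psi> x * (c x * deriv \<phi> x) \<partial>lborel) = - (\<integral>x. \<psi> x * L x \<partial>lborel)"
    if \<psi>: "test_function \<psi>" for \<psi> :: "real \<Rightarrow> real"
  proof -
    have p: "test_function (\<lambda>x. \<psi> x * deriv \<phi> x)"
      using test_function_scaleR[OF test_function_smooth[OF \<psi>] \<phi>1] by simp
    have dp: "deriv (\<lambda>x. \<psi> x * deriv \<phi> x) x = deriv \<psi> x * deriv \<phi> x + \<psi> x * deriv (deriv \<phi>) x" for x
      using DERIV_mult[OF test_function_DERIV[OF \<psi>, of x] test_function_DERIV[OF \<phi>1, of x]]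
      by (intro DERIV_imp_deriv) (simp add: algebra_simps)
    have "(\<integral>x. deriv (\<lambda>x. \<psi> x * deriv \<phi> x) x * c x \<partial>lborel) = - (\<integral>x. (\<psi> x * deriv \<phi> x) * g x \<partial>lborel)"
      using c_weak p unfolding has_weak_derivative_def by simp
    then have weak: "(\<integral>x. (deriv \<psi> x * deriv \<phi> x + \<psi> x * deriv (deriv \<phi>) x) * c x \<partial>lborel)
        = - (\<integral>x. (\<psi> x * deriv \<phi> x) * g x \<partial>lborel)"
      unfolding dp .
    have i: "integrable lborel (\<lambda>x. deriv \<psi> x * (c x * deriv \<phi> x))"
      "integrable lborel (\<lambda>x. \<psi> x * (c x * deriv (deriv \<phi>) x))"
      "integrable lborel (\<lambda>x. \<psi> x * (g x * deriv \<phi> x))"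
      using integrable_test_times_locally_integrable[OF test_function_deriv[OF \<psi>] Linf_loc_locally_integrable[OF c\<phi>]]
        integrable_test_times_locally_integrable[OF \<psi> Linf_loc_locally_integrable[OF Linf_loc_mult[OF c Linf_loc_continuous[OF cont1(2)]]]]
        integrable_test_times_locally_integrable[OF \<psi> Linf_loc_locally_integrable[OF Linf_loc_mult[OF g Linf_loc_continuous[OF cont1(1)]]]]
      by simp_all
    have "(\<integral>x. (deriv \<psi> x * deriv \<phi> x + \<psi> x * deriv (deriv \<phi>) x) * c x \<partial>lborel)
        = (\<integral>x. deriv \<psi> x * (c x * deriv \<phi> x) + \<psi> x * (c x * deriv (deriv \<phi>) x) \<partial>lborel)"
      by (intro Bochner_Integration.integral_cong) (simp_all add: algebra_simps)
    also have "\<dots> = (\<integral>x. deriv \<psi> x * (c x * deriv \<phi> x) \<partial>lborel) + (\<integral>x. \<psi> x * (c x * deriv (deriv \<phi>) x) \<partial>lborel)"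
      by (rule Bochner_Integration.integral_add[OF i(1,2)])
    finally have 1: "(\<integral>x. deriv \<psi> x * (c x * deriv \<phi> x) \<partial>lborel) + (\<integral>x. \<psi> x * (c x * deriv (deriv \<phi>) x) \<partial>lborel)
        = - (\<integral>x. (\<psi> x * deriv \<phi> x) * g x \<partial>lborel)"
      using weak by simp
    have "(\<integral>x. \<psi> x * L x \<partial>lborel) = (\<integral>x. \<psi> x * (g x * deriv \<phi> x) + \<psi> x * (c x * deriv (deriv \<phi>) x) \<partial>lborel)"
      by (intro Bochner_Integration.integral_cong) (simp_all add: L_def algebra_simps)
    also have "\<dots> = (\<integral>x. \<psi> x * (g x * deriv \<phi> x) \<partial>lborel) + (\<integral>x. \<psi> x * (c x * deriv (deriv \<phi>) x) \<partial>lborel)"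
      by (rule Bochner_Integration.integral_add[OF i(3,2)])
    also have "(\<integral>x. \<psi> x * (g x * deriv \<phi> x) \<partial>lborel) = (\<integral>x. (\<psi> x * deriv \<phi> x) * g x \<partial>lborel)"
      by (intro Bochner_Integration.integral_cong) (simp_all add: algebra_simps)
    finally show ?thesis using 1 by linarith
  qed
  have "has_weak_derivative (\<lambda>x. c x *\<^sub>R vector_derivative (\<lambda>x. complex_of_real (\<phi> x)) (at x)) (\<lambda>x. - rep_L2 v x)"
    unfolding has_weak_derivative_def vd
  proof (intro conjI allI impI)
    have "locally_integrable (\<lambda>x. complex_of_real (c x * deriv \<phi> x))"
      by (rule locally_integrable_linear[OF bounded_linear_of_real Linf_loc_locally_integrable[OF c\<phi>]])
    then show "locally_integrable (\<lambda>x. c x *\<^sub>R complex_of_real (deriv \<phi> x))"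
      by (simp add: scaleR_conv_of_real)
    show "locally_integrable (\<lambda>x. - rep_L2 v x)"
      by (intro square_integrable_locally_integrable square_integrable_uminus square_integrable_rep_L2)
    fix \<psi> :: "real \<Rightarrow> real" assume \<psi>: "test_function \<psi>"
    have "(\<integral>x. deriv \<psi> x *\<^sub>R (c x *\<^sub>R complex_of_real (deriv \<phi> x)) \<partial>lborel)
        = (\<integral>x. complex_of_real (deriv \<psi> x * (c x * deriv \<phi> x)) \<partial>lborel)"
      by (simp add: scaleR_conv_of_real)
    also have "\<dots> = complex_of_real (\<integral>x. deriv \<psi> x * (c x * deriv \<phi> x) \<partial>lborel)"
      by (rule integral_complex_of_real)
    also have "\<dots> = - complex_of_real (\<integral>x. \<psi> x * L x \<partial>lborel)"
      unfolding byparts[OF \<psi>] by simp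
    also have "\<dots> = - (\<integral>x. complex_of_real (\<psi> x * L x) \<partial>lborel)"
      unfolding integral_complex_of_real ..
    also have "(\<integral>x. complex_of_real (\<psi> x * L x) \<partial>lborel) = (\<integral>x. \<psi> x *\<^sub>R (- rep_L2 v x) \<partial>lborel)"
    proof (rule integral_cong_AE)
      have [measurable]: "\<psi> \<in> borel_measurable borel" "L \<in> borel_measurable borel" "rep_L2 v \<in> borel_measurable borel"
        using test_function_measurable[OF \<psi>] Linf_loc_measurable[OF L_Linf] square_integrable_rep_L2[of v]
        by (auto simp: square_integrable_def)
      show "(\<lambda>x. complex_of_real (\<psi> x * L x)) \<in> borel_measurable lborel" by measurable
      show "(\<lambda>x. \<psi> x *\<^sub>R (- rep_L2 v x)) \<in> borel_measurable lborel" by measurable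
      show "AE x in lborel. complex_of_real (\<psi> x * L x) = \<psi> x *\<^sub>R (- rep_L2 v x)"
        using v by eventually_elim (simp add: scaleR_conv_of_real)
    qed
    finally show "(\<integral>x. deriv \<psi> x *\<^sub>R (c x *\<^sub>R complex_of_real (deriv \<phi> x)) \<partial>lborel)
        = - (\<integral>x. \<psi> x *\<^sub>R (- rep_L2 v x) \<partial>lborel)" .
  qed
  then show "(abs_L2 (\<lambda>x. of_real (\<phi> x)), abs_L2 (\<lambda>x. of_real (- L x))) \<in> divergence_form_op c"
    unfolding divergence_form_op_def v_def[symmetric] using lin by blast
qed

lemma bounded_adjoint_eigenvector_zero:
  assumes c_weak: "has_weak_derivative c g" and c: "Linf_loc c" and g: "Linf_loc g"
    and c_nonneg: "AE x in lborel. 0 \<le> c x"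
    and lam: "\<mu> > 0" and adj: "(w, - (\<mu> *\<^sub>R w)) \<in> adjoint_op (divergence_form_op c)"
    and w_bound: "AE x in lborel. Im (rep_L2 w x) = 0 \<and> \<bar>Re (rep_L2 w x)\<bar> \<le> M"
  shows "w = 0"
proof -
  \<comment> \<open>a real representative that is bounded everywhere\<close>
  define f where "f x = max (- M) (min M (Re (rep_L2 w x)))" for x
  have [measurable]: "rep_L2 w \<in> borel_measurable borel"
    using square_integrable_rep_L2[of w] by (simp add: square_integrable_def)
  have f_meas [measurable]: "f \<in> borel_measurable borel" unfolding f_def by measurable
  have wf: "AE x in lborel. rep_L2 w x = of_real (f x)"
    using w_bound by eventually_elim (auto simp: f_def complex_eq_iff)
  have sq: "square_integrable (\<lambda>x. complex_of_real (f x))"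
  proof (rule square_integrable_bound[OF square_integrable_rep_L2[of w]])
    show "AE x in lborel. norm (complex_of_real (f x)) \<le> norm (rep_L2 w x)"
      using wf by eventually_elim simp
  qed measurable
  have w: "w = abs_L2 (\<lambda>x. of_real (f x))"
    using abs_L2_eqI[OF square_integrable_rep_L2[of w] sq wf] by (simp add: abs_rep_L2)
  have "AE x in lborel. f x = 0"
  proof (rule bounded_solution_zero[OF c_weak c g c_nonneg f_meas _ _ lam])
    show "\<bar>f x\<bar> \<le> \<bar>M\<bar>" for x by (auto simp: f_def)
    show "integrable lborel (\<lambda>x. (f x)\<^sup>2)" using sq by (simp add: square_integrable_def)
    fix \<psi> :: "real \<Rightarrow> real" assume \<psi>: "test_function \<psi>"
    define L where "L x = g x * deriv \<psi> x + c x * deriv (deriv \<psi>) x" for x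
    have sL: "square_integrable (\<lambda>x. of_real (- L x))"
      and mem: "(abs_L2 (\<lambda>x. of_real (\<psi> x)), abs_L2 (\<lambda>x. of_real (- L x))) \<in> divergence_form_op c"
      using real_test_function_in_divergence_form_op[OF c_weak c g \<psi>] unfolding L_def by blast+
    have s\<psi>: "square_integrable (\<lambda>x. of_real (\<psi> x))"
      using square_integrable_real_test[OF Linf_loc_continuous[OF continuous_on_const[of _ 1]] \<psi>] by simp
    have "inner (abs_L2 (\<lambda>x. of_real (- L x))) w = inner (abs_L2 (\<lambda>x. of_real (\<psi> x))) (- (\<mu> *\<^sub>R w))"
      by (rule adjoint_op_imp_inner[OF adj mem])
    then have "inner (abs_L2 (\<lambda>x. of_real (- L x))) w = - \<mu> * inner (abs_L2 (\<lambda>x. of_real (\<psi> x))) w"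
      by simp
    then have "(\<integral>x. inner (complex_of_real (- L x)) (of_real (f x)) \<partial>lborel)
        = - \<mu> * (\<integral>x. inner (complex_of_real (\<psi> x)) (of_real (f x)) \<partial>lborel)"
      unfolding w inner_abs_L2[OF sL sq] inner_abs_L2[OF s\<psi> sq] .
    then have "(\<integral>x. L x * f x \<partial>lborel) = \<mu> * (\<integral>x. \<psi> x * f x \<partial>lborel)"
      by (simp add: inner_complex_def)
    then show "(\<integral>x. (g x * deriv \<psi> x + c x * deriv (deriv \<psi>) x) * f x \<partial>lborel) = \<mu> * (\<integral>x. \<psi> x * f x \<partial>lborel)"
      unfolding L_def .
  qed
  then have "abs_L2 (\<lambda>x. complex_of_real (f x)) = abs_L2 (\<lambda>x. 0)"
    by (intro abs_L2_eqI sq square_integrable_zero) (auto elim: eventually_mono)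
  then show ?thesis by (simp add: w zero_L2_def)
qed

lemma submarkovian_extension_resolvent:
  assumes "submarkovian_extension H K"
  obtains \<Lambda> where "\<And>\<mu> u f. \<mu> \<ge> \<Lambda> \<Longrightarrow> (u, f - \<mu> *\<^sub>R u) \<in> K \<Longrightarrow> norm u \<le> norm f"
    "\<And>\<mu> u f. \<mu> \<ge> \<Lambda> \<Longrightarrow> \<mu> > 0 \<Longrightarrow> (u, f - \<mu> *\<^sub>R u) \<in> K \<Longrightarrow> between_0_1 f \<Longrightarrow>
       between_0_1 ((\<mu> / (1 + \<mu>)) *\<^sub>R u)"
proof -
  obtain m where m: "\<And>u v. (u, v) \<in> K \<Longrightarrow> m * (norm u)\<^sup>2 \<le> Re (cinner_L2 v u)"
    using assms unfolding submarkovian_extension_def lower_semibounded_def by blast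
  obtain S where S: "generates K S" "submarkovian S"
    using assms unfolding submarkovian_extension_def by blast
  then have C0: "C0_semigroup S" and K: "K = {(u, v). ((\<lambda>t. (S t u - u) /\<^sub>R t) \<longlongrightarrow> - v) (at_right 0)}"
    unfolding generates_def by blast+
  obtain B \<omega> where B: "B \<ge> 1" "\<And>t u. t \<ge> 0 \<Longrightarrow> norm (S t u) \<le> B * exp (\<omega> * t) * norm u"
    using C0_semigroup_growth[OF C0] by metis
  define \<Lambda> where "\<Lambda> = max (1 - m) (\<omega> + 1)"
  show thesis
  proof (rule that[of \<Lambda>])
    fix \<mu> u f assume \<mu>: "\<mu> \<ge> \<Lambda>" and uf: "(u, f - \<mu> *\<^sub>R u) \<in> K"
    have "\<mu> \<ge> 1 - m" using \<mu> by (simp add: \<Lambda>_def)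
    from resolvent_contraction[OF m this uf] show "norm u \<le> norm f" .
  next
    fix \<mu> u f assume \<mu>: "\<mu> \<ge> \<Lambda>" "\<mu> > 0" and uf: "(u, f - \<mu> *\<^sub>R u) \<in> K" and f: "between_0_1 f"
    have "\<mu> > \<omega>" using \<mu> by (simp add: \<Lambda>_def)
    moreover have "((\<lambda>t. (S t u - u) /\<^sub>R t) \<longlongrightarrow> - (f - \<mu> *\<^sub>R u)) (at_right 0)"
      using uf unfolding K by blast
    ultimately show "between_0_1 ((\<mu> / (1 + \<mu>)) *\<^sub>R u)"
      using resolvent_between_0_1[OF C0 S(2) B \<mu>(2)] f by blast
  qed
qed

lemma between_0_1_scaled_bound:
  assumes "between_0_1 (r *\<^sub>R u)" "r > 0"
  shows "AE x in lborel. Im (rep_L2 u x) = 0 \<and> 0 \<le> Re (rep_L2 u x) \<and> Re (rep_L2 u x) \<le> 1 / r"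
proof -
  have "r *\<^sub>R u = abs_L2 (\<lambda>x. r *\<^sub>R rep_L2 u x)"
    using abs_L2_scaleR[OF square_integrable_rep_L2[of u], of r] by (simp add: abs_rep_L2)
  then have "AE x in lborel. 0 \<le> r *\<^sub>R rep_L2 u x \<and> r *\<^sub>R rep_L2 u x \<le> 1"
    using assms(1) between_0_1_abs[OF square_integrable_scaleR[OF square_integrable_rep_L2]] by simp
  then show ?thesis
    unfolding complex_between_0_1
    by eventually_elim (use assms(2) in \<open>auto simp: zero_le_mult_iff field_simps\<close>)
qed

text \<open>The set \<open>D\<close> of all \<open>f\<close> for which both resolvents agree is a closed subspace. It contains all functions
  with values in the unit interval, because for these the difference of the resolvents is a bounded
  eigenvector of the adjoint; hence \<open>D\<close> is the whole space.\<close>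

lemma submarkovian_extension_subset:
  assumes c_weak: "has_weak_derivative c g" and c: "Linf_loc c" and g: "Linf_loc g"
    and c_nonneg: "AE x in lborel. 0 \<le> c x"
    and K1: "submarkovian_extension (divergence_form_op c) K1"
    and K2: "submarkovian_extension (divergence_form_op c) K2"
  shows "K1 \<subseteq> K2"
proof -
  have sa: "self_adjoint_op K1" "self_adjoint_op K2" and H: "divergence_form_op c \<subseteq> K1" "divergence_form_op c \<subseteq> K2"
    using K1 K2 by (auto simp: submarkovian_extension_def)
  have lin: "linear_op K1" "linear_op K2" and adj: "adjoint_op K1 = K1" "adjoint_op K2 = K2"
    using sa by (auto simp: self_adjoint_op_def)
  obtain \<Lambda>1 where L1: "\<And>\<mu> u f. \<mu> \<ge> \<Lambda>1 \<Longrightarrow> (u, f - \<mu> *\<^sub>R u) \<in> K1 \<Longrightarrow> norm u \<le> norm f"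
    "\<And>\<mu> u f. \<mu> \<ge> \<Lambda>1 \<Longrightarrow> \<mu> > 0 \<Longrightarrow> (u, f - \<mu> *\<^sub>R u) \<in> K1 \<Longrightarrow> between_0_1 f \<Longrightarrow> between_0_1 ((\<mu> / (1 + \<mu>)) *\<^sub>R u)"
    by (rule submarkovian_extension_resolvent[OF K1]) blast
  obtain \<Lambda>2 where L2: "\<And>\<mu> u f. \<mu> \<ge> \<Lambda>2 \<Longrightarrow> (u, f - \<mu> *\<^sub>R u) \<in> K2 \<Longrightarrow> norm u \<le> norm f"
    "\<And>\<mu> u f. \<mu> \<ge> \<Lambda>2 \<Longrightarrow> \<mu> > 0 \<Longrightarrow> (u, f - \<mu> *\<^sub>R u) \<in> K2 \<Longrightarrow> between_0_1 f \<Longrightarrow> between_0_1 ((\<mu> / (1 + \<mu>)) *\<^sub>R u)"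
    by (rule submarkovian_extension_resolvent[OF K2]) blast
  \<comment> \<open>large enough for the resolvent estimates of both extensions\<close>
  define \<mu> where "\<mu> = max 1 (max \<Lambda>1 \<Lambda>2)"
  have \<mu>: "\<mu> \<ge> \<Lambda>1" "\<mu> \<ge> \<Lambda>2" "\<mu> > 0" by (auto simp: \<mu>_def)
  have rpos: "\<mu> / (1 + \<mu>) > 0" using \<mu>(3) by simp
  define D where "D = {f. \<exists>u. (u, f - \<mu> *\<^sub>R u) \<in> K1 \<inter> K2}"
  have "f \<in> D" for f
  proof (rule L2_closed_span_between_0_1)
    show "closed D"
      unfolding D_def
    proof (rule closed_resolvent_range)
      show "closed (K1 \<inter> K2)" using sa by (intro closed_Int closed_self_adjoint_op)
      show "(u - u', v - v') \<in> K1 \<inter> K2" if "(u, v) \<in> K1 \<inter> K2" "(u', v') \<in> K1 \<inter> K2" for u v u' v'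
        using that linear_op_diff lin by blast
      show "norm u \<le> norm f" if "(u, f - \<mu> *\<^sub>R u) \<in> K1 \<inter> K2" for u f
        using that L1(1)[OF \<mu>(1)] by blast
    qed
    have memD: "v + \<mu> *\<^sub>R u \<in> D" if "(u, v) \<in> K1" "(u, v) \<in> K2" for u v
      unfolding D_def using that by (intro CollectI exI[of _ u]) simp
    show "x + y \<in> D" if "x \<in> D" "y \<in> D" for x y
    proof -
      obtain u where u: "(u, x - \<mu> *\<^sub>R u) \<in> K1 \<inter> K2" using \<open>x \<in> D\<close> by (auto simp: D_def)
      obtain v where v: "(v, y - \<mu> *\<^sub>R v) \<in> K1 \<inter> K2" using \<open>y \<in> D\<close> by (auto simp: D_def)
      have "(u + v, (x - \<mu> *\<^sub>R u) + (y - \<mu> *\<^sub>R v)) \<in> K1" "(u + v, (x - \<mu> *\<^sub>R u) + (y - \<mu> *\<^sub>R v)) \<in> K2"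
        using lin u v unfolding linear_op_def by blast+
      from memD[OF this] show ?thesis by (simp add: algebra_simps)
    qed
    show "scaleC_L2 a x \<in> D" if xD: "x \<in> D" for a x
    proof -
      obtain u where u: "(u, x - \<mu> *\<^sub>R u) \<in> K1 \<inter> K2" using xD by (auto simp: D_def)
      have "(scaleC_L2 a u, scaleC_L2 a (x - \<mu> *\<^sub>R u)) \<in> K1" "(scaleC_L2 a u, scaleC_L2 a (x - \<mu> *\<^sub>R u)) \<in> K2"
        using lin u unfolding linear_op_def by blast+
      from memD[OF this] show ?thesis by (simp add: scaleC_diff scaleC_scaleR)
    qed
    show "x \<in> D" if x: "between_0_1 x" for x
    proof -
      obtain u1 where u1: "(u1, x - \<mu> *\<^sub>R u1) \<in> K1"
        using resolvent_exists[OF sa(1) L1(1)[OF \<mu>(1)]] by blast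
      obtain u2 where u2: "(u2, x - \<mu> *\<^sub>R u2) \<in> K2"
        using resolvent_exists[OF sa(2) L2(1)[OF \<mu>(2)]] by blast
      define w where "w = u1 - u2"
      have b1: "AE x in lborel. Im (rep_L2 u1 x) = 0 \<and> 0 \<le> Re (rep_L2 u1 x) \<and> Re (rep_L2 u1 x) \<le> 1 / (\<mu> / (1 + \<mu>))"
        by (rule between_0_1_scaled_bound[OF L1(2)[OF \<mu>(1,3) u1 x] rpos])
      have b2: "AE x in lborel. Im (rep_L2 u2 x) = 0 \<and> 0 \<le> Re (rep_L2 u2 x) \<and> Re (rep_L2 u2 x) \<le> 1 / (\<mu> / (1 + \<mu>))"
        by (rule between_0_1_scaled_bound[OF L2(2)[OF \<mu>(2,3) u2 x] rpos])
      have "w = abs_L2 (\<lambda>x. rep_L2 u1 x - rep_L2 u2 x)"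
        unfolding w_def using abs_L2_diff[OF square_integrable_rep_L2[of u1] square_integrable_rep_L2[of u2]]
        by (simp add: abs_rep_L2)
      then have "AE x in lborel. rep_L2 w x = rep_L2 u1 x - rep_L2 u2 x"
        using rep_abs_L2[OF square_integrable_diff[OF square_integrable_rep_L2 square_integrable_rep_L2]] by simp
      with b1 b2 have wb: "AE x in lborel. Im (rep_L2 w x) = 0 \<and> \<bar>Re (rep_L2 w x)\<bar> \<le> 1 / (\<mu> / (1 + \<mu>))"
      proof eventually_elim
        case (elim x)
        then show ?case by (auto simp: abs_le_iff)
      qed
      have "(w, - (\<mu> *\<^sub>R w)) \<in> adjoint_op (divergence_form_op c)"
        unfolding adjoint_op_def
      proof (clarify)
        fix a b assume ab: "(a, b) \<in> divergence_form_op c"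
        have "cinner_L2 b u1 = cinner_L2 a (x - \<mu> *\<^sub>R u1)"
          using ab H u1 adj unfolding adjoint_op_def by blast
        moreover have "cinner_L2 b u2 = cinner_L2 a (x - \<mu> *\<^sub>R u2)"
          using ab H u2 adj unfolding adjoint_op_def by blast
        ultimately show "cinner_L2 b w = cinner_L2 a (- (\<mu> *\<^sub>R w))"
          unfolding cinner_eq_inner w_def by (auto simp: inner_diff algebra_simps)
      qed
      from bounded_adjoint_eigenvector_zero[OF c_weak c g c_nonneg \<mu>(3) this wb] have "u1 = u2"
        by (simp add: w_def)
      then show ?thesis using u1 u2 unfolding D_def by blast
    qed
  qed
  show ?thesis
  proof (clarify)
    fix u v assume uv: "(u, v) \<in> K1"
    obtain u' where u': "(u', v + \<mu> *\<^sub>R u - \<mu> *\<^sub>R u') \<in> K1" "(u', v + \<mu> *\<^sub>R u - \<mu> *\<^sub>R u') \<in> K2"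
      using \<open>v + \<mu> *\<^sub>R u \<in> D\<close> unfolding D_def by blast
    have "(u - u', 0 - \<mu> *\<^sub>R (u - u')) \<in> K1"
      using linear_op_diff[OF lin(1) uv u'(1)] by (simp add: algebra_simps)
    from L1(1)[OF \<mu>(1) this] have "u' = u" by simp
    then show "(u, v) \<in> K2" using u'(2) by simp
  qed
qed

theorem theorem1p3:
  fixes c :: "real \<Rightarrow> real"
  assumes "W1inf_loc c"
    and "AE x in lborel. 0 \<le> c x"
  shows "\<exists>!K. submarkovian_extension (divergence_form_op c) K"
proof -
  obtain g where c: "Linf_loc c" and g: "Linf_loc g" and weak: "has_weak_derivative c g"
    using assms(1) unfolding W1inf_loc_def by blast
  note subset = submarkovian_extension_subset[OF weak c g assms(2)]
  show ?thesis
  proof (rule ex1I)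
    show "submarkovian_extension (divergence_form_op c) (Friedrichs c)"
      by (rule submarkovian_extension_Friedrichs[OF c assms(2)])
    fix K assume K: "submarkovian_extension (divergence_form_op c) K"
    show "K = Friedrichs c"
      using subset[OF K submarkovian_extension_Friedrichs[OF c assms(2)]]
        subset[OF submarkovian_extension_Friedrichs[OF c assms(2)] K] by (rule subset_antisym)
  qed
qed

end
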